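(* Let $\mathcal R\in\widehat U_2=(U(\mathfrak g)^{\widehat\otimes2})_{\rm univ}$ be a solution of the quantum Yang–Baxter equation $\mathcal R^{1,2}\mathcal R^{1,3}\mathcal R^{2,3}=\mathcal R^{2,3}\mathcal R^{1,3}\mathcal R^{1,2}$ in $\widehat U_3$. Let $\mathcal R_N$ ($N\ge0$) be the homogeneous components of $\mathcal R$, and assume that $\mathcal R_0=1$ and $\mathcal R_1=r$. Then for each $N\ge1$, $$\mathcal R_N\in(U(\mathfrak g)\widehat\otimes U(\mathfrak a)U(\mathfrak b)_0)_{\rm univ}\quad\text{and}\quad \mathcal R_N\in(U(\mathfrak a)_0U(\mathfrak b)\widehat\otimes U(\mathfrak g))_{\rm univ}.$$
   Context: $\mathbb K$ is a field of characteristic $0$. Let $\mathcal{FA}_N$ be the free associative algebra on $N$ generators, graded by $\oplus_{i=1}^N\mathbb N\delta_i$ (the $i$-th generator has degree $\delta_i$); the index $\sum_i\delta_i$ denotes the multilinear part. **Universal algebras.** $U_n=(U(\mathfrak g)^{\otimes n})_{\rm univ}:=\bigoplus_{N\ge0}\big((\mathcal{FA}_N^{\otimes n})_{\sum_i\delta_i}\otimes(\mathcal{FA}_N^{\otimes n})_{\sum_i\delta_i}\big)_{\mathfrak S_N}$ (coinvariants for simultaneous renumbering of generators). The class of $(P_1\otimes\cdots\otimes P_n)\otimes(Q_1\otimes\cdots\otimes Q_n)$ is written as the normally ordered expression $\bigotimes_{\alpha=1}^n P_\alpha(a_1,\dots,a_N)Q_\alpha(b_1,\dots,b_N)$ (in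 each tensor factor all letters $a$ stand to the left of all letters $b$; each of $a_1,\dots,a_N,b_1,\dots,b_N$ occurs exactly once overall); it has degree $N$. Product: renumber so that the letters of the two elements are disjoint, concatenate in each tensor factor, then bring to normal order by repeatedly applying the rule coming from the classical Yang–Baxter equation: an adjacent pair $b_ia_j$ in some factor is replaced by the sum of three expressions: (i) the pair replaced by $a_jb_i$; (ii) minus the expression where the pair is replaced by $b_i$ and the letter $a_i$ (wherever it stands) is replaced by $[a_i,a_j]$; (iii) minus the expression where the pair is replaced by $a_j$ and the letter $b_j$ (wherever it stands) is replaced by $[b_i,b_j]$. This procedure terminates, gives a well-defined result, and makes $U_n$ a graded associative unital algebra. $\widehat U_n$ is its degree completion. **Insertions.** For distinct $i,j\in\{1,2,3\}$, $X\mapsto X^{i,j}$, $\widehat U_2\to\widehat U_3$ is the algebra morphism placing the first tensor factor of $X$ in position $i$, the second in position $j$, and $1$ in the remaining position. **Notation.** $r=a_1\otimes b_1\in U_2$ (degree $1$). $(U(\mathfrak g)\widehat\otimes U(\mathfrak a)U(\mathfrak b)_0)_{\rm univ}\subset\widehat U_2$ is the (completed) span of the normally ordered expressions whose second tensor factor contains at least one letter $b_i$; $(U(\mathfrak a)_0U(\mathfrak b)\widehat\otimes U(\mathfrak g))_{\rm univ}\subset\widehat U_2$ is the (completed) span of the normally ordered expressions whose first tensor factor contains at least one letter $a_i$. *)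

theory Defs
  imports Complex_Main "HOL-Library.Poly_Mapping" "HOL-Library.Multiset"
    "HOL-Library.Infinite_Set"
begin

section \<open>Expressions\<close>

text \<open>
  An expression with \<open>n\<close> tensor factors is a list of \<open>n\<close> words in the letters \<open>a_i\<close>, \<open>b_i\<close>.
\<close>

datatype letter = A nat | B nat

type_synonym expr = "letter list list"

definition multilinear :: "nat set \<Rightarrow> expr \<Rightarrow> bool" where
  "multilinear I e \<longleftrightarrow> distinct (concat e) \<and> set (concat e) = A ` I \<union> B ` I"

definition normally_ordered :: "expr \<Rightarrow> bool" where
  "normally_ordered e \<longleftrightarrow> (\<forall>w\<in>set e. \<exists>p q. w = map A p @ map B q)"

text \<open>
  The pairs (tuple of words in the \<open>a\<close>'s, tuple of words in the \<open>b\<close>'s) forming a basis of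
  the tensor square of the multilinear part of the \<open>n\<close>-th tensor power of the free algebra
  on \<open>N\<close> generators, written as normally ordered expressions.
\<close>

definition normal_exprs :: "nat \<Rightarrow> nat \<Rightarrow> expr set" where
  "normal_exprs n N = {e. length e = n \<and> normally_ordered e \<and> multilinear {1..N} e}"

primrec renumber_letter :: "(nat \<Rightarrow> nat) \<Rightarrow> letter \<Rightarrow> letter" where
  "renumber_letter \<sigma> (A i) = A (\<sigma> i)"
| "renumber_letter \<sigma> (B i) = B (\<sigma> i)"

definition renumber :: "(nat \<Rightarrow> nat) \<Rightarrow> expr \<Rightarrow> expr" where
  "renumber \<sigma> = map (map (renumber_letter \<sigma>))"

section \<open>Formal linear combinations\<close>

type_synonym 'k comb = "expr \<Rightarrow>\<^sub>0 'k"

definition cscale :: "'k::field_char_0 \<Rightarrow> 'k comb \<Rightarrow> 'k comb" where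
  "cscale c x = Poly_Mapping.map ((*) c) x"

lemma lookup_cscale [simp]: "Poly_Mapping.lookup (cscale c x) e = c * Poly_Mapping.lookup x e"
  by (simp add: cscale_def Poly_Mapping.map.rep_eq when_def)

global_interpretation comb: vector_space cscale
  defines comb_span = comb.span
  by unfold_locales (auto intro!: poly_mapping_eqI simp: lookup_add algebra_simps)

abbreviation single_expr :: "expr \<Rightarrow> 'k::field_char_0 comb" where
  "single_expr e \<equiv> Poly_Mapping.single e 1"

definition lin_ext :: "(expr \<Rightarrow> 'k::field_char_0 comb) \<Rightarrow> 'k comb \<Rightarrow> 'k comb" where
  "lin_ext f x = (\<Sum>e\<in>Poly_Mapping.keys x. cscale (Poly_Mapping.lookup x e) (f e))"

lemma lin_ext_superset:
  assumes "finite S" "Poly_Mapping.keys x \<subseteq> S"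
  shows "lin_ext f x = (\<Sum>e\<in>S. cscale (Poly_Mapping.lookup x e) (f e))"
  unfolding lin_ext_def using assms
  by (intro sum.mono_neutral_left) (auto simp: in_keys_iff)

lemma lin_ext_add: "lin_ext f (x + y) = lin_ext f x + lin_ext f y"
proof -
  let ?S = "Poly_Mapping.keys x \<union> Poly_Mapping.keys y"
  have "Poly_Mapping.keys (x + y) \<subseteq> ?S" by (rule Poly_Mapping.keys_add)
  then show ?thesis
    by (simp add: lin_ext_superset[where S = ?S] lookup_add comb.scale_left_distrib sum.distrib)
qed

lemma lin_ext_cscale: "lin_ext f (cscale c x) = cscale c (lin_ext f x)"
proof -
  have "Poly_Mapping.keys (cscale c x) \<subseteq> Poly_Mapping.keys x" by (auto simp: in_keys_iff)
  then show ?thesis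
    by (simp add: lin_ext_superset[where S = "Poly_Mapping.keys x"] comb.scale_sum_right)
qed

lemma lin_ext_diff: "lin_ext f (x - y) = lin_ext f x - lin_ext f y"
proof -
  have *: "x - y = x + cscale (- 1) y" by simp
  show ?thesis unfolding * lin_ext_add lin_ext_cscale by simp
qed

lemma lin_ext_single [simp]: "lin_ext f (single_expr e) = f e"
  by (simp add: lin_ext_def)

lemma lin_ext_zero [simp]: "lin_ext f 0 = 0"
  by (simp add: lin_ext_def)

lemma lin_ext_in_subspace:
  assumes "comb.subspace V" "\<And>e. e \<in> Poly_Mapping.keys x \<Longrightarrow> f e \<in> V"
  shows "lin_ext f x \<in> V"
  unfolding lin_ext_def using assms by (intro comb.subspace_sum comb.subspace_scale) auto

lemma lin_ext_diff_fun: "lin_ext f x - lin_ext g x = lin_ext (\<lambda>e. f e - g e) x"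
  by (simp add: lin_ext_def sum_subtractf comb.scale_right_diff_distrib)

lemma lin_ext_fun_add: "lin_ext (\<lambda>e. f e + g e) x = lin_ext f x + lin_ext g x"
  and lin_ext_fun_cscale: "lin_ext (\<lambda>e. cscale c (f e)) x = cscale c (lin_ext f x)"
  and lin_ext_fun_zero: "lin_ext (\<lambda>e. 0) x = 0"
  by (simp_all add: lin_ext_def comb.scale_right_distrib sum.distrib comb.scale_sum_right
      mult.commute)

section \<open>Normal ordering\<close>

text \<open>
  The leftmost adjacent pair \<open>b_i a_j\<close> of a word, with what precedes and what follows it;
  likewise for expressions, where also the preceding and following tensor factors are returned.
\<close>

fun split_word :: "letter list \<Rightarrow> (letter list \<times> nat \<times> nat \<times> letter list) option" where
  "split_word (B i # A j # w) = Some ([], i, j, w)"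
| "split_word (x # w) = map_option (\<lambda>(p, i, j, q). (x # p, i, j, q)) (split_word w)"
| "split_word [] = None"

fun split_expr ::
  "expr \<Rightarrow> (expr \<times> letter list \<times> nat \<times> nat \<times> letter list \<times> expr) option" where
  "split_expr [] = None"
| "split_expr (w # ws) =
    (case split_word w of
       Some (p, i, j, q) \<Rightarrow> Some ([], p, i, j, q, ws)
     | None \<Rightarrow> map_option (\<lambda>(us, s). (w # us, s)) (split_expr ws))"

definition subst :: "letter \<Rightarrow> letter list \<Rightarrow> expr \<Rightarrow> expr" where
  "subst x s = map (\<lambda>w. concat (map (\<lambda>y. if y = x then s else [y]) w))"

text \<open>
  The pairs \<open>(i, j)\<close> such that \<open>b_i\<close> stands to the left of \<open>a_j\<close> in one of the tensor factors.
\<close>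

fun ba_word :: "letter list \<Rightarrow> (nat \<times> nat) set" where
  "ba_word [] = {}"
| "ba_word (A i # w) = ba_word w"
| "ba_word (B i # w) = {(i, j) |j. A j \<in> set w} \<union> ba_word w"

definition ba :: "expr \<Rightarrow> (nat \<times> nat) set" where
  "ba e = (\<Union>w\<in>set e. ba_word w)"

text \<open>
  The procedure is only meaningful if it never meets a pair \<open>b_i a_i\<close>: in the rule for
  \<open>b_i a_j\<close> the letters \<open>a_i\<close> and \<open>b_j\<close> stand elsewhere. Acyclicity of \<open>ba\<close> excludes such pairs,
  holds for the concatenation of two normally ordered expressions with disjoint indices, and
  is preserved by the rule (lemmas \<open>admissible_juxtapose\<close> and \<open>admissible_step\<close> below).
\<close>

definition admissible :: "expr \<Rightarrow> bool" where
  "admissible e \<longleftrightarrow> (\<exists>I. multilinear I e) \<and> acyclic (ba e)"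

lemma split_word_SomeD: "split_word w = Some (p, i, j, q) \<Longrightarrow> w = p @ [B i, A j] @ q"
  by (induction w arbitrary: p i j q rule: split_word.induct) auto

lemma split_expr_SomeD:
  "split_expr e = Some (us, p, i, j, q, vs) \<Longrightarrow> e = us @ (p @ [B i, A j] @ q) # vs"
  by (induction e arbitrary: us p i j q vs)
     (auto split: option.splits dest!: split_word_SomeD)

lemma split_word_NoneD: "split_word w = None \<Longrightarrow> \<exists>p q. w = map A p @ map B q"
proof (induction w rule: split_word.induct)
  case (1 i j w)
  then show ?case by simp
next
  case ("2_1" v w)
  then obtain p q where "w = map A p @ map B q" by auto
  then have "A v # w = map A (v # p) @ map B q" by simp
  then show ?case by blast
next
  case ("2_2" x)
  have "x # [] = map A [] @ map B [case x of A i \<Rightarrow> i | B i \<Rightarrow> i] \<or>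
        x # [] = map A [case x of A i \<Rightarrow> i | B i \<Rightarrow> i] @ map B []"
    by (cases x) auto
  then show ?case by blast
next
  case ("2_3" x v w)
  then obtain p q where w: "B v # w = map A p @ map B q" by auto
  then have "p = []" by (cases p) auto
  show ?case
  proof (cases x)
    case (A i)
    then have "x # B v # w = map A [i] @ map B q" using w \<open>p = []\<close> by simp
    then show ?thesis by blast
  next
    case (B i)
    then have "x # B v # w = map A [] @ map B (i # q)" using w \<open>p = []\<close> by simp
    then show ?thesis by blast
  qed
next
  case 3
  then show ?case by simp
qed

lemma split_expr_NoneD: "split_expr e = None \<Longrightarrow> normally_ordered e"
  by (induction e)
     (auto simp: normally_ordered_def split: option.splits dest: split_word_NoneD)

lemma ba_word_iff: "(i, j) \<in> ba_word w \<longleftrightarrow> (\<exists>u v. w = u @ B i # v \<and> A j \<in> set v)"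
proof (induction w rule: ba_word.induct)
  case 1
  show ?case by simp
next
  case (2 k w)
  then show ?case by (auto simp: Cons_eq_append_conv)
next
  case (3 k w)
  then show ?case by (auto simp: Cons_eq_append_conv)
qed

lemma ba_word_append:
  "ba_word (u @ v) = ba_word u \<union> ba_word v \<union> {(i, j). B i \<in> set u \<and> A j \<in> set v}"
  by (induction u rule: ba_word.induct) auto

lemma ba_word_subset: "ba_word w \<subseteq> {(i, j). B i \<in> set w \<and> A j \<in> set w}"
  by (induction w rule: ba_word.induct) auto

lemma finite_A_inj: "finite {j. A j \<in> S}" if "finite S"
proof -
  have "{j. A j \<in> S} = A -` S" by auto
  then show ?thesis using that by (simp add: finite_vimageI inj_def)
qed

lemma finite_ba: "finite (ba e)"
proof -
  have "finite (ba_word w)" for w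
  proof (induction w rule: ba_word.induct)
    case (3 i w)
    have "{(i, j) |j. A j \<in> set w} = Pair i ` {j. A j \<in> set w}" by auto
    then show ?case using 3 by (simp add: finite_A_inj)
  qed auto
  then show ?thesis by (simp add: ba_def)
qed

lemma ba_append: "ba (us @ vs) = ba us \<union> ba vs"
  by (auto simp: ba_def)

lemma ba_Cons: "ba (w # vs) = ba_word w \<union> ba vs"
  by (auto simp: ba_def)

lemma ba_subset: "ba e \<subseteq> {(i, j). B i \<in> set (concat e) \<and> A j \<in> set (concat e)}"
  unfolding ba_def using ba_word_subset by fastforce

lemma ba_word_subst_A:
  assumes "set s = {A i, A j}" "ba_word s = {}"
  shows "ba_word (concat (map (\<lambda>y. if y = A i then s else [y]) w)) =
         ba_word w \<union> {(k, j) |k. (k, i) \<in> ba_word w}"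
  using assms by (induction w rule: ba_word.induct) (auto simp: ba_word_append)

lemma ba_word_subst_B:
  assumes "set s = {B i, B j}" "ba_word s = {}"
  shows "ba_word (concat (map (\<lambda>y. if y = B j then s else [y]) w)) =
         ba_word w \<union> {(i, k) |k. (j, k) \<in> ba_word w}"
  using assms by (induction w rule: ba_word.induct) (auto simp: ba_word_append)

lemma ba_subst_A:
  assumes "s = [A i, A j] \<or> s = [A j, A i]"
  shows "ba (subst (A i) s e) = ba e \<union> {(k, j) |k. (k, i) \<in> ba e}"
proof -
  have "set s = {A i, A j}" "ba_word s = {}" using assms by auto
  from ba_word_subst_A[OF this] show ?thesis by (auto simp: ba_def subst_def)
qed

lemma ba_subst_B:
  assumes "s = [B i, B j] \<or> s = [B j, B i]"
  shows "ba (subst (B j) s e) = ba e \<union> {(i, k) |k. (j, k) \<in> ba e}"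
proof -
  have "set s = {B i, B j}" "ba_word s = {}" using assms by auto
  from ba_word_subst_B[OF this] show ?thesis by (auto simp: ba_def subst_def)
qed

lemma ba_step:
  assumes "e = us @ (p @ [B i, A j] @ q) # vs" "multilinear I e" "acyclic (ba e)"
  shows "i \<noteq> j" "(i, j) \<in> ba e"
    and "ba (us @ (p @ [A j, B i] @ q) # vs) = ba e - {(i, j)}"
    and "ba (us @ (p @ [B i] @ q) # vs) \<subseteq> ba e - {(k, j) |k. True}"
    and "ba (us @ (p @ [A j] @ q) # vs) \<subseteq> ba e - {(i, k) |k. True}"
proof -
  have d: "distinct (concat e)" using assms(2) by (simp add: multilinear_def)
  show ij: "(i, j) \<in> ba e" unfolding assms(1) by (auto simp: ba_append ba_Cons ba_word_append)
  show "i \<noteq> j" using ij assms(3) by (auto simp: acyclic_def)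
  have nA: "A j \<notin> set (concat (us @ (p @ [B i] @ q) # vs))"
    and nB: "B i \<notin> set (concat (us @ (p @ [A j] @ q) # vs))"
    using d unfolding assms(1) by auto
  have "(i, j) \<notin> ba (us @ (p @ [A j, B i] @ q) # vs)"
    using nA nB ba_subset[of us] ba_subset[of vs] ba_word_subset[of p] ba_word_subset[of q]
    by (auto simp: ba_append ba_Cons ba_word_append)
  then show "ba (us @ (p @ [A j, B i] @ q) # vs) = ba e - {(i, j)}"
    unfolding assms(1) by (auto simp: ba_append ba_Cons ba_word_append)
  have "ba (us @ (p @ [B i] @ q) # vs) \<subseteq> ba e"
    unfolding assms(1) by (auto simp: ba_append ba_Cons ba_word_append)
  then show "ba (us @ (p @ [B i] @ q) # vs) \<subseteq> ba e - {(k, j) |k. True}"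
    using nA ba_subset[of "us @ (p @ [B i] @ q) # vs"] by blast
  have "ba (us @ (p @ [A j] @ q) # vs) \<subseteq> ba e"
    unfolding assms(1) by (auto simp: ba_append ba_Cons ba_word_append)
  then show "ba (us @ (p @ [A j] @ q) # vs) \<subseteq> ba e - {(i, k) |k. True}"
    using nB ba_subset[of "us @ (p @ [A j] @ q) # vs"] by blast
qed

lemma trancl_decrease_col:
  assumes "acyclic E" "(i, j) \<in> E" "F \<subseteq> E - {(k, j) |k. True}"
  shows "(F \<union> {(k, j) |k. (k, i) \<in> F})\<^sup>+ \<subset> E\<^sup>+"
proof -
  let ?E = "F \<union> {(k, j) |k. (k, i) \<in> F}"
  have "F \<subseteq> E" using assms(3) by blast
  have "?E \<subseteq> E\<^sup>+"
  proof
    fix x assume "x \<in> ?E"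
    then consider "x \<in> F" | k where "x = (k, j)" "(k, i) \<in> F" by blast
    then show "x \<in> E\<^sup>+"
    proof cases
      case 1
      then show ?thesis using \<open>F \<subseteq> E\<close> by (cases x) (blast intro: r_into_trancl)
    next
      case (2 k)
      then have "(k, i) \<in> E\<^sup>+" using \<open>F \<subseteq> E\<close> by (blast intro: r_into_trancl)
      then show ?thesis unfolding 2(1) using assms(2) by (rule trancl_into_trancl)
    qed
  qed
  then have sub: "?E\<^sup>+ \<subseteq> E\<^sup>+"
    using trancl_id[OF trans_trancl, of E] trancl_mono_subset[of ?E "E\<^sup>+"] by simp
  have "(i, j) \<notin> ?E\<^sup>+"
  proof
    assume "(i, j) \<in> ?E\<^sup>+"
    then obtain k where k: "(i, k) \<in> ?E\<^sup>*" "(k, j) \<in> ?E" by (meson tranclD2)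
    then have "(k, i) \<in> F" using assms(3) by auto
    then have "(k, i) \<in> ?E" by simp
    with k(1) have "(i, i) \<in> ?E\<^sup>+" by (rule rtrancl_into_trancl1)
    then have "(i, i) \<in> E\<^sup>+" using sub by blast
    then show False using assms(1) by (simp add: acyclic_def)
  qed
  then show ?thesis using sub assms(2) by blast
qed

lemma trancl_decrease_row:
  assumes "acyclic E" "(i, j) \<in> E" "F \<subseteq> E - {(i, k) |k. True}"
  shows "(F \<union> {(i, k) |k. (j, k) \<in> F})\<^sup>+ \<subset> E\<^sup>+"
proof -
  have *: "(F\<inverse> \<union> {(k, i) |k. (k, j) \<in> F\<inverse>})\<^sup>+ \<subset> (E\<inverse>)\<^sup>+"
    using assms by (intro trancl_decrease_col) auto
  have "F\<inverse> \<union> {(k, i) |k. (k, j) \<in> F\<inverse>} = (F \<union> {(i, k) |k. (j, k) \<in> F})\<inverse>" by auto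
  then show ?thesis using * by (simp add: trancl_converse psubset_eq)
qed

text \<open>
  The rule is always applied to the leftmost pair \<open>b_i a_j\<close> of the first tensor factor containing
  one; the result does not depend on this choice.
\<close>

function normal_order :: "expr \<Rightarrow> 'k::field_char_0 comb" where
  "normal_order e =
    (if admissible e then
       (case split_expr e of
          None \<Rightarrow> single_expr e
        | Some (us, p, i, j, q, vs) \<Rightarrow>
            normal_order (us @ (p @ [A j, B i] @ q) # vs)
            - (normal_order (subst (A i) [A i, A j] (us @ (p @ [B i] @ q) # vs))
               - normal_order (subst (A i) [A j, A i] (us @ (p @ [B i] @ q) # vs)))
            - (normal_order (subst (B j) [B i, B j] (us @ (p @ [A j] @ q) # vs))
               - normal_order (subst (B j) [B j, B i] (us @ (p @ [A j] @ q) # vs))))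
     else 0)"
  by pat_completeness auto

lemma
  assumes "admissible e" "split_expr e = Some (us, p, i, j, q, vs)"
  shows step_i: "(ba (us @ (p @ [A j, B i] @ q) # vs))\<^sup>+ \<subseteq> (ba e)\<^sup>+"
      "ba (us @ (p @ [A j, B i] @ q) # vs) \<subset> ba e"
    and step_ii: "s = [A i, A j] \<or> s = [A j, A i] \<Longrightarrow>
      (ba (subst (A i) s (us @ (p @ [B i] @ q) # vs)))\<^sup>+ \<subset> (ba e)\<^sup>+"
    and step_iii: "s = [B i, B j] \<or> s = [B j, B i] \<Longrightarrow>
      (ba (subst (B j) s (us @ (p @ [A j] @ q) # vs)))\<^sup>+ \<subset> (ba e)\<^sup>+"
proof -
  obtain I where "multilinear I e" and ac: "acyclic (ba e)"
    using assms(1) by (auto simp: admissible_def)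
  note * = ba_step[OF split_expr_SomeD[OF assms(2)] this]
  show 1: "ba (us @ (p @ [A j, B i] @ q) # vs) \<subset> ba e" using *(2,3) by auto
  show "(ba (us @ (p @ [A j, B i] @ q) # vs))\<^sup>+ \<subseteq> (ba e)\<^sup>+"
    using 1 by (meson psubset_imp_subset subrelI trancl_mono)
  show "(ba (subst (A i) s (us @ (p @ [B i] @ q) # vs)))\<^sup>+ \<subset> (ba e)\<^sup>+"
    if "s = [A i, A j] \<or> s = [A j, A i]"
    unfolding ba_subst_A[OF that] by (rule trancl_decrease_col[OF ac *(2,4)])
  show "(ba (subst (B j) s (us @ (p @ [A j] @ q) # vs)))\<^sup>+ \<subset> (ba e)\<^sup>+"
    if "s = [B i, B j] \<or> s = [B j, B i]"
    unfolding ba_subst_B[OF that] by (rule trancl_decrease_row[OF ac *(2,5)])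
qed

lemma finite_trancl_ba: "finite ((ba e)\<^sup>+)"
  by (simp add: finite_ba)

lemma measure_less_i:
  "(ba e')\<^sup>+ \<subseteq> (ba e)\<^sup>+ \<Longrightarrow> ba e' \<subset> ba e \<Longrightarrow>
    (e', e) \<in> measures [\<lambda>e. card ((ba e)\<^sup>+), \<lambda>e. card (ba e)]"
  using card_mono[OF finite_trancl_ba] psubset_card_mono[OF finite_ba] by (auto simp: le_less)

lemma measure_less_ii:
  "(ba e')\<^sup>+ \<subset> (ba e)\<^sup>+ \<Longrightarrow>
    (e', e) \<in> measures [\<lambda>e. card ((ba e)\<^sup>+), \<lambda>e. card (ba e)]"
  using psubset_card_mono[OF finite_trancl_ba] by simp

termination normal_order
proof (relation "measures [\<lambda>e. card ((ba e)\<^sup>+), \<lambda>e. card (ba e)]", goal_cases)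
  case 1
  show ?case by simp
next
  case (2 e s us r1 p r2 i r3 j r4 q vs)
  then show ?case by (intro measure_less_i step_i) simp_all
qed (clarify, rule measure_less_ii,
  rule step_ii[OF _ _ disjI1[OF refl]] step_ii[OF _ _ disjI2[OF refl]]
    step_iii[OF _ _ disjI1[OF refl]] step_iii[OF _ _ disjI2[OF refl]]; assumption)+

declare normal_order.simps [simp del]

lemma concat_subst:
  "concat (subst x s e) = concat (map (\<lambda>y. if y = x then s else [y]) (concat e))"
  by (induction e) (auto simp: subst_def)

lemma multilinear_subst:
  assumes "distinct (concat e)" "x \<in> set (concat e)" "z \<notin> set (concat e)"
    and "s = [x, z] \<or> s = [z, x]"
  shows "distinct (concat (subst x s e))"
    and "set (concat (subst x s e)) = insert z (set (concat e))"
proof -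
  obtain u v where w: "concat e = u @ x # v" using split_list[OF assms(2)] by blast
  have id: "concat (map (\<lambda>y. if y = x then s else [y]) w) = w" if "x \<notin> set w" for w
    using that by (induction w) auto
  have "x \<notin> set u" "x \<notin> set v" using assms(1) w by auto
  then have "concat (subst x s e) = u @ s @ v"
    unfolding concat_subst w by (simp add: id)
  then show "distinct (concat (subst x s e))"
      "set (concat (subst x s e)) = insert z (set (concat e))"
    using assms w by auto
qed

lemma length_subst [simp]: "length (subst x s e) = length e"
  by (simp add: subst_def)

lemma admissible_step:
  assumes "multilinear I e" "acyclic (ba e)" "split_expr e = Some (us, p, i, j, q, vs)"
    and "e' = us @ (p @ [A j, B i] @ q) # vs
      \<or> (\<exists>s. (s = [A i, A j] \<or> s = [A j, A i]) \<and> e' = subst (A i) s (us @ (p @ [B i] @ q) # vs))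
      \<or> (\<exists>s. (s = [B i, B j] \<or> s = [B j, B i]) \<and> e' = subst (B j) s (us @ (p @ [A j] @ q) # vs))"
  shows "multilinear I e' \<and> acyclic (ba e') \<and> length e' = length e"
proof -
  note e = split_expr_SomeD[OF assms(3)]
  have d: "distinct (concat e)" and I: "set (concat e) = A ` I \<union> B ` I"
    using assms(1) by (auto simp: multilinear_def)
  have "i \<noteq> j" by (rule ba_step[OF e assms(1,2)])
  have "B i \<in> set (concat e)" "A j \<in> set (concat e)" using e by auto
  then have "i \<in> I" "j \<in> I" unfolding I by auto
  then have "A i \<in> set (concat e)" "B j \<in> set (concat e)" unfolding I by auto
  have adm: "admissible e" using assms(1,2) by (auto simp: admissible_def)
  have acy: "acyclic (ba e')" if "(ba e')\<^sup>+ \<subseteq> (ba e)\<^sup>+"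
    using that assms(2) by (auto simp: acyclic_def)
  from assms(4) consider "e' = us @ (p @ [A j, B i] @ q) # vs"
    | s where "s = [A i, A j] \<or> s = [A j, A i]" "e' = subst (A i) s (us @ (p @ [B i] @ q) # vs)"
    | s where "s = [B i, B j] \<or> s = [B j, B i]" "e' = subst (B j) s (us @ (p @ [A j] @ q) # vs)"
    by blast
  then show ?thesis
  proof cases
    case 1
    have "distinct (concat e')" "set (concat e') = set (concat e)"
      using d unfolding e 1 by auto
    then show ?thesis using I step_i(1)[OF adm assms(3)] acy
      by (auto simp: multilinear_def 1 e)
  next
    case (2 s)
    let ?f = "us @ (p @ [B i] @ q) # vs"
    have "distinct (concat ?f)" "A j \<notin> set (concat ?f)"
      and set: "insert (A j) (set (concat ?f)) = set (concat e)"
      using d unfolding e by auto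
    moreover have "A i \<in> set (concat ?f)"
      using \<open>A i \<in> set (concat e)\<close> \<open>i \<noteq> j\<close> unfolding set[symmetric] by blast
    ultimately have "multilinear I e'"
      using multilinear_subst[of ?f "A i" "A j" s, OF _ _ _ 2(1)] I
      unfolding multilinear_def 2(2) by metis
    moreover have "acyclic (ba e')"
      using step_ii[OF adm assms(3) 2(1)] acy unfolding 2(2) by blast
    ultimately show ?thesis by (simp add: 2(2) e)
  next
    case (3 s)
    let ?f = "us @ (p @ [A j] @ q) # vs"
    have "distinct (concat ?f)" "B i \<notin> set (concat ?f)"
      and set: "insert (B i) (set (concat ?f)) = set (concat e)"
      using d unfolding e by auto
    moreover have "B j \<in> set (concat ?f)"
      using \<open>B j \<in> set (concat e)\<close> \<open>i \<noteq> j\<close> unfolding set[symmetric] by blast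
    ultimately have "multilinear I e'"
      using multilinear_subst[of ?f "B j" "B i" s, OF _ _ _ 3(1)[THEN disj_commute[THEN iffD1]]] I
      unfolding multilinear_def 3(2) by metis
    moreover have "acyclic (ba e')"
      using step_iii[OF adm assms(3) 3(1)] acy unfolding 3(2) by blast
    ultimately show ?thesis by (simp add: 3(2) e)
  qed
qed

lemma normal_order_in_span:
  assumes "multilinear I e" "acyclic (ba e)"
  shows "(normal_order e :: 'k::field_char_0 comb) \<in> comb.span
           (single_expr ` {f. length f = length e \<and> normally_ordered f \<and> multilinear I f})"
  using assms
proof (induction e rule: normal_order.induct)
  case (1 e)
  have adm: "admissible e" using 1 by (auto simp: admissible_def)
  show ?case
  proof (cases "split_expr e")
    case None
    then have "normal_order e = single_expr e" using adm by (simp add: normal_order.simps)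
    then show ?thesis using split_expr_NoneD[OF None] 1(6) by (auto intro: comb.span_base)
  next
    case (Some a)
    obtain us p i j q vs where a: "a = (us, p, i, j, q, vs)" by (cases a)
    note s = Some[unfolded a]
    let ?S = "comb.span
      (single_expr ` {f. length f = length e \<and> normally_ordered f \<and> multilinear I f})
      :: 'k comb set"
    have st: "multilinear I e' \<and> acyclic (ba e') \<and> length e' = length e"
      if "e' \<in> {us @ (p @ [A j, B i] @ q) # vs,
          subst (A i) [A i, A j] (us @ (p @ [B i] @ q) # vs),
          subst (A i) [A j, A i] (us @ (p @ [B i] @ q) # vs),
          subst (B j) [B i, B j] (us @ (p @ [A j] @ q) # vs),
          subst (B j) [B j, B i] (us @ (p @ [A j] @ q) # vs)}" for e'
      using that by (intro admissible_step[OF 1(6,7) s]) blast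
    note IH = 1(1-5)[OF adm s refl refl refl refl refl]
    have "normal_order (us @ (p @ [A j, B i] @ q) # vs) \<in> ?S"
      using st[of "us @ (p @ [A j, B i] @ q) # vs"] IH(1) by (simp del: append.simps)
    moreover have "normal_order (subst (A i) [A i, A j] (us @ (p @ [B i] @ q) # vs)) \<in> ?S"
      using st[of "subst (A i) [A i, A j] (us @ (p @ [B i] @ q) # vs)"] IH(2)
      by (simp del: append.simps)
    moreover have "normal_order (subst (A i) [A j, A i] (us @ (p @ [B i] @ q) # vs)) \<in> ?S"
      using st[of "subst (A i) [A j, A i] (us @ (p @ [B i] @ q) # vs)"] IH(3)
      by (simp del: append.simps)
    moreover have "normal_order (subst (B j) [B i, B j] (us @ (p @ [A j] @ q) # vs)) \<in> ?S"
      using st[of "subst (B j) [B i, B j] (us @ (p @ [A j] @ q) # vs)"] IH(4)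
      by (simp del: append.simps)
    moreover have "normal_order (subst (B j) [B j, B i] (us @ (p @ [A j] @ q) # vs)) \<in> ?S"
      using st[of "subst (B j) [B j, B i] (us @ (p @ [A j] @ q) # vs)"] IH(5)
      by (simp del: append.simps)
    ultimately show ?thesis
      using adm s by (subst normal_order.simps) (simp add: comb.span_diff)
  qed
qed

definition juxtapose :: "expr \<Rightarrow> expr \<Rightarrow> expr" where
  "juxtapose u v = map2 (@) u v"

lemma admissible_juxtapose:
  assumes "length u = length v" "normally_ordered u" "normally_ordered v"
    and "multilinear I u" "multilinear J v" "I \<inter> J = {}"
  shows "multilinear (I \<union> J) (juxtapose u v)" "acyclic (ba (juxtapose u v))"
proof -
  have m: "mset (concat (juxtapose u v)) = mset (concat (u @ v))"
    unfolding juxtapose_def using assms(1) by (induction u v rule: list_induct2) (simp_all add: ac_simps)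
  have "distinct (concat (u @ v))"
    using assms(4-6) by (auto simp: multilinear_def)
  then have "distinct (concat (juxtapose u v))"
    using m by (metis mset_eq_imp_distinct_iff)
  moreover have "set (concat (juxtapose u v)) = set (concat (u @ v))"
    using m by (rule mset_eq_setD)
  ultimately show "multilinear (I \<union> J) (juxtapose u v)"
    using assms(4,5) unfolding multilinear_def by auto
  have no: "ba_word w = {}" if "w \<in> set x" "normally_ordered x" for w x
  proof -
    have "ba_word (map B q) = {}" for q by (induction q) auto
    then have "ba_word (map A p @ map B q) = {}" for p q by (induction p) auto
    then show ?thesis using that by (auto simp: normally_ordered_def)
  qed
  have "ba (juxtapose u v) \<subseteq> I \<times> J"
  proof
    fix x assume "x \<in> ba (juxtapose u v)"
    then obtain s t where st: "s \<in> set u" "t \<in> set v" "x \<in> ba_word (s @ t)"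
      by (auto simp: ba_def juxtapose_def dest: set_zip_leftD set_zip_rightD)
    then obtain i j where "x = (i, j)" "B i \<in> set s" "A j \<in> set t"
      using no[OF st(1) assms(2)] no[OF st(2) assms(3)] by (auto simp: ba_word_append)
    then have "B i \<in> A ` I \<union> B ` I" "A j \<in> A ` J \<union> B ` J" "x = (i, j)"
      using assms(4,5) st unfolding multilinear_def by (metis UN_I set_concat)+
    then show "x \<in> I \<times> J" by auto
  qed
  moreover have "acyclic (I \<times> J)"
  proof -
    have "(I \<times> J)\<^sup>+ \<subseteq> I \<times> J" by (rule trancl_Int_subset) auto
    then show ?thesis using assms(6) unfolding acyclic_def by blast
  qed
  ultimately show "acyclic (ba (juxtapose u v))" by (meson acyclic_subset)
qed

lemma renumber_letter_inj:
  assumes "inj \<sigma>"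
  shows "inj (renumber_letter \<sigma>)"
proof (rule injI)
  fix x y assume "renumber_letter \<sigma> x = renumber_letter \<sigma> y"
  then show "x = y" by (cases x; cases y) (auto dest: injD[OF assms])
qed

lemma renumber_append [simp]: "renumber \<sigma> (u @ v) = renumber \<sigma> u @ renumber \<sigma> v"
  and renumber_Cons [simp]: "renumber \<sigma> (w # v) = map (renumber_letter \<sigma>) w # renumber \<sigma> v"
  and renumber_Nil [simp]: "renumber \<sigma> [] = []"
  and length_renumber [simp]: "length (renumber \<sigma> e) = length e"
  by (simp_all add: renumber_def)

lemma renumber_id [simp]: "renumber id e = e"
proof -
  have "renumber_letter id = id"
  proof
    show "renumber_letter id x = id x" for x by (cases x) auto
  qed
  then show ?thesis by (simp add: renumber_def)
qed

lemma renumber_renumber: "renumber \<sigma> (renumber \<tau> e) = renumber (\<sigma> \<circ> \<tau>) e"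
proof -
  have "renumber_letter \<sigma> \<circ> renumber_letter \<tau> = renumber_letter (\<sigma> \<circ> \<tau>)"
  proof
    show "(renumber_letter \<sigma> \<circ> renumber_letter \<tau>) x = renumber_letter (\<sigma> \<circ> \<tau>) x" for x
      by (cases x) auto
  qed
  then show ?thesis by (simp add: renumber_def)
qed

lemma concat_renumber: "concat (renumber \<sigma> e) = map (renumber_letter \<sigma>) (concat e)"
  by (simp add: renumber_def map_concat)

lemma multilinear_renumber:
  assumes "inj \<sigma>" "multilinear I e"
  shows "multilinear (\<sigma> ` I) (renumber \<sigma> e)"
proof -
  have "distinct (concat (renumber \<sigma> e))"
    unfolding concat_renumber using assms renumber_letter_inj[OF assms(1)]
    by (auto simp: distinct_map multilinear_def intro: inj_on_subset)
  moreover have "set (concat (renumber \<sigma> e)) = renumber_letter \<sigma> ` (A ` I \<union> B ` I)"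
    unfolding concat_renumber using assms(2) by (simp add: multilinear_def)
  ultimately show ?thesis
    unfolding multilinear_def by (simp add: image_Un image_image)
qed

lemma normally_ordered_renumber:
  assumes "normally_ordered e"
  shows "normally_ordered (renumber \<sigma> e)"
  unfolding normally_ordered_def
proof
  fix w assume "w \<in> set (renumber \<sigma> e)"
  then obtain w' where "w' \<in> set e" "w = map (renumber_letter \<sigma>) w'"
    by (auto simp: renumber_def)
  moreover from this obtain p q where "w' = map A p @ map B q"
    using assms by (auto simp: normally_ordered_def)
  ultimately have "w = map A (map \<sigma> p) @ map B (map \<sigma> q)" by (simp add: comp_def)
  then show "\<exists>p q. w = map A p @ map B q" by blast
qed

lemma split_word_renumber:
  "split_word (map (renumber_letter \<sigma>) w) =
     map_option (\<lambda>(p, i, j, q).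
       (map (renumber_letter \<sigma>) p, \<sigma> i, \<sigma> j, map (renumber_letter \<sigma>) q)) (split_word w)"
proof (induction w rule: split_word.induct)
  case ("2_1" v w)
  then show ?case by (cases "split_word w") auto
next
  case ("2_2" x)
  then show ?case by (cases x) auto
next
  case ("2_3" x v w)
  then show ?case by (cases x; cases "split_word (B v # w)") auto
qed auto

lemma split_expr_renumber:
  "split_expr (renumber \<sigma> e) =
     map_option (\<lambda>(us, p, i, j, q, vs).
       (renumber \<sigma> us, map (renumber_letter \<sigma>) p, \<sigma> i, \<sigma> j,
        map (renumber_letter \<sigma>) q, renumber \<sigma> vs)) (split_expr e)"
proof (induction e)
  case (Cons w e)
  then show ?case
    by (cases "split_word w"; cases "split_expr e") (auto simp: split_word_renumber)
qed simp

lemma subst_renumber: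
  assumes "inj \<sigma>"
  shows "subst (renumber_letter \<sigma> x) (map (renumber_letter \<sigma>) s) (renumber \<sigma> e) =
         renumber \<sigma> (subst x s e)"
proof -
  have *: "renumber_letter \<sigma> y = renumber_letter \<sigma> x \<longleftrightarrow> y = x" for y
    using renumber_letter_inj[OF assms] by (auto dest: injD)
  have "concat (map (\<lambda>y. if y = renumber_letter \<sigma> x then map (renumber_letter \<sigma>) s else [y])
          (map (renumber_letter \<sigma>) w)) =
        map (renumber_letter \<sigma>) (concat (map (\<lambda>y. if y = x then s else [y]) w))" for w
    by (induction w) (auto simp: *)
  then show ?thesis by (simp add: subst_def renumber_def)
qed

lemma ba_renumber:
  assumes "inj \<sigma>"
  shows "ba (renumber \<sigma> e) = map_prod \<sigma> \<sigma> ` ba e"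
proof -
  have 1: "{j. A j \<in> set (map (renumber_letter \<sigma>) w)} = \<sigma> ` {j. A j \<in> set w}" for w
  proof (induction w)
    case (Cons x w)
    then show ?case by (cases x) auto
  qed simp
  have "ba_word (map (renumber_letter \<sigma>) w) = map_prod \<sigma> \<sigma> ` ba_word w" for w
  proof (induction w rule: ba_word.induct)
    case (3 i w)
    have "{(\<sigma> i, j) |j. A j \<in> set (map (renumber_letter \<sigma>) w)} =
          Pair (\<sigma> i) ` {j. A j \<in> set (map (renumber_letter \<sigma>) w)}"
      by auto
    also have "\<dots> = map_prod \<sigma> \<sigma> ` {(i, j) |j. A j \<in> set w}" unfolding 1 by auto
    finally show ?case using 3 by (simp add: image_Un del: set_map)
  qed auto
  then show ?thesis by (auto simp: ba_def renumber_def)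
qed

lemma admissible_renumber_imp:
  assumes "inj \<sigma>" "admissible e"
  shows "admissible (renumber \<sigma> e)"
proof -
  have "acyclic (map_prod \<sigma> \<sigma> ` ba e)"
  proof -
    have "(x, y) \<in> (map_prod \<sigma> \<sigma> ` E)\<^sup>+ \<Longrightarrow> \<exists>u v. x = \<sigma> u \<and> y = \<sigma> v \<and> (u, v) \<in> E\<^sup>+" for x y E
    proof (induction rule: trancl_induct)
      case (step y z)
      then show ?case using assms(1) by (auto dest: injD intro: trancl_into_trancl)
    qed auto
    then show ?thesis using assms
      unfolding admissible_def acyclic_def by (metis injD)
  qed
  then show ?thesis using assms multilinear_renumber
    unfolding admissible_def ba_renumber[OF assms(1)] by blast
qed

lemma admissible_renumber:
  assumes "bij \<sigma>"
  shows "admissible (renumber \<sigma> e) \<longleftrightarrow> admissible e"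
proof
  assume "admissible (renumber \<sigma> e)"
  with bij_is_inj[OF bij_imp_bij_inv[OF assms]]
  have "admissible (renumber (inv \<sigma>) (renumber \<sigma> e))" by (rule admissible_renumber_imp)
  then show "admissible e" using assms by (simp add: renumber_renumber bij_is_inj)
qed (use assms in \<open>auto intro: admissible_renumber_imp bij_is_inj\<close>)

section \<open>The universal algebras\<close>

text \<open>
  Coinvariants: the quotient by the span of the differences of expressions that are
  renumberings of each other. Taking all permutations of \<open>\<nat>\<close> rather than those of the
  index set at hand identifies the same expressions with index set \<open>{1..N}\<close>, and makes classes of
  expressions with other index sets available.
\<close>

definition renumber_diffs :: "'k::field_char_0 comb set" where
  "renumber_diffs = comb.span {single_expr (renumber \<sigma> e) - single_expr e |\<sigma> e. bij \<sigma>}"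

lemma subspace_renumber_diffs: "comb.subspace renumber_diffs"
  by (simp add: renumber_diffs_def)

lemmas renumber_diffs_intros =
  comb.subspace_0[OF subspace_renumber_diffs] comb.subspace_add[OF subspace_renumber_diffs]
  comb.subspace_diff[OF subspace_renumber_diffs] comb.subspace_scale[OF subspace_renumber_diffs]
  comb.subspace_neg[OF subspace_renumber_diffs]

lemma single_renumber_diff:
  "bij \<sigma> \<Longrightarrow> single_expr (renumber \<sigma> e) - single_expr e \<in> renumber_diffs"
  unfolding renumber_diffs_def by (rule comb.span_base) auto

lemma lin_ext_renumber_diffs:
  assumes "\<And>\<sigma> e. bij \<sigma> \<Longrightarrow> f (renumber \<sigma> e) - f e \<in> renumber_diffs" "x \<in> renumber_diffs"
  shows "lin_ext f x \<in> renumber_diffs"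
  using assms(2)[unfolded renumber_diffs_def]
proof (induction rule: comb.span_induct)
  case base
  show ?case
    unfolding comb.subspace_def
    by (auto simp: lin_ext_add lin_ext_cscale intro: renumber_diffs_intros)
next
  case (step x)
  then show ?case by (auto simp: lin_ext_diff intro: assms(1))
qed

lemma normal_order_renumber:
  assumes "bij \<sigma>"
  shows "normal_order (renumber \<sigma> e) - normal_order e \<in> (renumber_diffs :: 'k::field_char_0 comb set)"
proof (induction e rule: normal_order.induct)
  case (1 e)
  show ?case
  proof (cases "admissible e")
    case False
    then show ?thesis using assms
      by (simp add: normal_order.simps admissible_renumber renumber_diffs_intros)
  next
    case adm: True
    show ?thesis
    proof (cases "split_expr e")
      case None
      then show ?thesis using assms adm single_renumber_diff[OF assms, of e]
        by (simp add: normal_order.simps admissible_renumber split_expr_renumber)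
    next
      case (Some a)
      obtain us p i j q vs where a: "a = (us, p, i, j, q, vs)" by (cases a)
      note s = Some[unfolded a]
      define e1 where "e1 = us @ (p @ [A j, B i] @ q) # vs"
      define e2 where "e2 = subst (A i) [A i, A j] (us @ (p @ [B i] @ q) # vs)"
      define e3 where "e3 = subst (A i) [A j, A i] (us @ (p @ [B i] @ q) # vs)"
      define e4 where "e4 = subst (B j) [B i, B j] (us @ (p @ [A j] @ q) # vs)"
      define e5 where "e5 = subst (B j) [B j, B i] (us @ (p @ [A j] @ q) # vs)"
      note defs = e1_def e2_def e3_def e4_def e5_def
      have no: "normal_order e = normal_order e1 - (normal_order e2 - normal_order e3)
          - (normal_order e4 - normal_order e5 :: 'k comb)"
        using adm s by (subst normal_order.simps) (simp add: defs)
      have ren: "normal_order (renumber \<sigma> e) = normal_order (renumber \<sigma> e1)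
          - (normal_order (renumber \<sigma> e2) - normal_order (renumber \<sigma> e3))
          - (normal_order (renumber \<sigma> e4) - normal_order (renumber \<sigma> e5) :: 'k comb)"
        using adm s assms
        by (subst normal_order.simps)
           (simp add: defs admissible_renumber split_expr_renumber
             subst_renumber[OF bij_is_inj, symmetric])
      have split: "normal_order (renumber \<sigma> e) - normal_order e =
          (normal_order (renumber \<sigma> e1) - normal_order e1)
          - ((normal_order (renumber \<sigma> e2) - normal_order e2)
             - (normal_order (renumber \<sigma> e3) - normal_order e3))
          - ((normal_order (renumber \<sigma> e4) - normal_order e4)
             - (normal_order (renumber \<sigma> e5) - normal_order e5 :: 'k comb))"
        unfolding no ren by simp
      note IH = 1[OF adm s refl refl refl refl refl, folded defs]
      show ?thesis unfolding split by (intro renumber_diffs_intros IH)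
    qed
  qed
qed

quotient_type (overloaded) 'k univ = "'k::field_char_0 comb" /
  "\<lambda>x y. x - y \<in> (renumber_diffs :: 'k comb set)"
  morphisms rep_univ Abs_univ
proof (rule equivpI)
  show "reflp (\<lambda>x y. x - y \<in> (renumber_diffs :: 'k comb set))"
    by (simp add: reflp_def renumber_diffs_intros)
  show "symp (\<lambda>x y. x - y \<in> (renumber_diffs :: 'k comb set))"
    by (rule sympI) (metis minus_diff_eq renumber_diffs_intros(5))
  show "transp (\<lambda>x y. x - y \<in> (renumber_diffs :: 'k comb set))"
  proof (rule transpI)
    fix x y z :: "'k comb"
    assume "x - y \<in> renumber_diffs" "y - z \<in> renumber_diffs"
    from renumber_diffs_intros(2)[OF this] show "x - z \<in> renumber_diffs" by simp
  qed
qed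

instantiation univ :: (field_char_0) ab_group_add
begin

lift_definition zero_univ :: "'a univ" is 0 .

lift_definition plus_univ :: "'a univ \<Rightarrow> 'a univ \<Rightarrow> 'a univ" is "(+)"
proof -
  fix x x' y y' :: "'a comb"
  assume "x - x' \<in> renumber_diffs" "y - y' \<in> renumber_diffs"
  from renumber_diffs_intros(2)[OF this]
  show "x + y - (x' + y') \<in> renumber_diffs" by (simp add: algebra_simps)
qed

lift_definition uminus_univ :: "'a univ \<Rightarrow> 'a univ" is uminus
  by (metis minus_diff_minus renumber_diffs_intros(5))

lift_definition minus_univ :: "'a univ \<Rightarrow> 'a univ \<Rightarrow> 'a univ" is "(-)"
proof -
  fix x x' y y' :: "'a comb"
  assume "x - x' \<in> renumber_diffs" "y - y' \<in> renumber_diffs"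
  from renumber_diffs_intros(3)[OF this]
  show "x - y - (x' - y') \<in> renumber_diffs" by (simp add: algebra_simps)
qed

instance
  by standard (transfer; simp add: algebra_simps renumber_diffs_intros)+

end

lift_definition uscale :: "'k::field_char_0 \<Rightarrow> 'k univ \<Rightarrow> 'k univ" is cscale
  by (metis comb.scale_right_diff_distrib renumber_diffs_intros(4))

global_interpretation univ: vector_space uscale
  defines univ_span = univ.span
  by unfold_locales
     (transfer; simp add: comb.scale_right_distrib comb.scale_left_distrib renumber_diffs_intros)+

lift_definition expr_class :: "expr \<Rightarrow> 'k::field_char_0 univ" is single_expr .

lemma expr_class_renumber: "bij \<sigma> \<Longrightarrow> expr_class (renumber \<sigma> e) = expr_class e"
  by transfer (rule single_renumber_diff)

text \<open>The homogeneous component of degree \<open>N\<close> of \<open>U_n\<close>.\<close>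

definition U :: "nat \<Rightarrow> nat \<Rightarrow> 'k::field_char_0 univ set" where
  "U n N = univ.span (expr_class ` normal_exprs n N)"

text \<open>
  The product. The letters of the two factors are made disjoint by giving them even and
  odd indices respectively.
\<close>

definition mult_expr :: "expr \<Rightarrow> expr \<Rightarrow> 'k::field_char_0 comb" where
  "mult_expr u v =
     normal_order (juxtapose (renumber (\<lambda>k. 2 * k) u) (renumber (\<lambda>k. 2 * k + 1) v))"

lemma renumber_juxtapose: "renumber \<sigma> (juxtapose u v) = juxtapose (renumber \<sigma> u) (renumber \<sigma> v)"
  unfolding juxtapose_def renumber_def by (simp add: zip_map_map split_beta comp_def)

lemma mult_expr_renumber:
  assumes "bij \<sigma>" "bij \<tau>"
  shows "mult_expr (renumber \<sigma> u) (renumber \<tau> v) - mult_expr u v \<in> renumber_diffs"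
proof -
  define \<rho> where "\<rho> k = (if even k then 2 * \<sigma> (k div 2) else 2 * \<tau> (k div 2) + 1)" for k
  have "bij \<rho>"
  proof (rule bijI)
    show "inj \<rho>"
    proof (rule injI)
      fix x y assume eq: "\<rho> x = \<rho> y"
      have par: "even (\<rho> z) \<longleftrightarrow> even z" for z by (simp add: \<rho>_def)
      have "even x \<longleftrightarrow> even y" using par eq by metis
      moreover from this have "x div 2 = y div 2"
        using eq assms by (auto simp: \<rho>_def split: if_splits dest: bij_is_inj injD)
      ultimately show "x = y" by (metis div_mult_mod_eq parity_cases)
    qed
    show "surj \<rho>"
    proof (rule surjI)
      fix y
      show "\<rho> (if even y then 2 * inv \<sigma> (y div 2) else 2 * inv \<tau> (y div 2) + 1) = y"
        using assms by (auto simp: \<rho>_def bij_is_surj surj_f_inv_f elim: oddE)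
    qed
  qed
  moreover have "\<rho> \<circ> (\<lambda>k. 2 * k) = (\<lambda>k. 2 * k) \<circ> \<sigma>" "\<rho> \<circ> (\<lambda>k. 2 * k + 1) = (\<lambda>k. 2 * k + 1) \<circ> \<tau>"
    by (auto simp: \<rho>_def)
  ultimately show ?thesis
    using normal_order_renumber[of \<rho>
        "juxtapose (renumber (\<lambda>k. 2 * k) u) (renumber (\<lambda>k. 2 * k + 1) v)"]
    by (simp add: mult_expr_def renumber_juxtapose renumber_renumber)
qed

definition mult_comb :: "'k::field_char_0 comb \<Rightarrow> 'k comb \<Rightarrow> 'k comb" where
  "mult_comb x y = lin_ext (\<lambda>u. lin_ext (mult_expr u) y) x"

lemma mult_expr_renumber_left:
    "bij \<sigma> \<Longrightarrow> mult_expr (renumber \<sigma> u) v - mult_expr u v \<in> renumber_diffs"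
  and mult_expr_renumber_right:
    "bij \<sigma> \<Longrightarrow> mult_expr u (renumber \<sigma> v) - mult_expr u v \<in> renumber_diffs"
  using mult_expr_renumber[of \<sigma> id u v] mult_expr_renumber[of id \<sigma> u v] by simp_all

lift_definition umult :: "'k::field_char_0 univ \<Rightarrow> 'k univ \<Rightarrow> 'k univ" is mult_comb
proof -
  fix x x' y y' :: "'k comb"
  assume x: "x - x' \<in> renumber_diffs" and y: "y - y' \<in> renumber_diffs"
  have "mult_comb (x - x') y \<in> renumber_diffs"
    unfolding mult_comb_def
    by (rule lin_ext_renumber_diffs[OF _ x])
       (auto simp: lin_ext_diff_fun
         intro!: lin_ext_in_subspace subspace_renumber_diffs mult_expr_renumber_left)
  moreover have "mult_comb x' (y - y') \<in> renumber_diffs"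
    unfolding mult_comb_def
    by (intro lin_ext_in_subspace subspace_renumber_diffs lin_ext_renumber_diffs[OF _ y]
          mult_expr_renumber_right)
  moreover have "mult_comb x y - mult_comb x' y' = mult_comb (x - x') y + mult_comb x' (y - y')"
    by (simp add: mult_comb_def lin_ext_diff lin_ext_diff_fun[symmetric])
  ultimately show "mult_comb x y - mult_comb x' y' \<in> renumber_diffs"
    by (simp add: renumber_diffs_intros)
qed

text \<open>Placing the two tensor factors in positions \<open>i\<close> and \<open>j\<close> of three.\<close>

fun insert_expr :: "nat \<Rightarrow> nat \<Rightarrow> expr \<Rightarrow> expr" where
  "insert_expr i j [u, v] = map (\<lambda>k. if k = i then u else if k = j then v else []) [1, 2, 3]"
| "insert_expr i j _ = []"  \<comment> \<open>irrelevant: not an expression with two tensor factors\<close>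

lemma insert_expr_renumber: "insert_expr i j (renumber \<sigma> e) = renumber \<sigma> (insert_expr i j e)"
  by (induction i j e rule: insert_expr.induct) auto

lift_definition uinsert :: "nat \<Rightarrow> nat \<Rightarrow> 'k::field_char_0 univ \<Rightarrow> 'k univ" is
  "\<lambda>i j. lin_ext (\<lambda>e. single_expr (insert_expr i j e))"
  unfolding lin_ext_diff[symmetric]
  by (rule lin_ext_renumber_diffs) (auto simp: insert_expr_renumber intro: single_renumber_diff)

lemma bij_extension:
  fixes f :: "nat \<Rightarrow> nat"
  assumes "finite I" "inj_on f I"
  obtains \<sigma> where "bij \<sigma>" "\<And>k. k \<in> I \<Longrightarrow> \<sigma> k = f k"
proof -
  have "infinite (- I)" "infinite (- (f ` I))"
    using assms(1) by (simp_all add: finite_compl)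
  then have b: "bij_betw (enumerate (- I)) UNIV (- I)"
      "bij_betw (enumerate (- (f ` I))) UNIV (- (f ` I))"
    by (simp_all add: bij_enumerate)
  define g where "g = enumerate (- (f ` I)) \<circ> inv_into UNIV (enumerate (- I))"
  have g: "bij_betw g (- I) (- (f ` I))"
    unfolding g_def by (rule bij_betw_trans[OF bij_betw_inv_into[OF b(1)] b(2)])
  define \<sigma> where "\<sigma> k = (if k \<in> I then f k else g k)" for k
  have "bij_betw \<sigma> I (f ` I)"
    using inj_on_imp_bij_betw[OF assms(2)] by (rule bij_betw_cong[THEN iffD1, rotated]) (simp add: \<sigma>_def)
  moreover have "bij_betw \<sigma> (- I) (- (f ` I))"
    using g by (rule bij_betw_cong[THEN iffD1, rotated]) (simp add: \<sigma>_def)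
  ultimately have "bij_betw \<sigma> (I \<union> - I) (f ` I \<union> - (f ` I))"
    by (rule bij_betw_combine) simp
  then have "bij \<sigma>" by simp
  then show ?thesis by (rule that) (simp add: \<sigma>_def)
qed

lemma renumber_cong:
  assumes "multilinear I e" "\<And>k. k \<in> I \<Longrightarrow> \<sigma> k = \<tau> k"
  shows "renumber \<sigma> e = renumber \<tau> e"
proof -
  have "renumber_letter \<sigma> x = renumber_letter \<tau> x" if "w \<in> set e" "x \<in> set w" for w x
  proof -
    have "x \<in> set (concat e)" using that by auto
    moreover have "set (concat e) = A ` I \<union> B ` I"
      using assms(1) unfolding multilinear_def by (rule conjunct2)
    ultimately have "x \<in> A ` I \<union> B ` I" by (rule back_subst[where P = "\<lambda>S. x \<in> S"])
    then show ?thesis using assms(2) by auto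
  qed
  then show ?thesis by (simp add: renumber_def)
qed

lemma expr_class_in_U:
  assumes "multilinear I e" "finite I" "normally_ordered e" "length e = n"
  shows "expr_class e \<in> U n (card I)"
proof -
  obtain f where f: "bij_betw f I {1..card I}"
    using finite_same_card_bij[OF assms(2), of "{1..card I}"] by auto
  obtain \<sigma> where \<sigma>: "bij \<sigma>" "\<And>k. k \<in> I \<Longrightarrow> \<sigma> k = f k"
    using bij_extension[OF assms(2) bij_betw_imp_inj_on[OF f]] by blast
  have "\<sigma> ` I = {1..card I}" using f \<sigma>(2) by (simp add: bij_betw_def)
  then have "renumber \<sigma> e \<in> normal_exprs n (card I)"
    using multilinear_renumber[OF bij_is_inj[OF \<sigma>(1)] assms(1)]
      normally_ordered_renumber[OF assms(3)] assms(4)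
    by (simp add: normal_exprs_def)
  then have "expr_class (renumber \<sigma> e) \<in> U n (card I)"
    unfolding U_def by (auto intro: univ.span_base)
  then show ?thesis by (simp add: expr_class_renumber[OF \<sigma>(1)])
qed

lemma Abs_univ_in_subspace:
  fixes x :: "'k::field_char_0 comb"
  assumes "x \<in> comb.span (single_expr ` F)" "univ.subspace V" "\<And>e. e \<in> F \<Longrightarrow> expr_class e \<in> V"
  shows "Abs_univ x \<in> V"
  using assms(1)
proof (induction rule: comb.span_induct)
  case base
  have "Abs_univ (0 :: 'k comb) = 0" "Abs_univ (x + y) = Abs_univ x + Abs_univ y"
    "Abs_univ (cscale c x) = uscale c (Abs_univ x)" for x y :: "'k comb" and c
    by (simp_all add: zero_univ_def plus_univ.abs_eq uscale.abs_eq)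
  then show ?case
    unfolding comb.subspace_def
    using univ.subspace_0[OF assms(2)] univ.subspace_add[OF assms(2)]
      univ.subspace_scale[OF assms(2)] by simp
next
  case (step x)
  then show ?case using assms(3) by (auto simp: expr_class.abs_eq)
qed

lemma umult_expr_class: "umult (expr_class u) (expr_class v) = Abs_univ (mult_expr u v)"
  by (simp add: expr_class.abs_eq umult.abs_eq mult_comb_def)

lemma umult_linear:
  "umult (x + x') y = umult x y + umult x' y" "umult x (y + y') = umult x y + umult x y'"
  "umult (uscale c x) y = uscale c (umult x y)" "umult x (uscale c y) = uscale c (umult x y)"
  "umult 0 y = 0" "umult x 0 = 0"
  by (transfer; simp add: mult_comb_def lin_ext_add lin_ext_cscale lin_ext_fun_add
      lin_ext_fun_cscale lin_ext_fun_zero renumber_diffs_intros)+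

lemma umult_in_U:
  assumes "x \<in> U n N" "y \<in> U n M"
  shows "umult x y \<in> U n (N + M)"
proof -
  have sub: "univ.subspace (U n K)" for K by (simp add: U_def)
  note intros = univ.subspace_0[OF sub] univ.subspace_add[OF sub] univ.subspace_scale[OF sub]
  have base: "umult (expr_class u) (expr_class v) \<in> U n (N + M)"
    if u: "u \<in> normal_exprs n N" and v: "v \<in> normal_exprs n M" for u v
  proof -
    let ?I = "(\<lambda>k. 2 * k) ` {1..N}" and ?J = "(\<lambda>k. 2 * k + 1) ` {1..M}"
    let ?u = "renumber (\<lambda>k. 2 * k) u" and ?v = "renumber (\<lambda>k. 2 * k + 1) v"
    have inj: "inj (\<lambda>k::nat. 2 * k)" "inj (\<lambda>k::nat. 2 * k + 1)" by (auto simp: inj_def)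
    have disj: "?I \<inter> ?J = {}" by (auto, presburger)
    have mu: "multilinear ?I ?u" and mv: "multilinear ?J ?v"
      using u v multilinear_renumber inj by (auto simp: normal_exprs_def)
    have nu: "normally_ordered ?u" and nv: "normally_ordered ?v"
      using u v normally_ordered_renumber by (auto simp: normal_exprs_def)
    have len: "length ?u = n" "length ?v = n" using u v by (simp_all add: normal_exprs_def)
    have adm: "multilinear (?I \<union> ?J) (juxtapose ?u ?v)" "acyclic (ba (juxtapose ?u ?v))"
      using admissible_juxtapose[OF trans[OF len(1) len(2)[symmetric]] nu nv mu mv disj] by auto
    have "length (juxtapose ?u ?v) = n" using len by (simp add: juxtapose_def)
    moreover have "card (?I \<union> ?J) = N + M"
      using disj inj by (simp add: card_Un_disjoint card_image inj_on_subset)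
    ultimately show ?thesis
      unfolding umult_expr_class mult_expr_def
      using expr_class_in_U[of "?I \<union> ?J" _ n]
      by (intro Abs_univ_in_subspace[OF normal_order_in_span[OF adm] sub]) auto
  qed
  have right: "umult (expr_class u) y \<in> U n (N + M)" if "u \<in> normal_exprs n N" for u
    using assms(2)[unfolded U_def[of n M]]
  proof (induction rule: univ.span_induct)
    case base
    show ?case
      by (auto simp: univ.subspace_def umult_linear intro: intros)
  qed (use base that in auto)
  show ?thesis
    using assms(1)[unfolded U_def[of n N]]
  proof (induction rule: univ.span_induct)
    case base
    show ?case
      by (auto simp: univ.subspace_def umult_linear intro: intros)
  qed (use right in auto)
qed

section \<open>Degree completions\<close>

text \<open>An element of the degree completion is the sequence of its homogeneous components.\<close>

type_synonym 'k univ_hat = "nat \<Rightarrow> 'k univ"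

definition U_hat :: "nat \<Rightarrow> 'k::field_char_0 univ_hat set" where
  "U_hat n = {X. \<forall>N. X N \<in> U n N}"

definition hat_one :: "nat \<Rightarrow> 'k::field_char_0 univ_hat" where
  "hat_one n = (\<lambda>N. if N = 0 then expr_class (replicate n []) else 0)"

definition hat_mult :: "'k::field_char_0 univ_hat \<Rightarrow> 'k univ_hat \<Rightarrow> 'k univ_hat"
    (infixl \<open>\<star>\<close> 70) where
  "X \<star> Y = (\<lambda>N. \<Sum>p\<le>N. umult (X p) (Y (N - p)))"

definition hat_insert :: "nat \<Rightarrow> nat \<Rightarrow> 'k::field_char_0 univ_hat \<Rightarrow> 'k univ_hat" where
  "hat_insert i j X = (\<lambda>N. uinsert i j (X N))"

definition component :: "'k::field_char_0 univ_hat \<Rightarrow> nat \<Rightarrow> 'k univ_hat" where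
  "component X N = (\<lambda>M. if M = N then X M else 0)"

definition classical_r :: "'k::field_char_0 univ_hat" where
  "classical_r = (\<lambda>N. if N = 1 then expr_class [[A 1], [B 1]] else 0)"

definition completed_span :: "nat \<Rightarrow> (expr \<Rightarrow> bool) \<Rightarrow> 'k::field_char_0 univ_hat set" where
  "completed_span n P = {X. \<forall>N. X N \<in> univ.span (expr_class ` {e \<in> normal_exprs n N. P e})}"

text \<open>
  \<open>U(g) \<otimes> U(a)U(b)\<^sub>0\<close> and \<open>U(a)\<^sub>0U(b) \<otimes> U(g)\<close>: at least one letter \<open>b\<close> in the second
  tensor factor, respectively at least one letter \<open>a\<close> in the first.
\<close>

definition Ug_UaUb0 :: "'k::field_char_0 univ_hat set" where
  "Ug_UaUb0 = completed_span 2 (\<lambda>e. \<exists>i. B i \<in> set (e ! 1))"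

definition Ua0Ub_Ug :: "'k::field_char_0 univ_hat set" where
  "Ua0Ub_Ug = completed_span 2 (\<lambda>e. \<exists>i. A i \<in> set (e ! 0))"

end

theory Submission
  imports Defs "HOL-Combinatorics.Multiset_Permutations"
begin

text \<open>
  Let \<open>N \<ge> 2\<close> be minimal such that the part \<open>T\<close> of \<open>R_N\<close> without \<open>b\<close> in the second factor is nonzero.
  Normally ordered expressions whose third factor contains a \<open>b\<close> span a left ideal of \<open>U_3\<close> stable under right
  multiplication by elements of the first two factors; modulo it the quantum Yang--Baxter equation in
  degree \<open>N + 1\<close> becomes linear:
  \<open>[r\<^sup>1\<^sup>2, T\<^sup>1\<^sup>3 + T\<^sup>2\<^sup>3] + r\<^sup>1\<^sup>3 T\<^sup>2\<^sup>3 - r\<^sup>2\<^sup>3 T\<^sup>1\<^sup>3 = 0\<close>.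
  Only \<open>r\<^sup>2\<^sup>3 T\<^sup>1\<^sup>3\<close> contributes expressions with \<open>N + 1\<close> letters \<open>b\<close> in the first factor, and they
  show that the second factor of \<open>T\<close> is empty. So \<open>T = f \<otimes> 1\<close> with \<open>[r, f \<otimes> 1 + 1 \<otimes> f] = 0\<close>, where
  \<open>f = \<Sum> F P Q a_P b_Q\<close>. To get \<open>f = 0\<close>, let \<open>F(X, Y)\<close> be the sum of \<open>F P Q\<close> over
  all \<open>P\<close> that restrict to the given words of a partition \<open>X\<close> of the letters into words and all \<open>Q\<close>
  that restrict to those of \<open>Y\<close>. (In terms of iterated coproducts these sums are the symbols of \<open>f\<close> for
  the Poincare--Birkhoff--Witt filtration.) They vanish by induction, starting with the finest
  partitions: the equation, restricted to suitable partitions, expresses \<open>F(X, Y)\<close> through sums over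
  finer ones. The statement on the first factor follows by a mirror symmetry.
\<close>

section \<open>Restrictions of words\<close>

text \<open>The rewriting follows one fixed strategy on labelled expressions, while the equation
  lives in a quotient by renumbering. The bridge is to give T coefficients that are invariant under
  all bijections of the labels and to test the equation against linear functionals on normal forms:
  for a well-chosen target most branches of the rewriting die without being expanded. The induction
  on partitions has one obstacle. To reach \<open>F(X, Y)\<close> for a block u of Y, r gets a new
  letter y, and the target has \<open>b_y b_u\<close> in the second factor. The terms in which r
  carries the label of a letter x of u lead to partitions treated earlier, except when x is the last
  letter of u and \<open>[x]\<close> is a block of X. Such a term returns a sum exactly as fine as
  the one sought, and the equation decides nothing. These letters are handled by the invariance
  under renumbering instead, which cannot distinguish letters that are singleton blocks of
  X.\<close>

definition agrees :: "'a list set \<Rightarrow> 'a list \<Rightarrow> bool" where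
  "agrees S P \<longleftrightarrow> (\<forall>p\<in>S. filter (\<lambda>x. x \<in> set p) P = p)"

lemma agrees_insert [simp]:
  "agrees (insert p S) P \<longleftrightarrow> filter (\<lambda>x. x \<in> set p) P = p \<and> agrees S P"
  by (auto simp: agrees_def)

text \<open>The empty word is excluded so that distinct blocks have distinct letter sets and the
  number of blocks, the measure of fineness in the induction, is bounded by the number of
  letters.\<close>

definition word_partition :: "'a set \<Rightarrow> 'a list set \<Rightarrow> bool" where
  "word_partition J S \<longleftrightarrow> finite S \<and> [] \<notin> S \<and> (\<forall>p\<in>S. distinct p) \<and>
     (\<forall>p\<in>S. \<forall>q\<in>S. p \<noteq> q \<longrightarrow> set p \<inter> set q = {}) \<and> (\<Union>p\<in>S. set p) = J"

lemma word_partition_insert: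
  assumes "p \<notin> S"
  shows "word_partition J (insert p S) \<longleftrightarrow>
    p \<noteq> [] \<and> distinct p \<and> set p \<subseteq> J \<and> word_partition (J - set p) S"
  using assms unfolding word_partition_def by (auto; blast)

lemma word_partition_not_in:
  assumes "word_partition J S" "set p \<inter> J = {}"
  shows "p \<notin> S"
proof
  assume "p \<in> S"
  then have "p \<noteq> []" "set p \<subseteq> J" using assms(1) unfolding word_partition_def by auto
  then show False using assms(2) by (cases p) auto
qed

lemma word_partition_insertI:
  assumes "word_partition (J - set p) S" "p \<noteq> []" "distinct p" "set p \<subseteq> J"
  shows "word_partition J (insert p S)" "p \<notin> S"
proof -
  show "p \<notin> S" using word_partition_not_in[OF assms(1)] by blast
  then show "word_partition J (insert p S)" using assms by (simp add: word_partition_insert)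
qed

lemma word_partition_card_le:
  assumes "word_partition J S" "finite J"
  shows "card S \<le> card J"
proof -
  have "finite S" using assms(1) by (simp add: word_partition_def)
  then show ?thesis using assms
  proof (induction S arbitrary: J)
    case (insert p S)
    then have *: "p \<noteq> []" "set p \<subseteq> J" "word_partition (J - set p) S"
      by (simp_all add: word_partition_insert)
    have "card S \<le> card (J - set p)" using insert.IH[OF *(3)] insert.prems by simp
    moreover have "card (J - set p) < card J"
      using *(1,2) insert.prems by (intro psubset_card_mono) (auto simp: neq_Nil_conv)
    ultimately show ?case using insert.hyps by simp
  qed simp
qed

lemma filter_filter_set: "set p \<subseteq> X \<Longrightarrow>
  filter (\<lambda>x. x \<in> set p) (filter (\<lambda>x. x \<in> X) Q) = filter (\<lambda>x. x \<in> set p) Q"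
  by (induction Q) auto

lemma agrees_filter_compl:
  assumes "\<And>t. t \<in> T \<Longrightarrow> set t \<inter> K = {}"
  shows "agrees T (filter (\<lambda>x. x \<notin> K) Q) \<longleftrightarrow> agrees T Q"
proof -
  have "filter (\<lambda>x. x \<in> set t) (filter (\<lambda>x. x \<notin> K) Q) = filter (\<lambda>x. x \<in> set t) Q" if "t \<in> T" for t
    using assms[OF that] by (induction Q) auto
  then show ?thesis by (simp add: agrees_def)
qed

lemma filter_takeWhile:
  "(\<And>x. \<not> R x \<Longrightarrow> S x) \<Longrightarrow> filter S (takeWhile R xs) = takeWhile R (filter S xs)"
  by (induction xs) auto

lemma permutations_of_set_iff: "P \<in> permutations_of_set J \<longleftrightarrow> set P = J \<and> distinct P"
  by (auto simp: permutations_of_set_def)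

lemma filter_in_permutations:
  "P \<in> permutations_of_set J \<Longrightarrow> X \<subseteq> J \<Longrightarrow> filter (\<lambda>x. x \<in> X) P \<in> permutations_of_set X"
  by (auto simp: permutations_of_set_iff)

section \<open>Insertion of one letter into a word\<close>

definition sub :: "'a \<Rightarrow> 'a list \<Rightarrow> 'a list \<Rightarrow> 'a list" where
  "sub l s P = concat (map (\<lambda>x. if x = l then s else [x]) P)"

lemma sub_simps [simp]: "sub l s [] = []" "sub l s (P @ Q) = sub l s P @ sub l s Q"
  "sub l s (x # P) = (if x = l then s else [x]) @ sub l s P"
  by (simp_all add: sub_def)

lemma sub_notin: "l \<notin> set P \<Longrightarrow> sub l s P = P"
  by (induction P) auto

text \<open>Here \<open>h\<close> inserts a fresh letter x, either at the end or next to a given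
  letter l, and commutes with restriction. The first condition on the right does not involve P, so
  it can be pulled out of sums over P as a constant.\<close>

lemma filter_insertion:
  assumes "\<And>P. x \<notin> set P \<Longrightarrow> filter (\<lambda>y. y \<noteq> x) (h P) = P"
    and "\<And>P. x \<notin> set P \<Longrightarrow>
      filter (\<lambda>y. y \<in> set p) (h P) = h (filter (\<lambda>y. y \<in> set (filter (\<lambda>y. y \<noteq> x) p)) P)"
    and "x \<notin> set P"
  shows "filter (\<lambda>y. y \<in> set p) (h P) = p \<longleftrightarrow>
    h (filter (\<lambda>y. y \<noteq> x) p) = p \<and>
    filter (\<lambda>y. y \<in> set (filter (\<lambda>y. y \<noteq> x) p)) P = filter (\<lambda>y. y \<noteq> x) p"
proof
  let ?q = "filter (\<lambda>y. y \<noteq> x) p" and ?v = "filter (\<lambda>y. y \<in> set (filter (\<lambda>y. y \<noteq> x) p)) P"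
  assume *: "filter (\<lambda>y. y \<in> set p) (h P) = p"
  then have h: "h ?v = p" using assms(2)[OF assms(3)] by simp
  have "x \<notin> set ?v" using assms(3) by simp
  from assms(1)[OF this] have "?q = ?v" unfolding h .
  then show "h ?q = p \<and> ?v = ?q" using h by metis
qed (use assms(2)[OF assms(3)] in simp)

text \<open>Only the block p that contains x sees the insertion; every other block restricts
  \<open>h P\<close> and P to the same word. Subtracting \<open>{[]}\<close> discards p when x was
  its only letter.\<close>

lemma agrees_insertion:
  assumes "word_partition J S" "p \<in> S" "x \<in> set p" "x \<notin> set P"
    and "\<And>P. x \<notin> set P \<Longrightarrow> filter (\<lambda>y. y \<noteq> x) (h P) = P"
    and "\<And>P. x \<notin> set P \<Longrightarrow>
      filter (\<lambda>y. y \<in> set p) (h P) = h (filter (\<lambda>y. y \<in> set (filter (\<lambda>y. y \<noteq> x) p)) P)"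
  shows "agrees S (h P) \<longleftrightarrow> h (filter (\<lambda>y. y \<noteq> x) p) = p \<and>
    agrees (S - {p} \<union> ({filter (\<lambda>y. y \<noteq> x) p} - {[]})) P"
proof -
  have S: "S = insert p (S - {p})" using assms(2) by blast
  have other: "filter (\<lambda>y. y \<in> set q) (h P) = filter (\<lambda>y. y \<in> set q) P" if "q \<in> S - {p}" for q
  proof -
    have "x \<notin> set q" using that assms(1-3) unfolding word_partition_def by blast
    then have "filter (\<lambda>y. y \<in> set q) (h P) = filter (\<lambda>y. y \<in> set q) (filter (\<lambda>y. y \<noteq> x) (h P))"
      by (induction "h P") (auto simp: filter_filter intro!: filter_cong)
    then show ?thesis using assms(5)[OF assms(4)] by simp
  qed
  define q where "q = filter (\<lambda>y. y \<noteq> x) p"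
  have "agrees S (h P) \<longleftrightarrow> filter (\<lambda>y. y \<in> set p) (h P) = p \<and> agrees (S - {p}) (h P)"
    by (subst S) (rule agrees_insert)
  moreover have "agrees (S - {p}) (h P) \<longleftrightarrow> agrees (S - {p}) P"
    using other by (simp add: agrees_def)
  moreover have "filter (\<lambda>y. y \<in> set p) (h P) = p \<longleftrightarrow>
      h q = p \<and> filter (\<lambda>y. y \<in> set q) P = q"
    unfolding q_def by (rule filter_insertion[of x h p P, OF assms(5,6,4)])
  moreover have "agrees (S - {p} \<union> ({q} - {[]})) P \<longleftrightarrow>
      filter (\<lambda>y. y \<in> set q) P = q \<and> agrees (S - {p}) P"
    by (cases "q = []") auto
  ultimately show ?thesis unfolding q_def[symmetric] by blast
qed

lemma agrees_snoc:
  assumes "word_partition J S" "p \<in> S" "x \<in> set p" "x \<notin> set P"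
  shows "agrees S (P @ [x]) \<longleftrightarrow> filter (\<lambda>y. y \<noteq> x) p @ [x] = p \<and>
    agrees (S - {p} \<union> ({filter (\<lambda>y. y \<noteq> x) p} - {[]})) P"
proof (rule agrees_insertion[OF assms, where h = "\<lambda>P. P @ [x]"])
  fix P assume "x \<notin> set P"
  then show "filter (\<lambda>y. y \<noteq> x) (P @ [x]) = P" by (induction P) auto
  show "filter (\<lambda>y. y \<in> set p) (P @ [x]) =
      filter (\<lambda>y. y \<in> set (filter (\<lambda>y. y \<noteq> x) p)) P @ [x]"
    using \<open>x \<notin> set P\<close> assms(3) by (induction P) auto
qed

lemma agrees_sub:
  assumes "word_partition J S" "p \<in> S" "x \<in> set p" "x \<notin> set P" "l \<in> set p" "l \<noteq> x"
    and "s = [l, x] \<or> s = [x, l]"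
  shows "agrees S (sub l s P) \<longleftrightarrow> sub l s (filter (\<lambda>y. y \<noteq> x) p) = p \<and>
    agrees (S - {p} \<union> ({filter (\<lambda>y. y \<noteq> x) p} - {[]})) P"
proof (rule agrees_insertion[OF assms(1-4), where h = "sub l s"])
  fix P assume "x \<notin> set P"
  then show "filter (\<lambda>y. y \<noteq> x) (sub l s P) = P" using assms(6,7) by (induction P) auto
  show "filter (\<lambda>y. y \<in> set p) (sub l s P) =
      sub l s (filter (\<lambda>y. y \<in> set (filter (\<lambda>y. y \<noteq> x) p)) P)"
    using \<open>x \<notin> set P\<close> assms(3,5-7) by (induction P) auto
qed

text \<open>The two monomials of a commutator of \<open>a_l\<close> and \<open>a_x\<close> differ by
  an adjacent transposition, which is invisible to a block that lacks one of the two letters. This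
  is how commutator terms cancel below.\<close>

lemma agrees_sub_swap:
  assumes "\<And>p. p \<in> S \<Longrightarrow> \<not> (l \<in> set p \<and> x \<in> set p)"
  shows "agrees S (sub l [l, x] P) \<longleftrightarrow> agrees S (sub l [x, l] P)"
proof -
  have "filter (\<lambda>y. y \<in> set p) (sub l [l, x] P) = filter (\<lambda>y. y \<in> set p) (sub l [x, l] P)"
    if "p \<in> S" for p
    using assms[OF that] by (induction P) auto
  then show ?thesis by (simp add: agrees_def)
qed

text \<open>
  The coefficient of a word \<open>\<alpha> @ j # \<beta>\<close> in the second factor of the normal ordering of
  \<open>a_P b_Q a_j \<otimes> b_j\<close>, weighted by \<open>g\<close> on the first factor. While \<open>a_j\<close> moves to the left through
  \<open>b_Q\<close>, the letters of \<open>\<alpha>\<close> and \<open>\<beta>\<close> are absorbed into \<open>b_j\<close> by the third rule, and \<open>a_j\<close> may end in a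
  commutator with some \<open>a_l\<close> by the second rule.
\<close>

definition insertion_value ::
  "('a list \<Rightarrow> 'a list \<Rightarrow> 'k::field_char_0) \<Rightarrow> 'a list \<Rightarrow> 'a list \<Rightarrow> 'a \<Rightarrow> 'a list \<Rightarrow> 'a list \<Rightarrow> 'k"
where
  "insertion_value g \<alpha> \<beta> j P Q =
     (let K = set \<alpha> \<union> set \<beta>; Q' = filter (\<lambda>x. x \<notin> K) Q in
      if filter (\<lambda>x. x \<in> set \<alpha>) Q = rev \<alpha> \<and> filter (\<lambda>x. x \<in> set \<beta>) Q = \<beta>
      then (- 1) ^ length \<alpha> * (g (P @ [j]) Q' -
        (\<Sum>l\<in>set (takeWhile (\<lambda>x. x \<notin> K) Q). g (sub l [l, j] P) Q' - g (sub l [j, l] P) Q'))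
      else 0)"

text \<open>\<open>equation\<close> compares coefficients in the linear equation for
  \<open>f \<otimes> 1\<close>, at targets with second factor \<open>b_\<omega>\<close> whose first
  factor is prescribed only through S and T; j is the label of r. It contains the single term
  \<open>a_P b_Q a_j \<otimes> b_j\<close>. The product in the opposite order has only
  \<open>b_j\<close> in the second factor and is excluded by \<open>2 \<le> length \<omega>\<close>.
  The term with \<open>b_j\<close> in front of f in the second factor can contribute only if
  \<omega> has \<open>N + 1\<close> letters and only through commutators with the \<open>a\<close>
  of index \<open>hd \<omega>\<close>; the last condition makes these cancel. Labels j outside
  \<omega> contribute nothing, since \<open>b_j\<close> never leaves the second factor.\<close>

locale vanishing =
  fixes F :: "nat list \<Rightarrow> nat list \<Rightarrow> 'k::field_char_0" and N :: nat
  assumes renumbered: "bij \<sigma> \<Longrightarrow> F (map \<sigma> P) (map \<sigma> Q) = F P Q"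
    and equation: "finite I \<Longrightarrow> card I = Suc N \<Longrightarrow> set \<omega> \<subseteq> I \<Longrightarrow> distinct \<omega> \<Longrightarrow> 2 \<le> length \<omega> \<Longrightarrow>
      length \<omega> \<noteq> Suc N \<or> (\<forall>p\<in>S. hd \<omega> \<in> set p \<longrightarrow> p = [hd \<omega>]) \<Longrightarrow>
      (\<Sum>j\<in>set \<omega>. \<Sum>P\<in>permutations_of_set (I - {j}). \<Sum>Q\<in>permutations_of_set (I - {j}). F P Q *
        insertion_value (\<lambda>P Q. of_bool (agrees S P \<and> agrees T Q))
          (takeWhile (\<lambda>x. x \<noteq> j) \<omega>) (tl (dropWhile (\<lambda>x. x \<noteq> j) \<omega>)) j P Q) = 0"
    and N_ge_2: "2 \<le> N"
begin

section \<open>Restricted sums of the coefficients\<close>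

definition restricted_sum :: "nat set \<Rightarrow> nat list set \<Rightarrow> nat list set \<Rightarrow> 'k" where
  "restricted_sum J S T = (\<Sum>P\<in>permutations_of_set J. \<Sum>Q\<in>permutations_of_set J.
     F P Q * of_bool (agrees S P \<and> agrees T Q))"

lemma restricted_sum_renumber:
  assumes "bij \<sigma>"
  shows "restricted_sum (\<sigma> ` J) (map \<sigma> ` S) (map \<sigma> ` T) = restricted_sum J S T"
proof -
  have inj: "inj \<sigma>" using assms by (rule bij_is_inj)
  have agr: "agrees (map \<sigma> ` S) (map \<sigma> P) \<longleftrightarrow> agrees S P" for S P
  proof -
    have "filter (\<lambda>x. x \<in> set (map \<sigma> p)) (map \<sigma> P) = map \<sigma> (filter (\<lambda>x. x \<in> set p) P)" for p
      by (induction P) (auto dest: injD[OF inj])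
    then show ?thesis using inj by (simp add: agrees_def inj_map_eq_map del: set_map)
  qed
  have perm: "permutations_of_set (\<sigma> ` J) = map \<sigma> ` permutations_of_set J"
    by (rule permutations_of_set_image_inj) (use inj in \<open>auto intro: inj_on_subset\<close>)
  have inj_on: "inj_on (map \<sigma>) X" for X by (rule inj_on_subset[OF inj_mapI[OF inj] subset_UNIV])
  show ?thesis
    unfolding restricted_sum_def perm sum.reindex[OF inj_on] comp_def agr renumbered[OF assms] ..
qed

text \<open>A condition that sees only the order of the letters of X in Q is a disjoint union over
  the possible words v on X, and each v can be recorded as one more block. In this way order
  conditions become sums over partitions again.\<close>

lemma restricted_sum_group:
  assumes "finite J" "X \<subseteq> J"
  shows "(\<Sum>P\<in>permutations_of_set J. \<Sum>Q\<in>permutations_of_set J.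
      F P Q * of_bool (agrees S P \<and> agrees T Q \<and> C (filter (\<lambda>x. x \<in> X) Q))) =
    (\<Sum>v\<in>{v\<in>permutations_of_set X. C v}. restricted_sum J S (insert v T))"
proof -
  have *: "of_bool (agrees S P \<and> agrees T Q \<and> C (filter (\<lambda>x. x \<in> X) Q)) =
      (\<Sum>v\<in>{v\<in>permutations_of_set X. C v}. of_bool (agrees S P \<and> agrees (insert v T) Q) :: 'k)"
    if "Q \<in> permutations_of_set J" for P Q
  proof -
    let ?w = "filter (\<lambda>x. x \<in> X) Q"
    have w: "?w \<in> permutations_of_set X" by (rule filter_in_permutations[OF that assms(2)])
    have "(\<Sum>v\<in>{v\<in>permutations_of_set X. C v}. of_bool (agrees S P \<and> agrees (insert v T) Q) :: 'k) =
        (\<Sum>v\<in>{v\<in>permutations_of_set X. C v}. if v = ?w then of_bool (agrees S P \<and> agrees T Q) else 0)"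
    proof (rule sum.cong)
      fix v assume "v \<in> {v\<in>permutations_of_set X. C v}"
      then have "set v = X" by (simp add: permutations_of_set_iff)
      then show "(of_bool (agrees S P \<and> agrees (insert v T) Q) :: 'k) =
          (if v = ?w then of_bool (agrees S P \<and> agrees T Q) else 0)"
        by auto
    qed simp
    also have "\<dots> = of_bool (agrees S P \<and> agrees T Q \<and> C ?w)"
      using w by (subst sum.delta) auto
    finally show ?thesis by simp
  qed
  have "(\<Sum>P\<in>permutations_of_set J. \<Sum>Q\<in>permutations_of_set J.
      F P Q * of_bool (agrees S P \<and> agrees T Q \<and> C (filter (\<lambda>x. x \<in> X) Q))) =
    (\<Sum>P\<in>permutations_of_set J. \<Sum>Q\<in>permutations_of_set J.
      \<Sum>v\<in>{v\<in>permutations_of_set X. C v}. F P Q * of_bool (agrees S P \<and> agrees (insert v T) Q))"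
    by (intro sum.cong refl) (simp only: * sum_distrib_left)
  also have "\<dots> = (\<Sum>P\<in>permutations_of_set J. \<Sum>v\<in>{v\<in>permutations_of_set X. C v}.
      \<Sum>Q\<in>permutations_of_set J. F P Q * of_bool (agrees S P \<and> agrees (insert v T) Q))"
    by (intro sum.cong refl sum.swap)
  also have "\<dots> = (\<Sum>v\<in>{v\<in>permutations_of_set X. C v}. \<Sum>P\<in>permutations_of_set J.
      \<Sum>Q\<in>permutations_of_set J. F P Q * of_bool (agrees S P \<and> agrees (insert v T) Q))"
    by (rule sum.swap)
  finally show ?thesis by (simp only: restricted_sum_def)
qed

text \<open>Since y is alone in its block, every commutator with \<open>a_y\<close> cancels. There
  remains the requirement that Q restricts to u, the word absorbed on the right of
  \<open>b_y\<close>, which turns u into a block.\<close>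

lemma sum_insertion_value_new:
  assumes J: "finite J" "y \<notin> J" and S: "word_partition J S" and S': "\<And>p. p \<in> S' \<Longrightarrow> y \<in> set p \<Longrightarrow> p = [y]"
    and SS': "\<And>P. P \<in> permutations_of_set J \<Longrightarrow> agrees S' (P @ [y]) \<longleftrightarrow> agrees S P"
    and T: "\<And>t. t \<in> T \<Longrightarrow> set t \<inter> set u = {}"
  shows "(\<Sum>P\<in>permutations_of_set J. \<Sum>Q\<in>permutations_of_set J. F P Q *
      insertion_value (\<lambda>P Q. of_bool (agrees S' P \<and> agrees T Q)) [] u y P Q) =
    restricted_sum J S (insert u T)"
  unfolding restricted_sum_def
proof (intro sum.cong refl arg_cong2[where f = "(*)"])
  fix P Q assume P: "P \<in> permutations_of_set J" and Q: "Q \<in> permutations_of_set J"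
  have sw: "agrees S' (sub l [l, y] P) \<longleftrightarrow> agrees S' (sub l [y, l] P)" if "l \<in> set Q" for l
  proof (rule agrees_sub_swap)
    have "l \<noteq> y" using that Q J(2) by (auto simp: permutations_of_set_iff)
    then have "l \<notin> set [y]" by simp
    then show "\<not> (l \<in> set p \<and> y \<in> set p)" if "p \<in> S'" for p using S'[OF that] by metis
  qed
  have "(\<Sum>l\<in>set (takeWhile (\<lambda>x. x \<notin> set u) Q).
      of_bool (agrees S' (sub l [l, y] P) \<and> agrees T (filter (\<lambda>x. x \<notin> set u) Q)) -
      of_bool (agrees S' (sub l [y, l] P) \<and> agrees T (filter (\<lambda>x. x \<notin> set u) Q)) :: 'k) = 0"
  proof (intro sum.neutral ballI)
    fix l assume "l \<in> set (takeWhile (\<lambda>x. x \<notin> set u) Q)"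
    then have "l \<in> set Q" by (blast dest: set_takeWhileD)
    from sw[OF this] show "of_bool (agrees S' (sub l [l, y] P) \<and> agrees T (filter (\<lambda>x. x \<notin> set u) Q)) -
      of_bool (agrees S' (sub l [y, l] P) \<and> agrees T (filter (\<lambda>x. x \<notin> set u) Q)) = (0 :: 'k)"
      by simp
  qed
  then show "insertion_value (\<lambda>P Q. of_bool (agrees S' P \<and> agrees T Q)) [] u y P Q =
      (of_bool (agrees S P \<and> agrees (insert u T) Q) :: 'k)"
    using agrees_filter_compl[of T "set u" Q, OF T]
    by (simp add: insertion_value_def Let_def SS'[OF P])
qed

end

lemma word_partition_remove:
  assumes "word_partition I S" "p \<in> S" "x \<in> set p" "q = filter (\<lambda>y. y \<noteq> x) p"
  shows "word_partition (I - {x}) (S - {p} \<union> ({q} - {[]}))"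
    and "card (S - {p} \<union> ({q} - {[]})) = (if q = [] then card S - 1 else card S)"
    and "q = [] \<Longrightarrow> p = [x]"
proof -
  have ins: "insert p (S - {p}) = S" using assms(2) by blast
  have fin: "finite S" using assms(1) by (simp add: word_partition_def)
  have p: "distinct p" "set p \<subseteq> I" "word_partition (I - set p) (S - {p})"
    using assms(1) word_partition_insert[of p "S - {p}" I] unfolding ins by blast+
  have q: "set q = set p - {x}" "distinct q" using p(1) assms(4) by auto
  show "p = [x]" if "q = []"
  proof -
    have "set p = {x}" using q(1) that assms(3) by auto
    then show ?thesis using p(1)
      by (metis distinct_card card.empty card.insert length_0_conv length_Suc_conv
          empty_iff finite.emptyI insert_iff list.set_intros(1) singletonD)
  qed
  then have e: "I - {x} = I - set p" if "q = []" using that by simp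
  have "I - {x} - set q = I - set p" using q(1) assms(3) by auto
  then have *: "word_partition (I - {x}) (insert q (S - {p}))" "q \<notin> S - {p}" if "q \<noteq> []"
    using word_partition_insertI[of "I - {x}" q "S - {p}"] p q that by auto
  show "word_partition (I - {x}) (S - {p} \<union> ({q} - {[]}))"
    using * p(3) e by (cases "q = []") auto
  show "card (S - {p} \<union> ({q} - {[]})) = (if q = [] then card S - 1 else card S)"
    using *(2) fin assms(2) card_Suc_Diff1[OF fin assms(2)] by (cases "q = []") auto
qed

context vanishing
begin

text \<open>
  When the new letter is an old letter \<open>x\<close> of the target, removing \<open>x\<close> from its block in \<open>S\<close> and adding
  the block of \<open>y\<close> leads to partitions that are finer, or equally fine with more blocks in \<open>S\<close>.
\<close>

lemma sum_insertion_value_old: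
  assumes I: "finite I" "card I = Suc N" "y \<in> I"
    and S: "word_partition (I - {y}) S" and T: "word_partition (I - {y} - set (u1 @ x # u2)) T"
    and u: "distinct (u1 @ x # u2)" "set (u1 @ x # u2) \<subseteq> I - {y}" "u2 = [] \<Longrightarrow> [x] \<notin> S"
    and IH: "\<And>J S1 T1. finite J \<Longrightarrow> card J = N \<Longrightarrow> word_partition J S1 \<Longrightarrow> word_partition J T1 \<Longrightarrow>
      card S + card T + 1 < card S1 + card T1 \<or>
      card S1 + card T1 = card S + card T + 1 \<and> card S < card S1 \<Longrightarrow> restricted_sum J S1 T1 = 0"
  shows "(\<Sum>P\<in>permutations_of_set (I - {x}). \<Sum>Q\<in>permutations_of_set (I - {x}). F P Q *
    insertion_value (\<lambda>P Q. of_bool (agrees (insert [y] S) P \<and> agrees T Q)) (y # u1) u2 x P Q) = 0"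
proof -
  define J where "J = I - {x}"
  define S' where "S' = insert [y] S"
  define \<alpha> where "\<alpha> = y # u1"
  define K where "K = set \<alpha> \<union> set u2"
  have xy: "x \<noteq> y" using u(2) by auto
  have xI: "x \<in> I" using u(2) by auto
  have J: "finite J" "card J = N" using I xI by (simp_all add: J_def)
  have K: "K \<subseteq> J" "K \<noteq> {}" "J - K = I - {y} - set (u1 @ x # u2)"
    using u I(3) xy by (auto simp: K_def \<alpha>_def J_def)
  have S': "word_partition I S'" "[y] \<notin> S"
    unfolding S'_def using word_partition_insertI[of I "[y]" S] S I(3) by auto
  have finS: "finite S" "finite T" using S T by (simp_all add: word_partition_def)
  have "x \<in> (\<Union>p\<in>S. set p)" using S u(2) by (auto simp: word_partition_def)
  then obtain p where p: "p \<in> S" "x \<in> set p" by blast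
  have pS': "p \<in> S'" using p by (simp add: S'_def)
  define p0 where "p0 = filter (\<lambda>z. z \<noteq> x) p"
  define S1 where "S1 = S' - {p} \<union> ({p0} - {[]})"
  have S1: "word_partition J S1" "card S1 = (if p0 = [] then card S else card S + 1)"
      "p0 = [] \<Longrightarrow> p = [x]"
    using word_partition_remove[OF S'(1) pS' p(2) p0_def] S'(2) finS(1)
    unfolding J_def S1_def by (auto simp: S'_def)
  define c where "c Q \<longleftrightarrow> filter (\<lambda>x. x \<in> set \<alpha>) Q = rev \<alpha> \<and> filter (\<lambda>x. x \<in> set u2) Q = u2" for Q
  have c_filter: "c (filter (\<lambda>x. x \<in> X) Q) \<longleftrightarrow> c Q" if "K \<subseteq> X" for X Q
    using that by (simp add: c_def filter_filter_set K_def del: filter_filter)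
  have TK: "word_partition (J - K) T" using T K(3) by simp
  have Tdisj: "set t \<inter> K = {}" if "t \<in> T" for t
    using TK that unfolding word_partition_def by blast
  define e0 :: 'k where "e0 = of_bool (p0 @ [x] = p)"
  define e :: "nat \<Rightarrow> 'k" where
    "e l = of_bool (sub l [l, x] p0 = p) - of_bool (sub l [x, l] p0 = p)" for l
  define tw where "tw Q = set (takeWhile (\<lambda>x. x \<notin> K) Q)" for Q :: "nat list"
  have val: "insertion_value (\<lambda>P Q. of_bool (agrees S' P \<and> agrees T Q)) \<alpha> u2 x P Q =
      (- 1) ^ length \<alpha> * (e0 * of_bool (agrees S1 P \<and> agrees T Q \<and> c Q) -
        (\<Sum>l\<in>set p0. e l * of_bool (agrees S1 P \<and> agrees T Q \<and> c Q \<and> l \<in> tw Q)))"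
    if P: "P \<in> permutations_of_set J" and Q: "Q \<in> permutations_of_set J" for P Q
  proof (cases "c Q")
    case True
    have xP: "x \<notin> set P" using P by (simp add: permutations_of_set_iff J_def)
    have a: "agrees S' (P @ [x]) \<longleftrightarrow> p0 @ [x] = p \<and> agrees S1 P"
      using agrees_snoc[OF S'(1) pS' p(2) xP] by (simp add: S1_def p0_def)
    have b: "agrees S' (sub l s P) \<longleftrightarrow> sub l s p0 = p \<and> agrees S1 P"
      if "l \<in> set p0" "s = [l, x] \<or> s = [x, l]" for l s
      using agrees_sub[OF S'(1) pS' p(2) xP _ _ that(2)] that(1) by (simp add: S1_def p0_def)
    \<comment> \<open>A letter outside the block of x shares no block with x, so the sum over the
      prefix of Q reduces to letters of \<open>p0\<close>.\<close>
    have d: "agrees S' (sub l [l, x] P) \<longleftrightarrow> agrees S' (sub l [x, l] P)"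
      if "l \<in> tw Q" "l \<notin> set p0" for l
    proof (rule agrees_sub_swap)
      have "l \<in> set Q" using that(1) unfolding tw_def by (blast dest: set_takeWhileD)
      then have "l \<noteq> x" using Q by (auto simp: permutations_of_set_iff J_def)
      then have "l \<notin> set p" using that(2) by (simp add: p0_def)
      have "q = p \<or> set q \<inter> set p = {}" if "q \<in> S'" for q
        using S'(1) pS' that unfolding word_partition_def by metis
      then show "\<not> (l \<in> set q \<and> x \<in> set q)" if "q \<in> S'" for q
        using that \<open>l \<notin> set p\<close> p(2) by blast
    qed
    have Tf: "agrees T (filter (\<lambda>x. x \<notin> K) Q) \<longleftrightarrow> agrees T Q"
      by (rule agrees_filter_compl[OF Tdisj])
    let ?D = "\<lambda>l. of_bool (agrees S' (sub l [l, x] P) \<and> agrees T (filter (\<lambda>x. x \<notin> K) Q)) -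
        of_bool (agrees S' (sub l [x, l] P) \<and> agrees T (filter (\<lambda>x. x \<notin> K) Q)) :: 'k"
    have "sum ?D (tw Q) = sum ?D (set p0 \<inter> tw Q)"
      by (intro sum.mono_neutral_right) (auto simp: tw_def d[unfolded tw_def])
    also have "\<dots> = (\<Sum>l\<in>set p0. if l \<in> tw Q then ?D l else 0)"
      by (rule sum.inter_restrict) simp
    also have "\<dots> = (\<Sum>l\<in>set p0. e l * of_bool (agrees S1 P \<and> agrees T Q \<and> c Q \<and> l \<in> tw Q))"
      by (intro sum.cong refl) (simp add: b Tf e_def True)
    finally show ?thesis
      using True unfolding insertion_value_def c_def
      by (simp add: Let_def a e0_def Tf flip: K_def tw_def)
  next
    case False
    then have "insertion_value (\<lambda>P Q. of_bool (agrees S' P \<and> agrees T Q)) \<alpha> u2 x P Q = (0 :: 'k)"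
      unfolding insertion_value_def Let_def c_def by (simp only: if_False)
    then show ?thesis by (simp add: False)
  qed
  have zero0: "(\<Sum>P\<in>permutations_of_set J. \<Sum>Q\<in>permutations_of_set J.
      F P Q * of_bool (agrees S1 P \<and> agrees T Q \<and> c Q)) = 0"
  \<comment> \<open>The total to exceed is \<open>card S + card T + 1\<close>. If x was a singleton
    block, then \<open>S1\<close> has only \<open>card S\<close> blocks, so
    \<open>rev \<alpha>\<close> and \<open>u2\<close> must count as two separate blocks; this is
    where \<open>u2\<close> has to be nonempty. Otherwise \<open>S1\<close> has one block more, and
    a single block v on K suffices.\<close>
  proof (cases "p0 = []")
    case True
    then have u2: "u2 \<noteq> []" using u(3) S1(3) p(1) by auto
    have "distinct (rev \<alpha>)" "distinct u2" "set (rev \<alpha>) \<inter> set u2 = {}"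
      using u by (auto simp: \<alpha>_def)
    moreover from this have "set u2 \<subseteq> J - set (rev \<alpha>)" "set (rev \<alpha>) \<subseteq> J"
      using K(1) by (auto simp: K_def)
    moreover have "J - set (rev \<alpha>) - set u2 = J - K" by (auto simp: K_def)
    ultimately have w: "word_partition (J - set (rev \<alpha>)) (insert u2 T)" "u2 \<notin> T"
        "word_partition J (insert (rev \<alpha>) (insert u2 T))" "rev \<alpha> \<notin> insert u2 T"
      using word_partition_insertI[of "J - set (rev \<alpha>)" u2 T]
        word_partition_insertI[of J "rev \<alpha>" "insert u2 T"] u2 TK
      by (simp_all add: \<alpha>_def)
    then have "restricted_sum J S1 (insert (rev \<alpha>) (insert u2 T)) = 0"
      using True S1 finS by (intro IH J) auto
    then show ?thesis by (simp add: restricted_sum_def c_def conj_ac)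
  next
    case False
    have "(\<Sum>P\<in>permutations_of_set J. \<Sum>Q\<in>permutations_of_set J.
        F P Q * of_bool (agrees S1 P \<and> agrees T Q \<and> c Q)) =
      (\<Sum>v\<in>{v\<in>permutations_of_set K. c v}. restricted_sum J S1 (insert v T))"
      using restricted_sum_group[OF J(1) K(1), of S1 T c] by (simp add: c_filter del: filter_filter)
    also have "\<dots> = 0"
    proof (intro sum.neutral ballI)
      fix v assume "v \<in> {v\<in>permutations_of_set K. c v}"
      then have v: "set v = K" "distinct v" by (auto simp: permutations_of_set_iff)
      then have "word_partition J (insert v T)" "v \<notin> T"
        using word_partition_insertI[of J v T] TK K(1,2) by auto
      then show "restricted_sum J S1 (insert v T) = 0"
        using False S1 finS by (intro IH J) auto
    qed
    finally show ?thesis .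
  qed
  have zero: "(\<Sum>P\<in>permutations_of_set J. \<Sum>Q\<in>permutations_of_set J.
      F P Q * of_bool (agrees S1 P \<and> agrees T Q \<and> c Q \<and> l \<in> tw Q)) = 0" if l: "l \<in> set p0" for l
  proof (cases "l \<in> K")
    case True
    then have "l \<notin> tw Q" for Q unfolding tw_def by (blast dest: set_takeWhileD)
    then show ?thesis by simp
  next
    case False
    have "l \<in> set p" "l \<noteq> x" using l by (auto simp: p0_def)
    then have "l \<in> J - K" using S'(1) pS' False unfolding word_partition_def J_def by blast
    then obtain t where t: "t \<in> T" "l \<in> set t" using TK unfolding word_partition_def by blast
    \<comment> \<open>That l precedes all of K is a condition on the relative order of the block t
      and K, so both are merged into one block v on X. The total is then exactly
      \<open>card S + card T + 1\<close>, but \<open>S1\<close> has more blocks than S: the second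
      alternative of the induction hypothesis.\<close>
    define X where "X = set t \<union> K"
    have Tt: "insert t (T - {t}) = T" using t by blast
    have JX: "J - X = J - K - set t" by (auto simp: X_def)
    have t': "set t \<subseteq> J - K" "word_partition (J - X) (T - {t})"
      using TK word_partition_insert[of t "T - {t}" "J - K"] unfolding JX Tt by blast+
    have X: "X \<subseteq> J" "K \<subseteq> X" "set t \<subseteq> X" using t' K by (auto simp: X_def)
    define C where "C v \<longleftrightarrow> filter (\<lambda>x. x \<in> set t) v = t \<and> c v \<and> l \<in> tw v" for v
    have "l \<in> tw (filter (\<lambda>x. x \<in> X) Q) \<longleftrightarrow> l \<in> tw Q" for Q
    proof -
      have "takeWhile (\<lambda>x. x \<notin> K) (filter (\<lambda>x. x \<in> X) Q) = filter (\<lambda>x. x \<in> X) (takeWhile (\<lambda>x. x \<notin> K) Q)"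
        using X(2) by (intro filter_takeWhile[symmetric]) auto
      then show ?thesis using t X by (auto simp: tw_def)
    qed
    then have C_filter: "C (filter (\<lambda>x. x \<in> X) Q) \<longleftrightarrow> filter (\<lambda>x. x \<in> set t) Q = t \<and> c Q \<and> l \<in> tw Q" for Q
      using X by (simp add: C_def c_filter filter_filter_set del: filter_filter)
    have "agrees T Q \<and> c Q \<and> l \<in> tw Q \<longleftrightarrow> agrees (T - {t}) Q \<and> C (filter (\<lambda>x. x \<in> X) Q)" for Q
      unfolding C_filter by (subst Tt[symmetric], subst agrees_insert) blast
    then have "(\<Sum>P\<in>permutations_of_set J. \<Sum>Q\<in>permutations_of_set J.
        F P Q * of_bool (agrees S1 P \<and> agrees T Q \<and> c Q \<and> l \<in> tw Q)) =
      (\<Sum>v\<in>{v\<in>permutations_of_set X. C v}. restricted_sum J S1 (insert v (T - {t})))"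
      using restricted_sum_group[OF J(1) X(1), of S1 "T - {t}" C] by (simp del: filter_filter)
    also have "\<dots> = 0"
    proof (intro sum.neutral ballI)
      fix v assume "v \<in> {v\<in>permutations_of_set X. C v}"
      then have v: "set v = X" "distinct v" by (auto simp: permutations_of_set_iff)
      have "v \<noteq> []" using v(1) X(2) K(2) by auto
      then have w: "word_partition J (insert v (T - {t}))" "v \<notin> T - {t}"
        using word_partition_insertI[of J v "T - {t}"] t'(2) X(1) v by simp_all
      have "card (insert v (T - {t})) = card T"
        using w(2) finS(2) card_Suc_Diff1[OF finS(2) t(1)] by simp
      then show "restricted_sum J S1 (insert v (T - {t})) = 0"
        using l S1 by (intro IH J w) auto
    qed
    finally show ?thesis .
  qed
  have "(\<Sum>P\<in>permutations_of_set J. \<Sum>Q\<in>permutations_of_set J. F P Q *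
      insertion_value (\<lambda>P Q. of_bool (agrees S' P \<and> agrees T Q)) \<alpha> u2 x P Q) =
    (\<Sum>P\<in>permutations_of_set J. \<Sum>Q\<in>permutations_of_set J.
      (- 1) ^ length \<alpha> * e0 * (F P Q * of_bool (agrees S1 P \<and> agrees T Q \<and> c Q)) -
      (\<Sum>l\<in>set p0. (- 1) ^ length \<alpha> * e l *
        (F P Q * of_bool (agrees S1 P \<and> agrees T Q \<and> c Q \<and> l \<in> tw Q))))"
  proof (intro sum.cong refl)
    fix P Q assume "P \<in> permutations_of_set J" "Q \<in> permutations_of_set J"
    show "F P Q * insertion_value (\<lambda>P Q. of_bool (agrees S' P \<and> agrees T Q)) \<alpha> u2 x P Q =
      (- 1) ^ length \<alpha> * e0 * (F P Q * of_bool (agrees S1 P \<and> agrees T Q \<and> c Q)) -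
      (\<Sum>l\<in>set p0. (- 1) ^ length \<alpha> * e l *
        (F P Q * of_bool (agrees S1 P \<and> agrees T Q \<and> c Q \<and> l \<in> tw Q)))"
      unfolding val[OF \<open>P \<in> _\<close> \<open>Q \<in> _\<close>]
      by (simp only: right_diff_distrib sum_distrib_left mult_ac)
  qed
  also have "\<dots> = (- 1) ^ length \<alpha> * e0 * (\<Sum>P\<in>permutations_of_set J. \<Sum>Q\<in>permutations_of_set J.
        F P Q * of_bool (agrees S1 P \<and> agrees T Q \<and> c Q)) -
      (\<Sum>l\<in>set p0. (- 1) ^ length \<alpha> * e l * (\<Sum>P\<in>permutations_of_set J. \<Sum>Q\<in>permutations_of_set J.
        F P Q * of_bool (agrees S1 P \<and> agrees T Q \<and> c Q \<and> l \<in> tw Q)))"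
    unfolding sum_subtractf sum_distrib_left
    by (subst sum.swap[of _ "set p0"], intro arg_cong2[where f = "(-)"] refl sum.cong sum.swap)
  also have "\<dots> = 0" by (simp only: zero0 zero mult_zero_right sum.neutral_const diff_self cong: sum.cong)
  finally show ?thesis unfolding J_def S'_def \<alpha>_def .
qed

end

section \<open>One-letter blocks and shuffles of a letter into a word\<close>

lemma takeWhile_neq_append: "x \<notin> set a \<Longrightarrow> takeWhile (\<lambda>z. z \<noteq> x) (a @ x # b) = a"
  and dropWhile_neq_append: "x \<notin> set a \<Longrightarrow> dropWhile (\<lambda>z. z \<noteq> x) (a @ x # b) = x # b"
  by (induction a) auto

lemma filter_eq_singleton: "distinct P \<Longrightarrow> z \<in> set P \<Longrightarrow> filter (\<lambda>x. x = z) P = [z]"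
  by (induction P) (auto simp: filter_empty_conv)

lemma agrees_singletons:
  "distinct P \<Longrightarrow> Z \<subseteq> set P \<Longrightarrow> agrees ((\<lambda>z. [z]) ` Z) P"
  by (auto simp: agrees_def filter_eq_singleton)

lemma insertions_of_letter:
  assumes "distinct w" "x \<notin> set w"
  shows "{v \<in> permutations_of_set (insert x (set w)).
      filter (\<lambda>z. z \<in> set w) v = w \<and> filter (\<lambda>z. z \<in> set [x]) v = [x]} =
    (\<lambda>k. take k w @ x # drop k w) ` {..length w}"
proof (intro equalityI subsetI)
  fix v assume v: "v \<in> {v \<in> permutations_of_set (insert x (set w)).
      filter (\<lambda>z. z \<in> set w) v = w \<and> filter (\<lambda>z. z \<in> set [x]) v = [x]}"
  then have "x \<in> set v" by (auto simp: permutations_of_set_iff)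
  then obtain a b where ab: "v = a @ x # b" by (meson split_list)
  have "set a \<subseteq> set w" "set b \<subseteq> set w"
    using v unfolding ab by (auto simp: permutations_of_set_iff)
  then have "w = a @ b" using v assms(2) unfolding ab by (auto simp: filter_id_conv subset_iff)
  then show "v \<in> (\<lambda>k. take k w @ x # drop k w) ` {..length w}"
    unfolding ab by (intro image_eqI[where x = "length a"]) auto
next
  fix v assume "v \<in> (\<lambda>k. take k w @ x # drop k w) ` {..length w}"
  then obtain k where k: "v = take k w @ x # drop k w" by blast
  have w: "set (take k w) \<subseteq> set w" "set (drop k w) \<subseteq> set w"
    by (rule set_take_subset set_drop_subset)+
  have x: "x \<notin> set (take k w)" "x \<notin> set (drop k w)" using w assms(2) by blast+
  have "set w = set (take k w) \<union> set (drop k w)" by (metis append_take_drop_id set_append)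
  then have "v \<in> permutations_of_set (insert x (set w))"
    using assms(1) x set_take_disj_set_drop_if_distinct[OF assms(1), of k k]
    unfolding k permutations_of_set_iff by auto
  moreover have "filter (\<lambda>z. z \<in> set w) (take k w) = take k w"
      "filter (\<lambda>z. z \<in> set w) (drop k w) = drop k w"
      "filter (\<lambda>z. z = x) (take k w) = []" "filter (\<lambda>z. z = x) (drop k w) = []"
    using w x by (auto simp: filter_id_conv filter_empty_conv)
  ultimately show "v \<in> {v \<in> permutations_of_set (insert x (set w)).
      filter (\<lambda>z. z \<in> set w) v = w \<and> filter (\<lambda>z. z \<in> set [x]) v = [x]}"
    using assms(2) by (simp add: k)
qed

context vanishing
begin

definition vanishes_above :: "nat \<Rightarrow> nat \<Rightarrow> bool" where
  "vanishes_above d n \<longleftrightarrow> (\<forall>J S T. finite J \<longrightarrow> card J = N \<longrightarrow> word_partition J S \<longrightarrow>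
     word_partition J T \<longrightarrow> n < card S + card T \<or> card S + card T = n \<and> d < card S \<longrightarrow> restricted_sum J S T = 0)"

lemma vanishes_aboveD:
  "vanishes_above d n \<Longrightarrow> finite J \<Longrightarrow> card J = N \<Longrightarrow> word_partition J S \<Longrightarrow>
    word_partition J T \<Longrightarrow> n < card S + card T \<or> card S + card T = n \<and> d < card S \<Longrightarrow> restricted_sum J S T = 0"
  unfolding vanishes_above_def by blast

text \<open>The target has the extra block \<open>[y]\<close> in the first factor and the word \<open>y # u\<close> in the second.\<close>

lemma restricted_sum_last_not_singleton:
  assumes J: "finite J" "card J = N" and S: "word_partition J S" and T: "word_partition (J - set u) T"
    and u: "u \<noteq> []" "distinct u" "set u \<subseteq> J" "[last u] \<notin> S"
    and IH: "vanishes_above (card S) (card S + card T + 1)"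
  shows "restricted_sum J S (insert u T) = 0"
proof -
  obtain y where y: "y \<notin> J" using ex_new_if_finite[OF infinite_UNIV_nat J(1)] by blast
  define I where "I = insert y J"
  have I: "finite I" "card I = Suc N" "I - {y} = J" using J y by (auto simp: I_def)
  let ?S = "insert [y] S"
  let ?V = "\<lambda>j. \<Sum>P\<in>permutations_of_set (I - {j}). \<Sum>Q\<in>permutations_of_set (I - {j}). F P Q *
        insertion_value (\<lambda>P Q. of_bool (agrees ?S P \<and> agrees T Q))
          (takeWhile (\<lambda>x. x \<noteq> j) (y # u)) (tl (dropWhile (\<lambda>x. x \<noteq> j) (y # u))) j P Q"
  have S_J: "set p \<subseteq> J" if "p \<in> S" for p using S that unfolding word_partition_def by blast
  then have yS: "y \<notin> set p" if "p \<in> S" for p using y that by blast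
  \<comment> \<open>The summand of y is the sum in question; each summand of a letter of u vanishes
    by the induction hypothesis.\<close>
  have "(\<Sum>j\<in>set (y # u). ?V j) = 0"
  proof (rule equation)
    show "set (y # u) \<subseteq> I" "distinct (y # u)" using u y by (auto simp: I_def)
    show "2 \<le> length (y # u)" using u(1) by (cases u) auto
    show "length (y # u) \<noteq> Suc N \<or> (\<forall>p\<in>?S. hd (y # u) \<in> set p \<longrightarrow> p = [hd (y # u)])"
      using yS by auto
  qed (use I in auto)
  moreover have "?V x = 0" if "x \<in> set u" for x
  proof -
    obtain u1 u2 where sp: "u = u1 @ x # u2" using split_list[OF \<open>x \<in> set u\<close>] by blast
    have x: "x \<notin> set (y # u1)" using u(2,3) y unfolding sp by auto
    have yu: "y # u = (y # u1) @ x # u2" by (simp add: sp)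
    show ?thesis
      unfolding yu takeWhile_neq_append[OF x] dropWhile_neq_append[OF x] list.sel
    proof (rule sum_insertion_value_old)
      show "word_partition (I - {y}) S" using S I(3) by simp
      show "word_partition (I - {y} - set (u1 @ x # u2)) T" using T I(3) sp by simp
      show "y \<in> I" by (simp add: I_def)
      show "distinct (u1 @ x # u2)" using u(2) sp by simp
      show "set (u1 @ x # u2) \<subseteq> I - {y}" using u(3) sp I(3) by simp
      \<comment> \<open>If nothing follows x in u, then x is \<open>last u\<close>.\<close>
      show "[x] \<notin> S" if "u2 = []" using u(4) sp that by simp
    qed (use I vanishes_aboveD[OF IH] in auto)
  qed
  moreover have "?V y = restricted_sum J S (insert u T)"
  proof -
    have "?V y = (\<Sum>P\<in>permutations_of_set J. \<Sum>Q\<in>permutations_of_set J. F P Q *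
      insertion_value (\<lambda>P Q. of_bool (agrees ?S P \<and> agrees T Q)) [] u y P Q)"
      unfolding I(3) by simp
    also have "\<dots> = restricted_sum J S (insert u T)"
    proof (rule sum_insertion_value_new[OF J(1) y S])
      show "p = [y]" if "p \<in> ?S" "y \<in> set p" for p using that yS by auto
      show "set t \<inter> set u = {}" if "t \<in> T" for t
        using T that unfolding word_partition_def by blast
      fix P assume P: "P \<in> permutations_of_set J"
      then have "y \<notin> set P" using y by (simp add: permutations_of_set_iff)
      moreover from this have "filter (\<lambda>x. x = y) P = []" by (auto simp: filter_empty_conv)
      ultimately show "agrees ?S (P @ [y]) \<longleftrightarrow> agrees S P" using yS by (simp add: agrees_def)
    qed
    finally show ?thesis .
  qed
  moreover have "y \<notin> set u" using u(3) y by blast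
  ultimately show ?thesis by simp
qed

text \<open>The transposition of x and z permutes the blocks \<open>[x]\<close> and
  \<open>[z]\<close> of S and fixes all other blocks of S and all of T, so invariance under
  renumbering exchanges the two words.\<close>

lemma restricted_sum_swap:
  assumes S: "word_partition J S" "[x] \<in> S" "[z] \<in> S"
    and T: "word_partition (J - set (c1 @ [x, z] @ c2)) T" "distinct (c1 @ [x, z] @ c2)"
  shows "restricted_sum J S (insert (c1 @ [x, z] @ c2) T) = restricted_sum J S (insert (c1 @ [z, x] @ c2) T)"
proof -
  define \<sigma> where "\<sigma> = Transposition.transpose x z"
  have \<sigma>: "bij \<sigma>" by (simp add: \<sigma>_def)
  have id: "map \<sigma> p = p" if "x \<notin> set p" "z \<notin> set p" for p
    using that by (intro map_idI) (auto simp: \<sigma>_def transpose_def)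
  have "x \<in> J" "z \<in> J" using S unfolding word_partition_def by auto
  then have "\<sigma> ` J = J" unfolding \<sigma>_def by (rule transpose_image_eq[OF iffI, rotated])
  moreover have "map \<sigma> ` S = S"
  proof -
    have "map \<sigma> p = p" if "p \<in> S - {[x], [z]}" for p
    proof (rule id)
      have "set p \<inter> set [x] = {}" "set p \<inter> set [z] = {}"
        using S that unfolding word_partition_def by (metis DiffE insert_iff)+
      then show "x \<notin> set p" "z \<notin> set p" by auto
    qed
    then have "map \<sigma> ` (S - {[x], [z]}) = S - {[x], [z]}" by (simp add: image_def)
    moreover have "map \<sigma> ` {[x], [z]} = {[x], [z]}" by (auto simp: \<sigma>_def)
    moreover have "S = S - {[x], [z]} \<union> {[x], [z]}" using S by blast
    ultimately show ?thesis by (metis image_Un)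
  qed
  moreover have "map \<sigma> ` T = T"
  proof -
    have "map \<sigma> p = p" if "p \<in> T" for p
      by (rule id) (use T(1) that in \<open>auto simp: word_partition_def\<close>)
    then show ?thesis by (simp add: image_def)
  qed
  moreover have "map \<sigma> (c1 @ [x, z] @ c2) = c1 @ [z, x] @ c2"
    using T(2) id[of c1] id[of c2] by (simp add: \<sigma>_def)
  ultimately show ?thesis
    using restricted_sum_renumber[OF \<sigma>, of J S "insert (c1 @ [x, z] @ c2) T"] by (simp only: image_insert)
qed

lemma restricted_sum_move:
  assumes "word_partition J S" "[x] \<in> S" "\<And>z. z \<in> set c2 \<Longrightarrow> [z] \<in> S"
    and "word_partition (J - set (c1 @ x # c2)) T" "distinct (c1 @ x # c2)"
  shows "restricted_sum J S (insert (c1 @ x # c2) T) = restricted_sum J S (insert (c1 @ c2 @ [x]) T)"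
  using assms
proof (induction c2 arbitrary: c1)
  case (Cons z c2)
  have "restricted_sum J S (insert (c1 @ x # z # c2) T) = restricted_sum J S (insert (c1 @ z # x # c2) T)"
    using restricted_sum_swap[of J S x z c1 c2 T] Cons.prems by simp
  also have "\<dots> = restricted_sum J S (insert ((c1 @ [z]) @ c2 @ [x]) T)"
    using Cons.IH[of "c1 @ [z]"] Cons.prems by (simp add: insert_commute)
  finally show ?case by simp
qed simp

text \<open>The words restricting to w and to \<open>[x]\<close> are the shuffles of the two. The
  left-hand side has one block more than every summand, so in the induction it is already known to
  vanish.\<close>

lemma restricted_sum_insert_letter:
  assumes "finite J" "distinct w" "x \<notin> set w" "set w \<subseteq> J" "x \<in> J"
  shows "restricted_sum J S (insert w (insert [x] T)) = (\<Sum>k\<le>length w. restricted_sum J S (insert (take k w @ x # drop k w) T))"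
proof -
  define C where "C v \<longleftrightarrow> filter (\<lambda>z. z \<in> set w) v = w \<and> filter (\<lambda>z. z \<in> set [x]) v = [x]" for v
  define X where "X = insert x (set w)"
  have "C (filter (\<lambda>z. z \<in> X) Q) \<longleftrightarrow> C Q" for Q
    unfolding C_def by (subst (1 2) filter_filter_set) (auto simp: X_def)
  moreover have "of_bool (agrees S P \<and> agrees (insert w (insert [x] T)) Q) =
      (of_bool (agrees S P \<and> agrees T Q \<and> C Q) :: 'k)" for P Q
    unfolding C_def agrees_insert by (simp add: conj_ac)
  ultimately have "restricted_sum J S (insert w (insert [x] T)) =
      (\<Sum>v\<in>{v\<in>permutations_of_set X. C v}. restricted_sum J S (insert v T))"
    unfolding restricted_sum_def[of J S "insert w (insert [x] T)"]
    using restricted_sum_group[OF assms(1), of X S T C] assms(4,5) by (simp add: X_def)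
  also have "{v\<in>permutations_of_set X. C v} = (\<lambda>k. take k w @ x # drop k w) ` {..length w}"
    unfolding C_def X_def by (rule insertions_of_letter[OF assms(2,3)])
  also have "(\<Sum>v\<in>(\<lambda>k. take k w @ x # drop k w) ` {..length w}. restricted_sum J S (insert v T)) =
      (\<Sum>k\<le>length w. restricted_sum J S (insert (take k w @ x # drop k w) T))"
  proof (subst sum.reindex)
    show "inj_on (\<lambda>k. take k w @ x # drop k w) {..length w}"
    proof (rule inj_onI)
      fix k m assume km: "k \<in> {..length w}" "m \<in> {..length w}"
        "take k w @ x # drop k w = take m w @ x # drop m w"
      have "x \<notin> set (take k w)" for k using assms(3) by (meson in_set_takeD)
      then have "take k w = take m w"
        using arg_cong[OF km(3), of "takeWhile (\<lambda>z. z \<noteq> x)"] by (simp add: takeWhile_neq_append)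
      then show "k = m" using km by (metis atMost_iff length_take min.absorb2)
    qed
  qed simp
  finally show ?thesis .
qed

text \<open>
  Shuffling the last letter \<open>x\<close> into the rest of the word gives a sum over a finer partition, hence \<open>0\<close>.
  The words in which \<open>x\<close> stays in the trailing block of singletons all have the same restricted sum.
\<close>

lemma restricted_sum_trailing_singletons:
  assumes J: "finite J" "card J = N" and S: "word_partition J S"
    and IH: "vanishes_above (card S) (card S + card T + 1)"
    and "word_partition (J - set (w0 @ zs)) T" "distinct (w0 @ zs)" "set (w0 @ zs) \<subseteq> J"
    and "\<And>z. z \<in> set zs \<Longrightarrow> [z] \<in> S" "w0 \<noteq> [] \<Longrightarrow> [last w0] \<notin> S"
    and "w0 @ zs \<noteq> []" "\<And>x. w0 @ zs = [x] \<Longrightarrow> [x] \<notin> S"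
  shows "restricted_sum J S (insert (w0 @ zs) T) = 0"
  using assms(5-)
proof (induction zs arbitrary: w0 rule: rev_induct)
  case Nil
  then show ?case using restricted_sum_last_not_singleton[OF J S, of w0 T] IH by simp
next
  case (snoc x zs)
  define w where "w = w0 @ zs"
  have w: "distinct w" "x \<notin> set w" "set w \<subseteq> J" "x \<in> J" and xS: "[x] \<in> S"
    using snoc.prems by (auto simp: w_def)
  have w_ne: "w \<noteq> []"
    using snoc.prems(7)[of x] xS by (auto simp: w_def)
  have set_w: "J - set (w0 @ zs @ [x]) = J - set w - set [x]" by (auto simp: w_def)
  have "word_partition (J - set w) (insert [x] T)" "[x] \<notin> T"
    using word_partition_insertI[of "J - set w" "[x]" T] snoc.prems(1) w
    unfolding set_w by simp_all
  moreover from this have "word_partition J (insert w (insert [x] T))" "w \<notin> insert [x] T"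
    using word_partition_insertI[of J w "insert [x] T"] w w_ne by auto
  moreover have "finite T" using snoc.prems(1) by (simp add: word_partition_def)
  ultimately have "restricted_sum J S (insert w (insert [x] T)) = 0"
    by (intro vanishes_aboveD[OF IH J S]) auto
  moreover have "restricted_sum J S (insert (take k w @ x # drop k w) T) =
      (if k < length w0 then 0 else restricted_sum J S (insert (w0 @ zs @ [x]) T))" if "k \<le> length w" for k
  \<comment> \<open>If x lands inside \<open>w0\<close>, the last letter of \<open>w0\<close> stays
    last and the trailing part has lost x: the induction hypothesis applies. Otherwise x lands among
    the trailing singletons, and swaps carry it to the end.\<close>
  proof (cases "k < length w0")
    case True
    let ?v = "take k w0 @ x # drop k w0"
    have ne: "drop k w0 \<noteq> []" using True by simp
    have m: "mset ?v = mset (x # w0)" by (metis append_take_drop_id mset.simps(2) mset_append union_mset_add_mset_right)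
    then have s: "set ?v = insert x (set w0)" "distinct ?v \<longleftrightarrow> distinct (x # w0)"
      by (metis list.simps(15) mset_eq_setD, metis mset_eq_imp_distinct_iff)
    have "set (?v @ zs) = set (w0 @ zs @ [x])" using s(1) by auto
    moreover have "distinct (?v @ zs)" using snoc.prems(2) s by auto
    moreover have "last ?v = last w0" using ne by (simp add: last_drop)
    moreover have "w0 \<noteq> []" using True by auto
    moreover from snoc.prems(5)[OF this] have "[last w0] \<notin> S" .
    moreover have "?v @ zs \<noteq> [y]" for y using ne by (cases "take k w0") auto
    ultimately have "restricted_sum J S (insert (?v @ zs) T) = 0"
      using snoc.prems True by (intro snoc.IH) auto
    then show ?thesis using True by (simp add: w_def)
  next
    case False
    define m where "m = k - length w0"
    have zs: "set (take m zs) \<subseteq> set zs" "set (drop m zs) \<subseteq> set zs"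
      by (rule set_take_subset set_drop_subset)+
    have e: "take k w @ x # drop k w = (w0 @ take m zs) @ x # drop m zs"
      using False by (simp add: w_def m_def)
    have mz: "mset (take m zs) + mset (drop m zs) = mset zs"
      by (metis append_take_drop_id mset_append)
    have "mset ((w0 @ take m zs) @ x # drop m zs) = mset (w0 @ zs @ [x])"
      using mz by simp
    then have s: "set ((w0 @ take m zs) @ x # drop m zs) = set (w0 @ zs @ [x])"
        "distinct ((w0 @ take m zs) @ x # drop m zs)"
      using snoc.prems(2) by (metis mset_eq_setD, metis mset_eq_imp_distinct_iff)
    have "restricted_sum J S (insert ((w0 @ take m zs) @ x # drop m zs) T) =
        restricted_sum J S (insert ((w0 @ take m zs) @ drop m zs @ [x]) T)"
    proof (rule restricted_sum_move[OF S xS])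
      show "[z] \<in> S" if "z \<in> set (drop m zs)" for z using snoc.prems(4) that zs(2) by auto
      show "word_partition (J - set ((w0 @ take m zs) @ x # drop m zs)) T"
        unfolding s(1) by (rule snoc.prems(1))
    qed (rule s(2))
    also have "(w0 @ take m zs) @ drop m zs @ [x] = w0 @ zs @ [x]"
      by (metis append_assoc append_take_drop_id)
    finally show ?thesis unfolding e using False by simp
  qed
  ultimately have "(\<Sum>k\<le>length w. if k < length w0 then 0 else restricted_sum J S (insert (w0 @ zs @ [x]) T)) = 0"
    using restricted_sum_insert_letter[OF J(1) w, of S T] by simp
  also have "(\<Sum>k\<le>length w. if k < length w0 then 0 else restricted_sum J S (insert (w0 @ zs @ [x]) T)) =
      (\<Sum>k\<in>{length w0..length w}. restricted_sum J S (insert (w0 @ zs @ [x]) T))"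
    by (rule sum.mono_neutral_cong_right) auto
  also have "\<dots> = of_nat (Suc (length zs)) * restricted_sum J S (insert (w0 @ zs @ [x]) T)"
    by (simp add: w_def)
  \<comment> \<open>A multiple by \<open>Suc (length zs)\<close> vanishes, and the characteristic is
    0.\<close>
  finally show ?case by (simp del: of_nat_Suc)
qed

text \<open>
  The finest partitions; for \<open>N = 1\<close> the sum need not vanish, since \<open>a_1 b_1\<close> solves the equation.
\<close>

lemma restricted_sum_singletons:
  assumes J: "finite J" "card J = N"
  shows "restricted_sum J ((\<lambda>z. [z]) ` J) ((\<lambda>z. [z]) ` J) = 0"
proof -
  obtain x where x: "x \<in> J" using J N_ge_2 by fastforce
  obtain y where y: "y \<notin> J" using ex_new_if_finite[OF infinite_UNIV_nat J(1)] by blast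
  have xy: "x \<noteq> y" using x y by blast
  define I where "I = insert y J"
  have I: "finite I" "card I = Suc N" "I - {y} = J" using J y by (auto simp: I_def)
  \<comment> \<open>The target has the word \<open>[x, y]\<close> in the second factor. The block
    \<open>[x, y]\<close> in the first tells the two labels of r apart: appending y to P agrees with
    it, appending x does not. The prefix of Q over which commutators are taken stops before the
    other letter of the block, so all commutators cancel. Since \<open>2 \<le> N\<close>, the target
    is shorter than \<open>N + 1\<close>, as \<open>equation\<close> demands.\<close>
  define Z where "Z = (\<lambda>z. [z]) ` (J - {x})"
  let ?S = "insert [x, y] Z"
  let ?V = "\<lambda>j. \<Sum>P\<in>permutations_of_set (I - {j}). \<Sum>Q\<in>permutations_of_set (I - {j}). F P Q *
        insertion_value (\<lambda>P Q. of_bool (agrees ?S P \<and> agrees Z Q))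
          (takeWhile (\<lambda>z. z \<noteq> j) [x, y]) (tl (dropWhile (\<lambda>z. z \<noteq> j) [x, y])) j P Q"
  have "(\<Sum>j\<in>set [x, y]. ?V j) = 0"
    by (rule equation) (use I x xy N_ge_2 in \<open>auto simp: I_def\<close>)
  moreover have "?V x = 0"
  proof (intro sum.neutral ballI)
    fix P Q assume P: "P \<in> permutations_of_set (I - {x})" and Q: "Q \<in> permutations_of_set (I - {x})"
    have "y \<in> set P" "x \<notin> set P" "distinct P"
      using P xy by (auto simp: permutations_of_set_iff I_def)
    then have "filter (\<lambda>z. z = x \<or> z = y) P = [y]"
      by (subst filter_eq_singleton[symmetric, of P y]) (auto intro!: filter_cong)
    then have "\<not> agrees ?S (P @ [x])" using xy by auto
    moreover have "agrees ?S (sub l [l, x] P) \<longleftrightarrow> agrees ?S (sub l [x, l] P)"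
      if "l \<in> set (takeWhile (\<lambda>z. z \<noteq> y) Q)" for l
    proof (rule agrees_sub_swap)
      have "l \<noteq> y" "l \<in> set Q" using set_takeWhileD[OF that] by auto
      then have "l \<notin> {x, y}" using Q by (auto simp: permutations_of_set_iff)
      then show "\<not> (l \<in> set p \<and> x \<in> set p)" if "p \<in> ?S" for p
        using that by (auto simp: Z_def)
    qed
    ultimately show "F P Q * insertion_value (\<lambda>P Q. of_bool (agrees ?S P \<and> agrees Z Q))
        (takeWhile (\<lambda>z. z \<noteq> x) [x, y]) (tl (dropWhile (\<lambda>z. z \<noteq> x) [x, y])) x P Q = 0"
      by (simp add: insertion_value_def Let_def del: agrees_insert)
  qed
  moreover have "?V y = - restricted_sum J ((\<lambda>z. [z]) ` J) ((\<lambda>z. [z]) ` J)"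
    unfolding restricted_sum_def I(3) sum_negf[symmetric]
  proof (intro sum.cong refl)
    fix P Q assume P: "P \<in> permutations_of_set J" and Q: "Q \<in> permutations_of_set J"
    have P': "x \<in> set P" "y \<notin> set P" "distinct P" "set P = J" and Q': "distinct Q" "set Q = J"
      using P Q x y by (auto simp: permutations_of_set_iff)
    have "filter (\<lambda>z. z = x \<or> z = y) P = [x]"
      using P' by (subst filter_eq_singleton[symmetric, of P x]) (auto intro!: filter_cong)
    moreover have "agrees Z (P @ [y])"
      unfolding Z_def by (rule agrees_singletons) (use P' in auto)
    ultimately have "agrees ?S (P @ [y])" using xy by simp
    moreover have "agrees ?S (sub l [l, y] P) \<longleftrightarrow> agrees ?S (sub l [y, l] P)"
      if "l \<in> set (takeWhile (\<lambda>z. z \<noteq> x) Q)" for l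
    proof (rule agrees_sub_swap)
      have "l \<noteq> x" "l \<in> set Q" using set_takeWhileD[OF that] by auto
      then have "l \<notin> {x, y}" using Q' y by auto
      then show "\<not> (l \<in> set p \<and> y \<in> set p)" if "p \<in> ?S" for p
        using that y by (auto simp: Z_def)
    qed
    moreover have "filter (\<lambda>z. z = x) Q = [x]" by (rule filter_eq_singleton) (use Q' x in auto)
    moreover have "agrees Z (filter (\<lambda>z. z \<noteq> x) Q)"
      unfolding Z_def by (rule agrees_singletons) (use Q' in auto)
    moreover have "agrees ((\<lambda>z. [z]) ` J) P" "agrees ((\<lambda>z. [z]) ` J) Q"
      using P' Q' by (auto intro: agrees_singletons)
    ultimately show "F P Q * insertion_value (\<lambda>P Q. of_bool (agrees ?S P \<and> agrees Z Q))
        (takeWhile (\<lambda>z. z \<noteq> y) [x, y]) (tl (dropWhile (\<lambda>z. z \<noteq> y) [x, y])) y P Q =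
      - (F P Q * of_bool (agrees ((\<lambda>z. [z]) ` J) P \<and> agrees ((\<lambda>z. [z]) ` J) Q))"
      using xy by (simp add: insertion_value_def Let_def del: agrees_insert)
  qed
  ultimately show ?thesis using xy by simp
qed

lemma restricted_sum_eq_0:
  assumes "finite J" "card J = N" "word_partition J S" "word_partition J T"
  shows "restricted_sum J S T = 0"
  using assms
\<comment> \<open>Lexicographic: more blocks in total, then more blocks in S. The second component
  is due to the commutator terms, which gain a block in S but lose one in T.\<close>
proof (induction "(2 * N - (card S + card T), N - card S)" arbitrary: J S T
    rule: wf_induct_rule[OF wf_lex_prod[OF wf_less_than wf_less_than]])
  case (1 S T J)
  have above: "vanishes_above (card S) (card S + card T)"
    unfolding vanishes_above_def
  proof (intro allI impI)
    fix J' :: "nat set" and S' T' assume *: "finite J'" "card J' = N" "word_partition J' S'" "word_partition J' T'"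
      "card S + card T < card S' + card T' \<or> card S' + card T' = card S + card T \<and> card S < card S'"
    then have "card S' \<le> N" "card T' \<le> N" using word_partition_card_le by metis+
    then show "restricted_sum J' S' T' = 0" using * by (intro 1(1)) auto
  qed
  have fin: "finite S" "finite T" using 1 by (simp_all add: word_partition_def)
  show ?case
  \<comment> \<open>If each block of T is a single letter that is also a block of S, both partitions
    are the finest ones. Otherwise some block u of T can be used to reduce to earlier
    partitions.\<close>
  proof (cases "T \<subseteq> (\<lambda>z. [z]) ` {z. [z] \<in> S}")
    case True
    have sing: "[z] \<in> S \<and> [z] \<in> T" if "z \<in> J" for z
    proof -
      obtain t where "t \<in> T" "z \<in> set t" using 1(5) \<open>z \<in> J\<close> unfolding word_partition_def by blast
      with True show ?thesis by auto
    qed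
    have "X = (\<lambda>z. [z]) ` J" if "word_partition J X" "\<And>z. z \<in> J \<Longrightarrow> [z] \<in> X" for X
    proof
      show "X \<subseteq> (\<lambda>z. [z]) ` J"
      proof
        fix p assume "p \<in> X"
        then have "p \<noteq> []" "set p \<subseteq> J" using that(1) unfolding word_partition_def by auto
        then obtain z where z: "z \<in> set p" "z \<in> J" by (cases p) auto
        then have "set p \<inter> set [z] \<noteq> {}" by auto
        then have "p = [z]" using that(1) that(2)[OF z(2)] \<open>p \<in> X\<close>
          unfolding word_partition_def by metis
        then show "p \<in> (\<lambda>z. [z]) ` J" using z by blast
      qed
    qed (use that(2) in auto)
    then have "S = (\<lambda>z. [z]) ` J" "T = (\<lambda>z. [z]) ` J" using 1(4,5) sing by blast+
    then show ?thesis using restricted_sum_singletons 1(2,3) by simp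
  next
    case False
    then obtain u where u: "u \<in> T" "\<And>x. u = [x] \<Longrightarrow> [x] \<notin> S" by blast
    define T0 where "T0 = T - {u}"
    have T: "T = insert u T0" "u \<notin> T0" using u(1) by (auto simp: T0_def)
    then have u': "u \<noteq> []" "distinct u" "set u \<subseteq> J" "word_partition (J - set u) T0"
      using 1(5) word_partition_insert[of u T0 J] by auto
    have cT: "card T = card T0 + 1" using T fin by simp
    \<comment> \<open>The longest suffix of u whose letters are singleton blocks of S; what precedes
      it is empty or ends in a letter to which the equation applies.\<close>
    define zs where "zs = rev (takeWhile (\<lambda>z. [z] \<in> S) (rev u))"
    define w0 where "w0 = rev (dropWhile (\<lambda>z. [z] \<in> S) (rev u))"
    have uz: "u = w0 @ zs"
      unfolding w0_def zs_def rev_append[symmetric] takeWhile_dropWhile_id by simp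
    have "[z] \<in> S" if "z \<in> set zs" for z using that unfolding zs_def by (auto dest: set_takeWhileD)
    moreover have "[last w0] \<notin> S" if "w0 \<noteq> []"
      using hd_dropWhile[of "\<lambda>z. [z] \<in> S" "rev u"] that unfolding w0_def by (simp add: last_rev)
    moreover have "vanishes_above (card S) (card S + card T0 + 1)"
      using above unfolding cT by (simp only: add.assoc)
    ultimately have "restricted_sum J S (insert (w0 @ zs) T0) = 0"
      using restricted_sum_trailing_singletons[OF 1(2-4), of T0 w0 zs] u' u(2) unfolding uz[symmetric] by blast
    then show ?thesis unfolding T(1) uz[symmetric] .
  qed
qed

text \<open>The coarsest partitions, with one block each, isolate a single coefficient.\<close>

lemma weights_eq_0:
  assumes "P \<in> permutations_of_set J" "Q \<in> permutations_of_set J" "card J = N"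
  shows "F P Q = 0"
proof -
  have J: "set P = J" "distinct P" "set Q = J" "distinct Q"
    using assms(1,2) unfolding permutations_of_set_iff by blast+
  have fin: "finite J" unfolding J(1)[symmetric] by simp
  have "J \<noteq> {}" using assms(3) N_ge_2 by force
  then have ne: "P \<noteq> []" "Q \<noteq> []" using J(1,3) by force+
  have "word_partition J {P}" "word_partition J {Q}"
    using J ne by (simp_all add: word_partition_def)
  then have H0: "restricted_sum J {P} {Q} = 0" by (intro restricted_sum_eq_0 fin assms(3))
  have agr: "agrees {P} P' \<longleftrightarrow> P' = P" if "P' \<in> permutations_of_set J" "set P = J" for P P'
  proof -
    have "filter (\<lambda>x. x \<in> set P) P' = P'"
      using that by (simp add: permutations_of_set_iff)
    then show ?thesis by (simp add: agrees_def)
  qed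
  moreover have "restricted_sum J {P} {Q} = (\<Sum>P'\<in>permutations_of_set J. \<Sum>Q'\<in>permutations_of_set J.
      F P' Q' * of_bool (P' = P \<and> Q' = Q))"
    unfolding restricted_sum_def
  proof (intro sum.cong refl)
    fix P' Q' assume "P' \<in> permutations_of_set J" "Q' \<in> permutations_of_set J"
    then have "agrees {P} P' \<longleftrightarrow> P' = P" "agrees {Q} Q' \<longleftrightarrow> Q' = Q"
      using agr J by simp_all
    then show "F P' Q' * of_bool (agrees {P} P' \<and> agrees {Q} Q') = F P' Q' * of_bool (P' = P \<and> Q' = Q)"
      by (simp del: agrees_insert)
  qed
  moreover have "(\<Sum>P'\<in>permutations_of_set J. \<Sum>Q'\<in>permutations_of_set J.
      F P' Q' * of_bool (P' = P \<and> Q' = Q)) =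
    (\<Sum>P'\<in>permutations_of_set J. if P' = P then
      (\<Sum>Q'\<in>permutations_of_set J. if Q' = Q then F P' Q' else 0) else 0)"
    by (intro sum.cong refl) (simp add: of_bool_def if_distrib[of "\<lambda>x. _ * x"] cong: if_cong)
  moreover have "\<dots> = F P Q" using assms(1,2) by simp
  ultimately show ?thesis using H0 by metis
qed

end

section \<open>Evaluating normally ordered expressions\<close>

definition lin_val :: "(expr \<Rightarrow> 'k::field_char_0) \<Rightarrow> 'k comb \<Rightarrow> 'k" where
  "lin_val G x = (\<Sum>e\<in>Poly_Mapping.keys x. Poly_Mapping.lookup x e * G e)"

lemma lin_val_superset:
  assumes "finite S" "Poly_Mapping.keys x \<subseteq> S"
  shows "lin_val G x = (\<Sum>e\<in>S. Poly_Mapping.lookup x e * G e)"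
  unfolding lin_val_def using assms
  by (intro sum.mono_neutral_left) (auto simp: in_keys_iff)

lemma lin_val_add: "lin_val G (x + y) = lin_val G x + lin_val G y"
proof -
  let ?S = "Poly_Mapping.keys x \<union> Poly_Mapping.keys y"
  have "Poly_Mapping.keys (x + y) \<subseteq> ?S" by (rule Poly_Mapping.keys_add)
  then show ?thesis
    by (simp add: lin_val_superset[where S = ?S] lookup_add distrib_right sum.distrib)
qed

lemma lin_val_cscale: "lin_val G (cscale c x) = c * lin_val G x"
proof -
  have "Poly_Mapping.keys (cscale c x) \<subseteq> Poly_Mapping.keys x" by (auto simp: in_keys_iff)
  then show ?thesis
    by (simp add: lin_val_superset[where S = "Poly_Mapping.keys x"] sum_distrib_left mult.assoc)
qed

lemma lin_val_single [simp]: "lin_val G (single_expr e) = G e"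
  by (simp add: lin_val_def)

lemma lin_val_zero [simp]: "lin_val G 0 = 0"
  by (simp add: lin_val_def)

lemma lin_val_diff: "lin_val G (x - y) = lin_val G x - lin_val G y"
proof -
  have *: "x - y = x + cscale (- 1) y" by simp
  show ?thesis unfolding * lin_val_add lin_val_cscale by simp
qed

lemma lin_val_sum: "lin_val G (sum f I) = (\<Sum>i\<in>I. lin_val G (f i))"
  by (induction I rule: infinite_finite_induct) (auto simp: lin_val_add)

lemma lookup_eq_lin_val: "Poly_Mapping.lookup x e = lin_val (\<lambda>f. of_bool (f = e)) x"
  unfolding lin_val_superset[of "insert e (Poly_Mapping.keys x)" x, OF finite.insertI[OF finite_keys] subset_insertI]
  by (simp add: of_bool_def if_distrib[of "\<lambda>c. _ * c"] cong: if_cong)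

text \<open>The value of a linear functional on the normal form. If G is the indicator of a target
  or vanishes on an ideal, a branch of the rewriting can be discarded as soon as an invariant shows
  that it misses the target.\<close>

definition normal_val :: "(expr \<Rightarrow> 'k::field_char_0) \<Rightarrow> expr \<Rightarrow> 'k" where
  "normal_val G e = lin_val G (normal_order e)"

lemma subst_eq_sub: "subst x s = map (sub x s)"
  by (simp add: subst_def sub_def[abs_def])

lemma normal_val_step:
  assumes "admissible e" "split_expr e = Some (us, p, i, j, q, vs)"
  shows "normal_val G e = normal_val G (us @ (p @ [A j, B i] @ q) # vs)
    - (normal_val G (subst (A i) [A i, A j] (us @ (p @ [B i] @ q) # vs))
       - normal_val G (subst (A i) [A j, A i] (us @ (p @ [B i] @ q) # vs)))
    - (normal_val G (subst (B j) [B i, B j] (us @ (p @ [A j] @ q) # vs))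
       - normal_val G (subst (B j) [B j, B i] (us @ (p @ [A j] @ q) # vs)))"
  unfolding normal_val_def using assms
  by (subst normal_order.simps) (simp add: lin_val_diff)

lemma normal_val_normal: "admissible e \<Longrightarrow> split_expr e = None \<Longrightarrow> normal_val G e = G e"
  unfolding normal_val_def by (subst normal_order.simps) simp

lemma normal_val_not_admissible: "\<not> admissible e \<Longrightarrow> normal_val G e = 0"
  unfolding normal_val_def by (subst normal_order.simps) simp

section \<open>Invariants of the rewriting\<close>

definition reductions :: "expr \<Rightarrow> letter list \<Rightarrow> nat \<Rightarrow> nat \<Rightarrow> letter list \<Rightarrow> expr \<Rightarrow> expr set" where
  "reductions us p i j q vs = {us @ (p @ [A j, B i] @ q) # vs,
     subst (A i) [A i, A j] (us @ (p @ [B i] @ q) # vs),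
     subst (A i) [A j, A i] (us @ (p @ [B i] @ q) # vs),
     subst (B j) [B i, B j] (us @ (p @ [A j] @ q) # vs),
     subst (B j) [B j, B i] (us @ (p @ [A j] @ q) # vs)}"

lemma admissible_reductions:
  assumes "admissible e" "split_expr e = Some (us, p, i, j, q, vs)" "e' \<in> reductions us p i j q vs"
  shows "admissible e'"
proof -
  obtain I where "multilinear I e" "acyclic (ba e)" using assms(1) by (auto simp: admissible_def)
  from admissible_step[OF this assms(2)] assms(3) show ?thesis
    unfolding reductions_def admissible_def by blast
qed

lemma normal_val_induct [consumes 1, case_names step]:
  assumes "Inv e"
    and "\<And>e. Inv e \<Longrightarrow> admissible e \<Longrightarrow> split_expr e = None \<Longrightarrow> G e = 0"
    and "\<And>us p i j q vs e'. Inv (us @ (p @ [B i, A j] @ q) # vs) \<Longrightarrow>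
      e' \<in> reductions us p i j q vs \<Longrightarrow> Inv e'"
  shows "normal_val G e = 0"
  using assms(1)
proof (induction e rule: normal_order.induct)
  case (1 e)
  show ?case
  proof (cases "admissible e")
    case adm: True
    show ?thesis
    proof (cases "split_expr e")
      case None
      then show ?thesis using adm assms(2) 1(6) by (simp add: normal_val_normal)
    next
      case (Some a)
      obtain us p i j q vs where a: "a = (us, p, i, j, q, vs)" by (cases a)
      note s = Some[unfolded a]
      note IH = 1(1-5)[OF adm s refl refl refl refl refl]
      have "Inv e'" if "e' \<in> reductions us p i j q vs" for e'
        using assms(3) 1(6) that unfolding split_expr_SomeD[OF s] by blast
      then show ?thesis
        unfolding normal_val_step[OF adm s] by (simp add: IH reductions_def del: append.simps)
    qed
  qed (simp add: normal_val_not_admissible)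
qed

text \<open>A property of one tensor factor that survives all rules. The first part concerns a pair
  standing in this factor, the second the substitution of a letter, which reaches every factor
  regardless of where the pair stands.\<close>

definition stable_word :: "(letter list \<Rightarrow> bool) \<Rightarrow> bool" where
  "stable_word W \<longleftrightarrow>
     (\<forall>p i j q. W (p @ [B i, A j] @ q) \<longrightarrow>
       W (p @ [A j, B i] @ q) \<and> W (p @ [B i] @ q) \<and> W (p @ [A j] @ q)) \<and>
     (\<forall>w i j. W w \<longrightarrow> W (sub (A i) [A i, A j] w) \<and> W (sub (A i) [A j, A i] w) \<and>
       W (sub (B i) [B i, B j] w) \<and> W (sub (B i) [B j, B i] w))"

lemma normal_val_stable:
  assumes W: "stable_word W" and e: "k < length e" "W (e ! k)"
    and G: "\<And>e. k < length e \<Longrightarrow> W (e ! k) \<Longrightarrow> G e = 0"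
  shows "normal_val G e = 0"
proof -
  have "k < length e \<and> W (e ! k)" using e by simp
  then show ?thesis
  proof (rule normal_val_induct)
    fix us p i j q vs e'
    assume "k < length (us @ (p @ [B i, A j] @ q) # vs) \<and> W ((us @ (p @ [B i, A j] @ q) # vs) ! k)"
      and e': "e' \<in> reductions us p i j q vs"
    then have k: "k < Suc (length us + length vs)"
      and w: "W ((us @ (p @ [B i, A j] @ q) # vs) ! k)" by auto
    have sub: "W ((us @ v # vs) ! k)"
      if "v \<in> {p @ [A j, B i] @ q, p @ [B i] @ q, p @ [A j] @ q}" for v
      using w that W unfolding stable_word_def nth_append
      by (cases "k < length us"; cases "k = length us") auto
    have len: "k < length (us @ v # vs)" for v using k by simp
    have subW: "W (sub (A i) [A i, A j] w)" "W (sub (A i) [A j, A i] w)"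
       "W (sub (B j) [B i, B j] w)" "W (sub (B j) [B j, B i] w)" if "W w" for w
      using W that unfolding stable_word_def by blast+
    have S: "k < length (map (sub x s) (us @ v # vs)) \<and> W (map (sub x s) (us @ v # vs) ! k)"
      if "W (sub x s ((us @ v # vs) ! k))" for x s v
      using that len[of v] by (simp only: length_map nth_map)
    show "k < length e' \<and> W (e' ! k)"
      using e' unfolding reductions_def subst_eq_sub
    proof (elim insertE emptyE)
      assume "e' = us @ (p @ [A j, B i] @ q) # vs"
      then show ?thesis using len sub by blast
    next
      assume e': "e' = map (sub (A i) [A i, A j]) (us @ (p @ [B i] @ q) # vs)"
      show ?thesis unfolding e' by (rule S, rule subW, rule sub) simp
    next
      assume e': "e' = map (sub (A i) [A j, A i]) (us @ (p @ [B i] @ q) # vs)"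
      show ?thesis unfolding e' by (rule S, rule subW, rule sub) simp
    next
      assume e': "e' = map (sub (B j) [B i, B j]) (us @ (p @ [A j] @ q) # vs)"
      show ?thesis unfolding e' by (rule S, rule subW, rule sub) simp
    next
      assume e': "e' = map (sub (B j) [B j, B i]) (us @ (p @ [A j] @ q) # vs)"
      show ?thesis unfolding e' by (rule S, rule subW, rule sub) simp
    qed
  qed (use G in auto)
qed

text \<open>A normally ordered word contains a \<open>b\<close> exactly when it ends in one. Only
  the latter is preserved by the rewriting: rule (iii) may remove a \<open>b\<close> from a factor,
  but the last letter of a word never is the \<open>b\<close> of a pair, and a commutator of
  \<open>b\<close>'s substituted for it again ends in a \<open>b\<close>.\<close>

lemma stable_ends_B: "stable_word (\<lambda>w. \<exists>u i. w = u @ [B i])"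
  unfolding stable_word_def
proof (intro conjI allI impI)
  fix p q :: "letter list" and i j
  assume "\<exists>u k. p @ [B i, A j] @ q = u @ [B k]"
  then have "\<exists>u k. q = u @ [B k]" by (cases q rule: rev_cases) auto
  then obtain u k where "q = u @ [B k]" by blast
  then show "\<exists>u k. p @ [A j, B i] @ q = u @ [B k]" "\<exists>u k. p @ [B i] @ q = u @ [B k]"
      "\<exists>u k. p @ [A j] @ q = u @ [B k]" by auto
qed (auto split: if_splits)

lemma stable_starts_A: "stable_word (\<lambda>w. \<exists>u i. w = A i # u)"
  unfolding stable_word_def
proof (intro conjI allI impI)
  fix p q :: "letter list" and i j
  assume "\<exists>u k. p @ [B i, A j] @ q = A k # u"
  then obtain k p' where "p = A k # p'" by (cases p) auto
  then show "\<exists>u k. p @ [A j, B i] @ q = A k # u" "\<exists>u k. p @ [B i] @ q = A k # u"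
      "\<exists>u k. p @ [A j] @ q = A k # u" by auto
qed (auto split: if_splits)

lemma set_sub: "set (sub x s w) = (if x \<in> set w then set w - {x} \<union> set s else set w)"
  by (induction w) auto

lemma stable_no_A: "stable_word (\<lambda>w. \<forall>i. A i \<notin> set w)"
  unfolding stable_word_def by (auto simp: set_sub split: if_splits)

lemma stable_no_B: "stable_word (\<lambda>w. \<forall>i. B i \<notin> set w)"
  unfolding stable_word_def by (auto simp: set_sub split: if_splits)

lemma length_sub: "length s \<ge> 1 \<Longrightarrow> length w \<le> length (sub x s w)"
  by (induction w) auto

text \<open>Without a \<open>b\<close> there is no pair in the word, so it can only grow.\<close>

lemma stable_long_no_B: "stable_word (\<lambda>w. 2 \<le> length w \<and> (\<forall>i. B i \<notin> set w))"
proof -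
  have "2 \<le> length (sub x [y, z] w)" if "2 \<le> length w" for x y z :: letter and w
    using that length_sub[of "[y, z]" w x] by simp
  then show ?thesis using stable_no_B unfolding stable_word_def by auto
qed

section \<open>Normal forms of particular products\<close>

lemma split_word_normal: "split_word (map A p @ map B q) = None"
proof (induction p)
  case Nil
  show ?case
  proof (induction q)
    case (Cons x q)
    then show ?case by (cases q) auto
  qed simp
qed simp

lemma split_word_normal_BA:
  "split_word (map A p @ map B q @ B i # A j # w) = Some (map A p @ map B q, i, j, w)"
proof (induction p)
  case Nil
  show ?case
  proof (induction q)
    case (Cons x q)
    then show ?case by (cases q) auto
  qed simp
qed simp

lemma acyclic_Times: "X \<inter> Y = {} \<Longrightarrow> acyclic (X \<times> Y)"
proof -
  assume "X \<inter> Y = {}"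
  moreover have "(X \<times> Y)\<^sup>+ \<subseteq> X \<times> Y" by (rule trancl_Int_subset) auto
  ultimately show ?thesis unfolding acyclic_def by blast
qed

lemma admissibleI:
  "multilinear I e \<Longrightarrow> ba e \<subseteq> X \<times> Y \<Longrightarrow> X \<inter> Y = {} \<Longrightarrow> admissible e"
  unfolding admissible_def using acyclic_subset acyclic_Times by metis

lemma ba_word_map [simp]: "ba_word (map A p) = {}" "ba_word (map B q) = {}"
  by (induction p, auto) (induction q, auto)

lemma sub_map_A [simp]: "sub (A i) [A x, A y] (map A P) = map A (sub i [x, y] P)"
  by (induction P) auto

lemma sub_map_B [simp]: "sub (B i) [B x, B y] (map B P) = map B (sub i [x, y] P)"
  by (induction P) auto

lemma sub_A_map_B [simp]: "sub (A i) s (map B P) = map B P"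
  by (induction P) auto

lemma sub_B_map_A [simp]: "sub (B i) s (map A P) = map A P"
  by (induction P) auto

lemma multilinearI:
  assumes "distinct (concat e)" "set (concat e) = A ` I \<union> B ` I"
  shows "multilinear I e"
  using assms by (simp add: multilinear_def)

lemma inj_letter [simp]: "inj_on A X" "inj_on B X"
  by (auto simp: inj_on_def)

lemma letter_image [simp]: "A x \<in> A ` X \<longleftrightarrow> x \<in> X" "B x \<in> B ` X \<longleftrightarrow> x \<in> X"
    "A ` X \<inter> B ` Y = {}" "B ` Y \<inter> A ` X = {}" "A x \<notin> B ` X" "B x \<notin> A ` X"
  by auto

lemma normal_val_reductions_normal:
  assumes "admissible e" "split_expr e = Some (us, p, i, j, q, vs)" "e' \<in> reductions us p i j q vs"
    and "split_expr e' = None"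
  shows "normal_val G e' = G e'"
  using admissible_reductions[OF assms(1-3)] assms(4) by (rule normal_val_normal)

lemma takeWhile_snoc: "\<not> R x \<Longrightarrow> takeWhile R (xs @ [x]) = takeWhile R xs"
  by (induction xs) auto

text \<open>The induction follows \<open>a_j\<close> to the left: Q is still to be passed, R has
  been passed, and \<alpha> and \<beta> have been absorbed on the two sides of \<open>b_j\<close>.
  The last letter i of Q is passed by rule (i), absorbed by rule (iii) with sign -1 on the left of
  \<open>b_j\<close> and +1 on the right, or it stops \<open>a_j\<close> in a commutator by rule
  (ii). Absorption runs through Q from the right; it extends \<alpha> at its right end and \<beta>
  at its left end, hence \<alpha>' occurs reversed in Q and \<beta>' does not. Rule (ii) counts only
  when all absorptions are done, that is, for letters of Q standing before all letters of \<alpha>'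
  and \<beta>'.\<close>

lemma normal_val_insertion:
  assumes G: "\<And>P' Q' \<omega>'. G [map A P' @ map B Q', map B \<omega>', []] = (if \<omega>' = \<omega> then g P' Q' else 0)"
    and "distinct \<omega>"
    and "distinct P" "distinct (Q @ R @ \<alpha> @ \<beta>)" "set P = set (Q @ R @ \<alpha> @ \<beta>)" "j \<notin> set P"
  defines "c \<equiv> \<lambda>P Q R \<alpha> \<beta>. normal_val G [map A P @ map B Q @ A j # map B R, map B (\<alpha> @ j # \<beta>), []]"
  shows "\<omega> = \<alpha> @ \<alpha>' @ j # \<beta>' @ \<beta> \<Longrightarrow>
      c P Q R \<alpha> \<beta> = insertion_value (\<lambda>P Q. g P (Q @ R)) \<alpha>' \<beta>' j P Q"
    and "(\<nexists>\<alpha>' \<beta>'. \<omega> = \<alpha> @ \<alpha>' @ j # \<beta>' @ \<beta>) \<Longrightarrow> c P Q R \<alpha> \<beta> = 0"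
proof -
  have "(\<forall>\<alpha>' \<beta>'. \<omega> = \<alpha> @ \<alpha>' @ j # \<beta>' @ \<beta> \<longrightarrow>
      c P Q R \<alpha> \<beta> = insertion_value (\<lambda>P Q. g P (Q @ R)) \<alpha>' \<beta>' j P Q) \<and>
    ((\<nexists>\<alpha>' \<beta>'. \<omega> = \<alpha> @ \<alpha>' @ j # \<beta>' @ \<beta>) \<longrightarrow> c P Q R \<alpha> \<beta> = 0)"
    using assms(3-6)
  proof (induction Q arbitrary: R \<alpha> \<beta> rule: rev_induct)
    case Nil
    let ?e = "[map A P @ map B [] @ A j # map B R, map B (\<alpha> @ j # \<beta>), []]"
    have e: "?e = [map A (P @ [j]) @ map B R, map B (\<alpha> @ j # \<beta>), []]" by simp
    have "multilinear (insert j (set P)) ?e"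
      using Nil by (intro multilinearI) (auto simp: distinct_map image_Un)
    then have "admissible ?e"
      by (rule admissibleI[where X = "{}" and Y = "{}"])
         (simp_all only: e ba_Cons, simp_all add: ba_word_append ba_def)
    moreover have "split_expr ?e = None"
      using split_word_normal[of "P @ [j]" R] split_word_normal[of "[]" "\<alpha> @ j # \<beta>"] by simp
    ultimately have "c P [] R \<alpha> \<beta> = G ?e" unfolding c_def by (rule normal_val_normal)
    also have "\<dots> = (if \<alpha> @ j # \<beta> = \<omega> then g (P @ [j]) R else 0)" unfolding e by (rule G)
    finally have c: "c P [] R \<alpha> \<beta> = (if \<alpha> @ j # \<beta> = \<omega> then g (P @ [j]) R else 0)" .
    show ?case
    proof (intro conjI allI impI)
      fix \<alpha>' \<beta>' assume \<omega>: "\<omega> = \<alpha> @ \<alpha>' @ j # \<beta>' @ \<beta>"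
      have "\<alpha> @ j # \<beta> = \<omega> \<longleftrightarrow> \<alpha>' = [] \<and> \<beta>' = []"
        using arg_cong[of "\<alpha> @ j # \<beta>" \<omega> length] \<omega> by auto
      then show "c P [] R \<alpha> \<beta> = insertion_value (\<lambda>P Q. g P (Q @ R)) \<alpha>' \<beta>' j P []"
        unfolding c by (auto simp: insertion_value_def)
    next
      assume "\<nexists>\<alpha>' \<beta>'. \<omega> = \<alpha> @ \<alpha>' @ j # \<beta>' @ \<beta>"
      then have "\<alpha> @ j # \<beta> \<noteq> \<omega>" by (metis append_Nil)
      then show "c P [] R \<alpha> \<beta> = 0" unfolding c by simp
    qed
  next
    case (snoc i Q)
    let ?e = "[map A P @ map B (Q @ [i]) @ A j # map B R, map B (\<alpha> @ j # \<beta>), []]"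
    have i: "i \<notin> set Q" "i \<noteq> j" "i \<notin> set \<alpha>" "i \<notin> set \<beta>" and j: "j \<notin> set \<alpha>" "j \<notin> set \<beta>" "j \<notin> set Q" "j \<notin> set R"
      using snoc.prems by auto
    have "multilinear (insert j (set P)) ?e"
      using snoc.prems by (intro multilinearI) (auto simp: distinct_map image_Un)
    moreover have "ba ?e \<subseteq> insert i (set Q) \<times> {j}"
      by (auto simp: ba_def ba_word_append)
    ultimately have adm: "admissible ?e" by (rule admissibleI) (use i j in auto)
    have s: "split_expr ?e = Some ([], map A P @ map B Q, i, j, map B R, [map B (\<alpha> @ j # \<beta>), []])"
      using split_word_normal_BA[of P Q i j "map B R"] by simp
    have e1: "[] @ ((map A P @ map B Q) @ [A j, B i] @ map B R) # [map B (\<alpha> @ j # \<beta>), []] =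
        [map A P @ map B Q @ A j # map B (i # R), map B (\<alpha> @ j # \<beta>), []]"
      by simp
    have e2: "subst (A i) [A x, A y] ([] @ ((map A P @ map B Q) @ [B i] @ map B R) # [map B (\<alpha> @ j # \<beta>), []]) =
        [map A (sub i [x, y] P) @ map B (Q @ i # R), map B (\<alpha> @ j # \<beta>), []]" for x y
      by (simp add: subst_eq_sub)
    have e3: "subst (B j) [B x, B y] ([] @ ((map A P @ map B Q) @ [A j] @ map B R) # [map B (\<alpha> @ j # \<beta>), []]) =
        [map A P @ map B Q @ A j # map B R, map B (\<alpha> @ [x, y] @ \<beta>), []]" for x y
      using j by (simp add: subst_eq_sub sub_notin)
    \<comment> \<open>After rule (ii) \<open>a_j\<close> sits inside \<open>a_P\<close>; nothing is
      left to reorder, and G can be applied directly.\<close>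
    have n2: "normal_val G [map A (sub i s P) @ map B (Q @ i # R), map B (\<alpha> @ j # \<beta>), []] =
        (if \<omega> = \<alpha> @ j # \<beta> then g (sub i s P) (Q @ i # R) else 0)" if "s = [i, j] \<or> s = [j, i]" for s
    proof -
      have "[map A (sub i s P) @ map B (Q @ i # R), map B (\<alpha> @ j # \<beta>), []] \<in>
          reductions [] (map A P @ map B Q) i j (map B R) [map B (\<alpha> @ j # \<beta>), []]"
        using that e2[of i j] e2[of j i] unfolding reductions_def by auto
      moreover have "split_expr [map A (sub i s P) @ map B (Q @ i # R), map B (\<alpha> @ j # \<beta>), []] = None"
        using split_word_normal[of "sub i s P" "Q @ i # R"] split_word_normal[of "[]" "\<alpha> @ j # \<beta>"]
        by simp
      ultimately show ?thesis
        using normal_val_reductions_normal[OF adm s, where G = G] G by metis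
    qed
    have step: "c P (Q @ [i]) R \<alpha> \<beta> = c P Q (i # R) \<alpha> \<beta>
        - (if \<omega> = \<alpha> @ j # \<beta> then g (sub i [i, j] P) (Q @ i # R) - g (sub i [j, i] P) (Q @ i # R) else 0)
        - (c P Q R (\<alpha> @ [i]) \<beta> - c P Q R \<alpha> (i # \<beta>))"
      unfolding c_def normal_val_step[OF adm s] e1 e2 e3 by (simp add: n2 del: map_append)
    have IH1: "\<And>\<alpha>' \<beta>'. \<omega> = \<alpha> @ \<alpha>' @ j # \<beta>' @ \<beta> \<Longrightarrow>
          c P Q (i # R) \<alpha> \<beta> = insertion_value (\<lambda>P Q. g P (Q @ i # R)) \<alpha>' \<beta>' j P Q"
        "(\<nexists>\<alpha>' \<beta>'. \<omega> = \<alpha> @ \<alpha>' @ j # \<beta>' @ \<beta>) \<Longrightarrow> c P Q (i # R) \<alpha> \<beta> = 0"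
      using snoc.IH[of "i # R" \<alpha> \<beta>] snoc.prems by auto
    have IH2: "\<And>\<alpha>' \<beta>'. \<omega> = (\<alpha> @ [i]) @ \<alpha>' @ j # \<beta>' @ \<beta> \<Longrightarrow>
          c P Q R (\<alpha> @ [i]) \<beta> = insertion_value (\<lambda>P Q. g P (Q @ R)) \<alpha>' \<beta>' j P Q"
        "(\<nexists>\<alpha>' \<beta>'. \<omega> = (\<alpha> @ [i]) @ \<alpha>' @ j # \<beta>' @ \<beta>) \<Longrightarrow> c P Q R (\<alpha> @ [i]) \<beta> = 0"
      using snoc.IH[of R "\<alpha> @ [i]" \<beta>] snoc.prems by auto
    have IH3: "\<And>\<alpha>' \<beta>'. \<omega> = \<alpha> @ \<alpha>' @ j # \<beta>' @ i # \<beta> \<Longrightarrow>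
          c P Q R \<alpha> (i # \<beta>) = insertion_value (\<lambda>P Q. g P (Q @ R)) \<alpha>' \<beta>' j P Q"
        "(\<nexists>\<alpha>' \<beta>'. \<omega> = \<alpha> @ \<alpha>' @ j # \<beta>' @ i # \<beta>) \<Longrightarrow> c P Q R \<alpha> (i # \<beta>) = 0"
      using snoc.IH[of R \<alpha> "i # \<beta>"] snoc.prems by auto
    show ?case
    proof (intro conjI allI impI)
      assume no: "\<nexists>\<alpha>' \<beta>'. \<omega> = \<alpha> @ \<alpha>' @ j # \<beta>' @ \<beta>"
      have "\<nexists>\<alpha>' \<beta>'. \<omega> = (\<alpha> @ [i]) @ \<alpha>' @ j # \<beta>' @ \<beta>"
        using no by (metis append_assoc)
      note z2 = IH2(2)[OF this]
      have "\<nexists>\<alpha>' \<beta>'. \<omega> = \<alpha> @ \<alpha>' @ j # \<beta>' @ i # \<beta>"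
        using no by (metis append_Cons append_Nil append_assoc)
      note z3 = IH3(2)[OF this]
      have "\<omega> \<noteq> \<alpha> @ j # \<beta>" using no by (metis append_Nil)
      then show "c P (Q @ [i]) R \<alpha> \<beta> = 0"
        unfolding step IH1(2)[OF no] z2 z3 by simp
    next
      fix \<alpha>' \<beta>' assume \<omega>: "\<omega> = \<alpha> @ \<alpha>' @ j # \<beta>' @ \<beta>"
      have d: "distinct (\<alpha> @ \<alpha>' @ j # \<beta>' @ \<beta>)" using assms(2) unfolding \<omega> .
      have uniq: "a = \<alpha> @ \<alpha>' \<and> b = \<beta>' @ \<beta>" if "\<omega> = a @ j # b" for a b
      proof -
        have eq: "a @ j # b = (\<alpha> @ \<alpha>') @ j # \<beta>' @ \<beta>" using that \<omega> by simp
        have "j \<notin> set a" "j \<notin> set b" using assms(2) that by auto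
        then show ?thesis using append_Cons_eq_iff[of j a b "\<alpha> @ \<alpha>'" "\<beta>' @ \<beta>"] eq by blast
      qed
      have T2: "\<omega> = \<alpha> @ j # \<beta> \<longleftrightarrow> \<alpha>' = [] \<and> \<beta>' = []"
        using uniq[of \<alpha> \<beta>] \<omega> by auto
      have T3: "c P Q R (\<alpha> @ [i]) \<beta> =
          (if \<alpha>' \<noteq> [] \<and> hd \<alpha>' = i then insertion_value (\<lambda>P Q. g P (Q @ R)) (tl \<alpha>') \<beta>' j P Q else 0)"
      proof (cases "\<alpha>' \<noteq> [] \<and> hd \<alpha>' = i")
        case True
        then have "\<omega> = (\<alpha> @ [i]) @ tl \<alpha>' @ j # \<beta>' @ \<beta>" using \<omega> by (cases \<alpha>') auto
        from IH2(1)[OF this] True show ?thesis by simp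
      next
        case False
        have "\<nexists>a b. \<omega> = (\<alpha> @ [i]) @ a @ j # b @ \<beta>"
        proof
          assume "\<exists>a b. \<omega> = (\<alpha> @ [i]) @ a @ j # b @ \<beta>"
          then obtain a b where "\<omega> = (\<alpha> @ i # a) @ j # b @ \<beta>" by auto
          from uniq[OF this] have "\<alpha>' = i # a" by simp
          then show False using False by simp
        qed
        from IH2(2)[OF this] False show ?thesis by auto
      qed
      have T4: "c P Q R \<alpha> (i # \<beta>) =
          (if \<beta>' \<noteq> [] \<and> last \<beta>' = i then insertion_value (\<lambda>P Q. g P (Q @ R)) \<alpha>' (butlast \<beta>') j P Q else 0)"
      proof (cases "\<beta>' \<noteq> [] \<and> last \<beta>' = i")
        case True
        then have "\<beta>' = butlast \<beta>' @ [i]" using append_butlast_last_id[of \<beta>'] by simp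
        then have "\<omega> = \<alpha> @ \<alpha>' @ j # butlast \<beta>' @ i # \<beta>" unfolding \<omega>
          by (metis append_Cons append_Nil append_assoc)
        from IH3(1)[OF this] True show ?thesis by simp
      next
        case False
        have "\<nexists>a b. \<omega> = \<alpha> @ a @ j # b @ i # \<beta>"
        proof
          assume "\<exists>a b. \<omega> = \<alpha> @ a @ j # b @ i # \<beta>"
          then obtain a b where "\<omega> = (\<alpha> @ a) @ j # b @ i # \<beta>" by auto
          from uniq[OF this] have "\<beta>' @ \<beta> = (b @ [i]) @ \<beta>" by simp
          then have "\<beta>' = b @ [i]" by (simp only: append_same_eq)
          then show False using False by simp
        qed
        from IH3(2)[OF this] False show ?thesis by auto
      qed
      note c = step[unfolded T2 T3 T4 IH1(1)[OF \<omega>]]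
      let ?K = "set \<alpha>' \<union> set \<beta>'"
      have notQ: "filter (\<lambda>x. x \<in> X) Q = filter (\<lambda>x. x \<in> Y) Q" "filter (\<lambda>x. x \<notin> X) Q = filter (\<lambda>x. x \<notin> Y) Q"
          "takeWhile (\<lambda>x. x \<notin> X) Q = takeWhile (\<lambda>x. x \<notin> Y) Q" if "X - {i} = Y - {i}" for X Y
      proof -
        have *: "x \<in> X \<longleftrightarrow> x \<in> Y" if "x \<in> set Q" for x
          using \<open>X - {i} = Y - {i}\<close> that i(1) by blast
        then show "filter (\<lambda>x. x \<in> X) Q = filter (\<lambda>x. x \<in> Y) Q" "filter (\<lambda>x. x \<notin> X) Q = filter (\<lambda>x. x \<notin> Y) Q"
          by (auto intro!: filter_cong)
        show "takeWhile (\<lambda>x. x \<notin> X) Q = takeWhile (\<lambda>x. x \<notin> Y) Q"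
          using * by (intro takeWhile_cong) auto
      qed
      have tw: "takeWhile (\<lambda>x. x \<notin> ?K) (Q @ [i]) = takeWhile (\<lambda>x. x \<notin> ?K) Q" if "i \<in> ?K"
        by (rule takeWhile_snoc) (use that in simp)
      have fQ: "filter (\<lambda>x. x \<in> X) Q \<noteq> v" if "i \<in> set v" for X v
        using i(1) that by auto
      consider (1) "i \<in> set \<alpha>'" | (2) "i \<notin> set \<alpha>'" "i \<in> set \<beta>'" | (3) "i \<notin> ?K" by blast
      then show "c P (Q @ [i]) R \<alpha> \<beta> = insertion_value (\<lambda>P Q. g P (Q @ R)) \<alpha>' \<beta>' j P (Q @ [i])"
      proof cases
        case 1
        then obtain x a where a: "\<alpha>' = x # a" by (cases \<alpha>') auto
        have i\<beta>: "i \<notin> set \<beta>'" using d 1 by auto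
        have z: "insertion_value (\<lambda>P Q. g P (Q @ i # R)) \<alpha>' \<beta>' j P Q = 0"
          using fQ[of "rev \<alpha>'"] 1 unfolding insertion_value_def Let_def by simp
        have "\<not> (\<beta>' \<noteq> [] \<and> last \<beta>' = i)" using i\<beta> last_in_set by metis
        then have c1: "c P (Q @ [i]) R \<alpha> \<beta> =
            - (if x = i then insertion_value (\<lambda>P Q. g P (Q @ R)) a \<beta>' j P Q else 0)"
          unfolding c z unfolding a by auto
        show ?thesis
        proof (cases "x = i")
          case True
          have "set \<alpha>' - {i} = set a - {i}" "?K - {i} = (set a \<union> set \<beta>') - {i}" using a True by auto
          note nq = notQ(1)[OF this(1)] notQ(2,3)[OF this(2)]
          show ?thesis
            unfolding c1 insertion_value_def Let_def filter_append tw[OF UnI1[OF 1]] nq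
            using True 1 i\<beta> by (simp add: a)
        next
          case False
          have "rev \<alpha>' \<noteq> filter (\<lambda>x. x \<in> set \<alpha>') Q @ [i]" using False a by simp
          then show ?thesis unfolding c1 insertion_value_def Let_def filter_append
            using False 1 by auto
        qed
      next
        case 2
        have "\<beta>' \<noteq> []" using 2 by auto
        then obtain x b where b: "\<beta>' = b @ [x]" by (metis rev_exhaust)
        have z: "insertion_value (\<lambda>P Q. g P (Q @ i # R)) \<alpha>' \<beta>' j P Q = 0"
          using fQ[of \<beta>'] 2 unfolding insertion_value_def Let_def by simp
        have "\<not> (\<alpha>' \<noteq> [] \<and> hd \<alpha>' = i)" using 2(1) hd_in_set by metis
        then have c1: "c P (Q @ [i]) R \<alpha> \<beta> =
            (if x = i then insertion_value (\<lambda>P Q. g P (Q @ R)) \<alpha>' b j P Q else 0)"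
          unfolding c z unfolding b by auto
        show ?thesis
        proof (cases "x = i")
          case True
          have "set \<beta>' - {i} = set b - {i}" "?K - {i} = (set \<alpha>' \<union> set b) - {i}" using b True by auto
          note nq = notQ(1)[OF this(1)] notQ(2,3)[OF this(2)]
          show ?thesis
            unfolding c1 insertion_value_def Let_def filter_append tw[OF UnI2[OF 2(2)]] nq
            using True 2 by (simp add: b)
        next
          case False
          have "\<beta>' \<noteq> filter (\<lambda>x. x \<in> set \<beta>') Q @ [i]" using False b by simp
          then show ?thesis unfolding c1 insertion_value_def Let_def filter_append
            using False 2 by auto
        qed
      next
        case 3
        have "\<not> (\<alpha>' \<noteq> [] \<and> hd \<alpha>' = i)" "\<not> (\<beta>' \<noteq> [] \<and> last \<beta>' = i)"
          using 3 hd_in_set last_in_set by (metis UnI1, metis UnI2)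
        then have c1: "c P (Q @ [i]) R \<alpha> \<beta> = insertion_value (\<lambda>P Q. g P (Q @ i # R)) \<alpha>' \<beta>' j P Q -
            (if \<alpha>' = [] \<and> \<beta>' = [] then g (sub i [i, j] P) (Q @ i # R) - g (sub i [j, i] P) (Q @ i # R) else 0)"
          unfolding c by auto
        show ?thesis
        proof (cases "\<alpha>' = [] \<and> \<beta>' = []")
          case True
          have tt: "takeWhile (\<lambda>x. True) xs = xs" for xs :: "nat list" by (simp add: takeWhile_eq_all_conv)
          show ?thesis unfolding c1 using True i(1)
            by (simp add: insertion_value_def tt algebra_simps)
        next
          case False
          \<comment> \<open>Some letter of \<open>?K\<close> exists and occurs in Q, so the prefix
            ends before it reaches i.\<close>
          have tw3: "takeWhile (\<lambda>x. x \<notin> ?K) (Q @ [i]) = takeWhile (\<lambda>x. x \<notin> ?K) Q"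
            if "filter (\<lambda>x. x \<in> set \<alpha>') Q = rev \<alpha>'" "filter (\<lambda>x. x \<in> set \<beta>') Q = \<beta>'"
          proof -
            obtain k where "k \<in> ?K" using False by (cases \<alpha>'; cases \<beta>') auto
            moreover from this have "k \<in> set Q"
              using that by (metis UnE filter_is_subset set_rev subsetD)
            ultimately show ?thesis by (intro takeWhile_append1[of k]) auto
          qed
          show ?thesis unfolding c1 insertion_value_def Let_def using False 3 tw3 by auto
        qed
      qed
    qed
  qed
  then show "\<omega> = \<alpha> @ \<alpha>' @ j # \<beta>' @ \<beta> \<Longrightarrow>
      c P Q R \<alpha> \<beta> = insertion_value (\<lambda>P Q. g P (Q @ R)) \<alpha>' \<beta>' j P Q"
    and "(\<nexists>\<alpha>' \<beta>'. \<omega> = \<alpha> @ \<alpha>' @ j # \<beta>' @ \<beta>) \<Longrightarrow> c P Q R \<alpha> \<beta> = 0" by blast+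
qed

lemma map_letter_eq_iff [simp]: "map A S = map A S' \<longleftrightarrow> S = S'" "map B S = map B S' \<longleftrightarrow> S = S'"
  by (simp_all add: inj_map_eq_map inj_def)

lemma normal_word_eq_iff:
  "map A P @ map B Q = map A P' @ map B Q' \<longleftrightarrow> P = P' \<and> Q = Q'"
proof
  assume eq: "map A P @ map B Q = map A P' @ map B Q'"
  have f: "filter (\<lambda>x. \<exists>i. x = A i) (map A P @ map B Q) = map A P"
      "filter (\<lambda>x. \<exists>i. x = B i) (map A P @ map B Q) = map B Q" for P Q
    by (simp_all add: filter_id_conv filter_empty_conv)
  have "map A P = map A P'" "map B Q = map B Q'"
    using arg_cong[OF eq, of "filter (\<lambda>x. \<exists>i. x = A i)"]
      arg_cong[OF eq, of "filter (\<lambda>x. \<exists>i. x = B i)"] unfolding f by blast+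
  then show "P = P' \<and> Q = Q'" by simp
qed simp

text \<open>After rules (i) and (iii) the second factor starts with \<open>a_l\<close> and keeps
  starting with an \<open>a\<close>, so G kills these terms. Rule (ii) remains: the letters of P are
  absorbed one by one into iterated commutators with \<open>a_j\<close> in the first factor. The
  hypothesis \<open>swap\<close> cancels the two terms of the last commutator, which annihilates the
  whole.\<close>

lemma normal_val_absorb:
  assumes G: "\<And>e. 1 < length e \<Longrightarrow> \<exists>u i. e ! 1 = A i # u \<Longrightarrow> G e = 0"
    and swap: "\<And>V l. l \<in> L \<Longrightarrow> G [map A (sub j [j, l] V), map B (j # Q), []] =
      G [map A (sub j [l, j] V), map B (j # Q), []]"
    and "distinct (V @ P)" "set (V @ P) = insert j (set Q)" "j \<in> set V" "distinct Q" "j \<notin> set Q"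
    and "set P \<subseteq> L" "P \<noteq> []"
  shows "normal_val G [map A V, B j # map A P @ map B Q, []] = 0"
  using assms(3-)
proof (induction P arbitrary: V)
  case (Cons l P)
  let ?e = "[map A V, B j # map A (l # P) @ map B Q, []]"
  have l: "l \<noteq> j" "l \<notin> set V" "l \<notin> set P" "l \<in> L" "j \<notin> set P" using Cons.prems by auto
  have set: "set V \<union> insert l (set P) = insert j (set Q)" using Cons.prems(2) by auto
  have "multilinear (insert j (set Q)) ?e"
    using Cons.prems set by (intro multilinearI) (auto simp: distinct_map image_Un[symmetric])
  moreover have "ba ?e \<subseteq> {j} \<times> insert l (set P)"
    using ba_word_subset[of "map A P @ map B Q"] by (auto simp: ba_def ba_word_append)
  ultimately have adm: "admissible ?e" by (rule admissibleI) (use l in auto)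
  have "split_word (map A V) = None" for V using split_word_normal[of V "[]"] by simp
  then have s: "split_expr ?e = Some ([map A V], [], j, l, map A P @ map B Q, [[]])" by simp
  have e2: "subst (A j) [A x, A y] ([map A V] @ ([] @ [B j] @ map A P @ map B Q) # [[]]) =
      [map A (sub j [x, y] V), B j # map A P @ map B Q, []]" for x y
    using l by (simp add: subst_eq_sub sub_notin)
  have z: "normal_val G (us @ ([] @ A l # w) # vs) = 0" if "length us = 1" for us w vs
    using stable_starts_A
    by (rule normal_val_stable[where k = 1]) (use that G in \<open>auto simp: nth_append\<close>)
  have z': "normal_val G (subst (B l) t ([map A V] @ ([] @ [A l] @ map A P @ map B Q) # [[]])) = 0" for t
    using stable_starts_A
    by (rule normal_val_stable[where k = 1]) (use G in \<open>auto simp: subst_eq_sub\<close>)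
  have "normal_val G [map A (sub j [j, l] V), B j # map A P @ map B Q, []] =
      normal_val G [map A (sub j [l, j] V), B j # map A P @ map B Q, []]"
  proof (cases "P = []")
    case True
    have "normal_val G [map A (sub j t V), B j # map A P @ map B Q, []] =
        G [map A (sub j t V), map B (j # Q), []]" if "t = [j, l] \<or> t = [l, j]" for t
    proof -
      have "[map A (sub j t V), B j # map A P @ map B Q, []] \<in>
          reductions [map A V] [] j l (map A P @ map B Q) [[]]"
        using that e2[of j l] e2[of l j] unfolding reductions_def by auto
      moreover have "split_expr [map A (sub j t V), B j # map A P @ map B Q, []] = None"
        using True split_word_normal[of "sub j t V" "[]"] split_word_normal[of "[]" "j # Q"] by simp
      ultimately show ?thesis
        using normal_val_reductions_normal[OF adm s, where G = G] True by simp
    qed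
    then show ?thesis using swap[OF l(4)] by simp
  next
    case False
    have "normal_val G [map A (sub j t V), B j # map A P @ map B Q, []] = 0"
      if "t = [j, l] \<or> t = [l, j]" for t
    proof (rule Cons.IH)
      obtain V1 V2 where V: "V = V1 @ j # V2" using split_list[OF Cons.prems(3)] by blast
      have n: "j \<notin> set V1" "j \<notin> set V2" using Cons.prems(1) V by auto
      have sub: "sub j t V = V1 @ t @ V2" using n by (simp add: V sub_notin)
      show "distinct (sub j t V @ P)" unfolding sub using Cons.prems(1)[unfolded V] l[unfolded V] that by auto
      show "set (sub j t V @ P) = insert j (set Q)"
        unfolding sub Cons.prems(2)[unfolded V, symmetric] using that by auto
      show "j \<in> set (sub j t V)" using that unfolding sub by auto
    qed (use Cons.prems False in auto)
    then show ?thesis by simp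
  qed
  then show ?case
    unfolding normal_val_step[OF adm s] e2 z' by (simp add: z[of "[map A V]", simplified])
qed simp

text \<open>While \<open>b_j\<close> moves right through the third factor, rule (ii) lengthens the
  second factor beyond one letter without a \<open>b\<close>, from where it never returns to
  \<open>[A y]\<close>; and if \<open>b_j\<close> passes everything, the third factor keeps a
  \<open>b\<close>. So exactly one use of rule (iii) is left, at some l. Its minus sign turns the
  commutator of \<open>b_j\<close> and \<open>b_l\<close> into that of \<open>b_l\<close> and
  \<open>b_j\<close>, placed in the first factor.\<close>

lemma normal_val_third:
  assumes G: "G = (\<lambda>e. of_bool (e = [map A P' @ map B Q', [A y], map A S']))"
    and "distinct Q" "distinct (P @ S @ S2)" "set (P @ S @ S2) = set Q" "j \<notin> set Q"
  shows "normal_val G [map A P @ map B Q, [A j], map A S @ B j # map A S2] =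
    (\<Sum>l\<in>set S2. of_bool (j = y \<and> P = P' \<and> S @ S2 = S' \<and> sub l [l, j] Q = Q') -
       of_bool (j = y \<and> P = P' \<and> S @ S2 = S' \<and> sub l [j, l] Q = Q'))"
  using assms(3-)
proof (induction S2 arbitrary: S)
  case Nil
  have "split_expr [map A P @ map B Q, [A j], map A S @ [B j]] = None"
    using split_word_normal[of P Q] split_word_normal[of S "[j]"] by simp
  moreover have "map A S @ [B j] \<noteq> map A S'" by (metis last_map last_snoc letter.distinct(1) map_is_Nil_conv snoc_eq_iff_butlast)
  ultimately show ?case
    using normal_val_normal[of "[map A P @ map B Q, [A j], map A S @ [B j]]" G]
      normal_val_not_admissible[of "[map A P @ map B Q, [A j], map A S @ [B j]]" G]
    by (auto simp: G)
next
  case (Cons l S2)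
  let ?e = "[map A P @ map B Q, [A j], map A S @ B j # map A (l # S2)]"
  have set: "set P \<union> (set S \<union> insert l (set S2)) = set Q" using Cons.prems(2) by auto
  have l: "l \<notin> set S2" "l \<noteq> j" "l \<in> set Q" "j \<notin> set S2" using Cons.prems by auto
  have "multilinear (insert j (set Q)) ?e"
    using Cons.prems assms(2) set by (intro multilinearI) (auto simp: distinct_map image_Un[symmetric])
  moreover have "ba ?e \<subseteq> {j} \<times> insert l (set S2)"
    by (auto simp: ba_def ba_word_append)
  ultimately have adm: "admissible ?e" by (rule admissibleI) (use l in auto)
  have s: "split_expr ?e = Some ([map A P @ map B Q, [A j]], map A S, j, l, map A S2, [])"
    using split_word_normal[of P Q] split_word_normal_BA[of S "[]" j l "map A S2"] by simp
  have e1: "[map A P @ map B Q, [A j]] @ (map A S @ [A l, B j] @ map A S2) # [] =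
      [map A P @ map B Q, [A j], map A (S @ [l]) @ B j # map A S2]" by simp
  have z: "normal_val G (subst (A j) [x1, x2] ([map A P @ map B Q, [A j]] @ (map A S @ [B j] @ map A S2) # [])) = 0"
    if "\<forall>i. B i \<notin> set [x1, x2]" for x1 x2
    using stable_long_no_B
  proof (rule normal_val_stable[where k = 1])
    show "G e = 0" if "1 < length e" "2 \<le> length (e ! 1) \<and> (\<forall>i. B i \<notin> set (e ! 1))" for e
      using that by (auto simp: G)
  qed (use that in \<open>auto simp: subst_eq_sub\<close>)
  have e3: "subst (B l) [B x1, B x2] ([map A P @ map B Q, [A j]] @ (map A S @ [A l] @ map A S2) # []) =
      [map A P @ map B (sub l [x1, x2] Q), [A j], map A (S @ l # S2)]" for x1 x2
    by (simp add: subst_eq_sub)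
  have n3: "normal_val G [map A P @ map B (sub l t Q), [A j], map A (S @ l # S2)] =
      of_bool (j = y \<and> P = P' \<and> S @ l # S2 = S' \<and> sub l t Q = Q')" if "t = [j, l] \<or> t = [l, j]" for t
  proof -
    have "[map A P @ map B (sub l t Q), [A j], map A (S @ l # S2)] \<in>
        reductions [map A P @ map B Q, [A j]] (map A S) j l (map A S2) []"
      using that e3[of j l] e3[of l j] unfolding reductions_def by auto
    moreover have "split_expr [map A P @ map B (sub l t Q), [A j], map A (S @ l # S2)] = None"
      using split_word_normal[of P "sub l t Q"] split_word_normal[of "S @ l # S2" "[]"] by simp
    ultimately have "normal_val G [map A P @ map B (sub l t Q), [A j], map A (S @ l # S2)] =
        G [map A P @ map B (sub l t Q), [A j], map A (S @ l # S2)]"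
      by (rule normal_val_reductions_normal[OF adm s])
    also have "\<dots> = of_bool (j = y \<and> P = P' \<and> S @ l # S2 = S' \<and> sub l t Q = Q')"
      unfolding G list.inject normal_word_eq_iff map_letter_eq_iff by (simp add: conj_ac)
    finally show ?thesis .
  qed
  have IH: "normal_val G [map A P @ map B Q, [A j], map A (S @ [l]) @ B j # map A S2] =
    (\<Sum>l'\<in>set S2. of_bool (j = y \<and> P = P' \<and> S @ l # S2 = S' \<and> sub l' [l', j] Q = Q') -
       of_bool (j = y \<and> P = P' \<and> S @ l # S2 = S' \<and> sub l' [j, l'] Q = Q'))"
    using Cons.IH[of "S @ [l]"] Cons.prems unfolding append_assoc append_Cons append_Nil by auto
  have z': "normal_val G (subst (A j) [A x, A x'] ([map A P @ map B Q, [A j]] @ (map A S @ [B j] @ map A S2) # [])) = 0"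
    for x x' by (rule z) simp
  show ?case
    unfolding normal_val_step[OF adm s] e1 e3 IH z' n3[OF disjI1[OF refl]] n3[OF disjI2[OF refl]]
      list.set sum.insert[OF finite_set l(1)]
    by (simp only: algebra_simps)
qed

section \<open>The linear equation in labelled form\<close>

definition normal_on :: "nat \<Rightarrow> nat set \<Rightarrow> expr set" where
  "normal_on n J = {e. length e = n \<and> normally_ordered e \<and> multilinear J e}"

lemma normal_exprs_eq: "normal_exprs n N = normal_on n {1..N}"
  by (simp add: normal_exprs_def normal_on_def)

lemma finite_normal_on:
  assumes "finite J"
  shows "finite (normal_on n J)"
proof -
  let ?L = "A ` J \<union> B ` J"
  have "normal_on n J \<subseteq> {e. set e \<subseteq> {w. set w \<subseteq> ?L \<and> length w \<le> card ?L} \<and> length e = n}"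
  proof
    fix e assume e: "e \<in> normal_on n J"
    have "set w \<subseteq> ?L \<and> length w \<le> card ?L" if "w \<in> set e" for w
    proof -
      have d: "distinct (concat e)" "set (concat e) = ?L" using e by (auto simp: normal_on_def multilinear_def)
      then have "set w \<subseteq> ?L" "distinct w" using that by (auto simp: distinct_concat_iff)
      moreover from this have "length w \<le> card ?L"
        using assms by (metis card_mono distinct_card finite_UnI finite_imageI)
      ultimately show ?thesis by simp
    qed
    then show "e \<in> {e. set e \<subseteq> {w. set w \<subseteq> ?L \<and> length w \<le> card ?L} \<and> length e = n}"
      using e by (auto simp: normal_on_def)
  qed
  moreover have "finite {w. set w \<subseteq> ?L \<and> length w \<le> card ?L}"
    using assms by (intro finite_lists_length_le) auto
  ultimately show ?thesis by (rule finite_subset[OF _ finite_lists_length_eq])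
qed

lemma normal_on_2_iff:
  "w \<in> normal_on 2 J \<longleftrightarrow> (\<exists>P Q S T. w = [map A P @ map B Q, map A S @ map B T] \<and>
     P @ S \<in> permutations_of_set J \<and> Q @ T \<in> permutations_of_set J)"
proof
  assume w: "w \<in> normal_on 2 J"
  then obtain u v where uv: "w = [u, v]" by (auto simp: normal_on_def length_Suc_conv numeral_2_eq_2)
  with w obtain P Q S T where u: "u = map A P @ map B Q" and v: "v = map A S @ map B T"
    unfolding normal_on_def normally_ordered_def by force
  have m: "distinct (concat w)" "set (concat w) = A ` J \<union> B ` J"
    using w by (simp_all add: normal_on_def multilinear_def)
  have "distinct (P @ S)" "distinct (Q @ T)"
    using m(1) by (auto simp: uv u v distinct_map)
  moreover have "set (P @ S) = J"
  proof -
    have "x \<in> set (P @ S) \<longleftrightarrow> A x \<in> set (concat w)" for x by (auto simp: uv u v)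
    then show ?thesis unfolding m(2) by auto
  qed
  moreover have "set (Q @ T) = J"
  proof -
    have "x \<in> set (Q @ T) \<longleftrightarrow> B x \<in> set (concat w)" for x by (auto simp: uv u v)
    then show ?thesis unfolding m(2) by auto
  qed
  ultimately show "\<exists>P Q S T. w = [map A P @ map B Q, map A S @ map B T] \<and>
     P @ S \<in> permutations_of_set J \<and> Q @ T \<in> permutations_of_set J"
    using uv u v unfolding permutations_of_set_iff by blast
next
  assume "\<exists>P Q S T. w = [map A P @ map B Q, map A S @ map B T] \<and>
     P @ S \<in> permutations_of_set J \<and> Q @ T \<in> permutations_of_set J"
  then obtain P Q S T where w: "w = [map A P @ map B Q, map A S @ map B T]"
    and d: "distinct (P @ S)" "set (P @ S) = J" "distinct (Q @ T)" "set (Q @ T) = J"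
    unfolding permutations_of_set_iff by blast
  have "multilinear J w"
  proof (rule multilinearI)
    show "distinct (concat w)" using d(1,3) by (auto simp: w distinct_map)
    have "set (concat w) = A ` set (P @ S) \<union> B ` set (Q @ T)" by (auto simp: w)
    then show "set (concat w) = A ` J \<union> B ` J" by (simp only: d(2,4))
  qed
  moreover have "normally_ordered w" unfolding w normally_ordered_def by auto
  ultimately show "w \<in> normal_on 2 J" by (simp add: normal_on_def w)
qed

definition r_expr :: "nat \<Rightarrow> nat \<Rightarrow> nat \<Rightarrow> expr" where
  "r_expr i k j = insert_expr i k [[A j], [B j]]"

text \<open>
  The left-hand side of the linear equation, evaluated by \<open>G\<close>, for \<open>r\<close> with letter \<open>j\<close> and \<open>T = w\<close>.
\<close>

definition linear_val :: "(expr \<Rightarrow> 'k::field_char_0) \<Rightarrow> nat \<Rightarrow> expr \<Rightarrow> 'k" where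
  "linear_val G j w =
     normal_val G (juxtapose (r_expr 1 2 j) (insert_expr 1 3 w))
   - normal_val G (juxtapose (insert_expr 1 3 w) (r_expr 1 2 j))
   + normal_val G (juxtapose (r_expr 1 2 j) (insert_expr 2 3 w))
   - normal_val G (juxtapose (insert_expr 2 3 w) (r_expr 1 2 j))
   + normal_val G (juxtapose (r_expr 1 3 j) (insert_expr 2 3 w))
   - normal_val G (juxtapose (r_expr 2 3 j) (insert_expr 1 3 w))"

lemma linear_val_eq:
  "linear_val G j [u, v] = normal_val G [A j # u, [B j], v] - normal_val G [u @ [A j], [B j], v]
   + normal_val G [[A j], B j # u, v] - normal_val G [[A j], u @ [B j], v]
   + normal_val G [[A j], u, B j # v] - normal_val G [u, [A j], B j # v]"
  by (simp add: linear_val_def r_expr_def juxtapose_def)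

definition kills_third_B :: "(expr \<Rightarrow> 'k::field_char_0) \<Rightarrow> bool" where
  "kills_third_B G \<longleftrightarrow> (\<forall>e i. 2 < length e \<longrightarrow> B i \<in> set (e ! 2) \<longrightarrow> G e = 0)"

lemma normal_val_ends_B:
  assumes "kills_third_B G"
  shows "normal_val G [u, v, w @ [B i]] = 0"
  using stable_ends_B
proof (rule normal_val_stable[where k = 2])
  fix e assume e: "2 < length e" "\<exists>u i. e ! 2 = u @ [B i]"
  then obtain u i where "e ! 2 = u @ [B i]" by blast
  then have "B i \<in> set (e ! 2)" by simp
  then show "G e = 0" using assms e(1) unfolding kills_third_B_def by blast
qed auto

lemma linear_val_ends_B:
  assumes "kills_third_B G"
  shows "linear_val G j [u, v @ [B i]] = 0"
  using normal_val_ends_B[OF assms] normal_val_ends_B[OF assms, where w = "B j # v"]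
  by (simp add: linear_val_eq)

lemma normal_val_split_None: "split_expr e = None \<Longrightarrow> G e = 0 \<Longrightarrow> normal_val G e = 0"
  by (cases "admissible e") (simp_all add: normal_val_normal normal_val_not_admissible)

lemma filter_sub_new: "y \<notin> set Q \<Longrightarrow> l \<noteq> y \<Longrightarrow> s = [l, y] \<or> s = [y, l] \<Longrightarrow>
    filter (\<lambda>z. z \<noteq> y) (sub l s Q) = Q"
  by (induction Q) auto

text \<open>The linear equation tested by a functional that kills the left ideal. F is defined for
  all label sets at once, so that T can be written with the labels \<open>I - {j}\<close> when r
  carries the label j.\<close>

locale labelled_equation =
  fixes F :: "expr \<Rightarrow> 'k::field_char_0" and N :: nat
  assumes F_renumber: "bij \<sigma> \<Longrightarrow> F (renumber \<sigma> w) = F w"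
    and linear_equation: "finite I \<Longrightarrow> card I = Suc N \<Longrightarrow> kills_third_B G \<Longrightarrow>
      (\<Sum>j\<in>I. \<Sum>w\<in>normal_on 2 (I - {j}). F w * linear_val G j w) = 0"
    and N_ge_2: "2 \<le> N"
begin

lemma second_factor_A:
  assumes "finite J" "card J = N" "P0 @ S0 \<in> permutations_of_set J" "Q0 \<in> permutations_of_set J" "S0 \<noteq> []"
  shows "F [map A P0 @ map B Q0, map A S0] = 0"
proof -
  obtain y where y: "y \<notin> J" using ex_new_if_finite[OF infinite_UNIV_nat assms(1)] by blast
  define I where "I = insert y J"
  have I: "finite I" "card I = Suc N" "I - {y} = J" using assms(1,2) y by (auto simp: I_def)
  have S0: "set S0 \<subseteq> J" and Q0: "set Q0 = J" "distinct Q0"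
    using assms(3,4) by (auto simp: permutations_of_set_iff)
  have "\<exists>x\<in>set Q0. x \<in> set S0" using S0 Q0 assms(5) by (cases S0) auto
  then obtain q1 l0 q2 where q: "Q0 = q1 @ l0 # q2" "l0 \<in> set S0" "\<forall>x\<in>set q1. x \<notin> set S0"
    using split_list_first_prop[of Q0 "\<lambda>x. x \<in> set S0"] by blast
  \<comment> \<open>The new letter y stands directly before \<open>l0\<close>, the first letter of
    \<open>Q0\<close> that belongs to \<open>S0\<close>. For y to stand directly after a letter of
    \<open>S0\<close>, such a letter would have to precede \<open>l0\<close>. So among the monomials
    of all commutators of \<open>b_l\<close> and \<open>b_y\<close> with l in \<open>S0\<close>,
    only one gives \<open>Q'\<close>, and it comes from \<open>l0\<close>.\<close>
  define Q' where "Q' = q1 @ y # l0 # q2"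
  define G :: "expr \<Rightarrow> 'k" where "G = (\<lambda>e. of_bool (e = [map A P0 @ map B Q', [A y], map A S0]))"
  have G: "kills_third_B G" by (auto simp: kills_third_B_def G_def)
  \<comment> \<open>Five of the six terms vanish: in two the second factor is \<open>b_j\<close> and
    never acquires an \<open>a\<close>, in three the first factor is \<open>a_j\<close> and never
    acquires a \<open>b\<close>, while the target has both.\<close>
  have G1: "normal_val G [u, [B j], v] = 0" for u j v
    using stable_no_A by (rule normal_val_stable[where k = 1]) (auto simp: G_def)
  have G2: "normal_val G [[A j], u, v] = 0" for u j v
    using stable_no_B by (rule normal_val_stable[where k = 0]) (auto simp: G_def Q'_def)
  let ?w0 = "[map A P0 @ map B Q0, map A S0]"
  have val: "linear_val G j w = of_bool (j = y \<and> w = ?w0)"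
    if "j \<in> I" "w \<in> normal_on 2 (I - {j})" for j w
  proof -
    obtain P Q S T where w: "w = [map A P @ map B Q, map A S @ map B T]"
      and PS: "P @ S \<in> permutations_of_set (I - {j})" and QT: "Q @ T \<in> permutations_of_set (I - {j})"
      using \<open>w \<in> _\<close> unfolding normal_on_2_iff by blast
    show ?thesis
    proof (cases T rule: rev_cases)
      case (snoc T' t)
      then have "B t \<in> set (map A S @ map B T)" by simp
      moreover have "B t \<notin> set (map A S0)" by auto
      ultimately have "map A S @ map B T \<noteq> map A S0" by metis
      then show ?thesis
        using linear_val_ends_B[OF G, of j "map A P @ map B Q" "map A S @ map B T'" t] by (simp add: w snoc)
    next
      case Nil
      have Q: "set Q = I - {j}" "distinct Q" using QT Nil by (simp_all add: permutations_of_set_iff)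
      have PS': "set (P @ S) = I - {j}" "distinct (P @ S)" using PS by (simp_all only: permutations_of_set_iff)
      have "linear_val G j w = - normal_val G [map A P @ map B Q, [A j], map A [] @ B j # map A S]"
        by (simp add: w Nil linear_val_eq G1 G2)
      also have "\<dots> = - (\<Sum>l\<in>set S. of_bool (j = y \<and> P = P0 \<and> [] @ S = S0 \<and> sub l [l, j] Q = Q') -
          of_bool (j = y \<and> P = P0 \<and> [] @ S = S0 \<and> sub l [j, l] Q = Q'))"
        by (subst normal_val_third[OF G_def]) (use Q PS' in auto)
      also have "\<dots> = of_bool (j = y \<and> w = ?w0)"
      proof (cases "j = y \<and> P = P0 \<and> S = S0")
        case True
        have yQ: "y \<notin> set Q" using Q True by auto
        have ly: "l \<noteq> y" if "l \<in> set S0" for l using that S0 y by blast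
        have yQ0: "y \<notin> set Q0" using Q0 y by simp
        have "filter (\<lambda>z. z \<noteq> y) q1 = q1" "filter (\<lambda>z. z \<noteq> y) q2 = q2" "l0 \<noteq> y"
          using yQ0 by (auto simp: q(1) filter_id_conv)
        then have fQ': "filter (\<lambda>z. z \<noteq> y) Q' = Q0" by (simp add: Q'_def q(1))
        have QQ0: "Q = Q0" if "sub l s Q = Q'" "l \<in> set S0" "s = [l, y] \<or> s = [y, l]" for l s
          using filter_sub_new[OF yQ ly[OF that(2)] that(3)] that(1) fQ' by simp
        have "w = ?w0 \<longleftrightarrow> Q = Q0" using True Nil by (simp add: w normal_word_eq_iff)
        moreover have "(\<Sum>l\<in>set S0. of_bool (sub l [l, y] Q = Q') - of_bool (sub l [y, l] Q = Q')) =
            (- of_bool (Q = Q0) :: 'k)"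
        proof (cases "Q = Q0")
          case False
          then have "sub l [l, y] Q \<noteq> Q'" "sub l [y, l] Q \<noteq> Q'" if "l \<in> set S0" for l
            using QQ0 that by blast+
          then show ?thesis using False by simp
        next
          case QQ: True
          have "sub l [l, y] Q \<noteq> Q' \<and> (sub l [y, l] Q = Q' \<longleftrightarrow> l = l0)" if "l \<in> set S0" for l
          proof -
            have "l \<in> set Q0" using that S0 Q0 by blast
            then obtain a b where ab: "Q0 = a @ l # b" using split_list by metis
            have n: "l \<notin> set a" "l \<notin> set b" "y \<notin> set a" "y \<notin> set b" "y \<notin> set q1" "y \<notin> set q2" "l \<noteq> y"
              using Q0(2)[unfolded ab] yQ0[unfolded ab] yQ0[unfolded q(1)] ly[OF that] by auto
            have s: "sub l s Q = a @ s @ b" for s using n by (simp add: QQ ab sub_notin)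
            have "a @ l # y # b \<noteq> q1 @ y # l0 # q2"
            proof
              assume "a @ l # y # b = q1 @ y # l0 # q2"
              then have "(a @ [l]) @ y # b = q1 @ y # l0 # q2" by simp
              moreover have "y \<notin> set (a @ [l])" using n by simp
              ultimately have "a @ [l] = q1" using n append_Cons_eq_iff[of y "a @ [l]" b q1 "l0 # q2"] by blast
              then show False using q(3) that by auto
            qed
            moreover have "a @ y # l # b = q1 @ y # l0 # q2 \<longleftrightarrow> l = l0"
            proof
              assume "a @ y # l # b = q1 @ y # l0 # q2"
              then show "l = l0" using n append_Cons_eq_iff[of y a "l # b" q1 "l0 # q2"] by simp
            next
              assume "l = l0"
              then have "a @ l0 # b = q1 @ l0 # q2" using ab q(1) by simp
              then show "a @ y # l # b = q1 @ y # l0 # q2"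
                using n \<open>l = l0\<close> append_Cons_eq_iff[of l0 a b q1 q2] by simp
            qed
            ultimately show ?thesis unfolding s Q'_def by simp
          qed
          then have "(\<Sum>l\<in>set S0. of_bool (sub l [l, y] Q = Q') - of_bool (sub l [y, l] Q = Q')) =
              (\<Sum>l\<in>set S0. if l = l0 then - 1 else 0 :: 'k)"
            by (intro sum.cong refl) auto
          then show ?thesis using q(2) QQ by simp
        qed
        ultimately show ?thesis using True by simp
      next
        case False
        then have "\<not> (j = y \<and> w = ?w0)" by (auto simp: w Nil normal_word_eq_iff)
        with False show ?thesis by (auto intro!: sum.neutral)
      qed
      finally show ?thesis .
    qed
  qed
  have w0: "?w0 \<in> normal_on 2 J"
    unfolding normal_on_2_iff using assms(3,4)
    by (intro exI[of _ P0] exI[of _ Q0] exI[of _ S0] exI[of _ "[]"]) simp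
  have "0 = (\<Sum>j\<in>I. \<Sum>w\<in>normal_on 2 (I - {j}). F w * linear_val G j w)"
    by (rule linear_equation[OF I(1,2) G, symmetric])
  also have "\<dots> = (\<Sum>j\<in>I. \<Sum>w\<in>normal_on 2 (I - {j}). F w * of_bool (j = y \<and> w = ?w0))"
    by (intro sum.cong refl) (simp add: val)
  also have "\<dots> = (\<Sum>j\<in>I. if j = y then F ?w0 else 0)"
  proof (intro sum.cong refl)
    fix j assume "j \<in> I"
    show "(\<Sum>w\<in>normal_on 2 (I - {j}). F w * of_bool (j = y \<and> w = ?w0)) = (if j = y then F ?w0 else 0)"
    proof (cases "j = y")
      case True
      have "(\<Sum>w\<in>normal_on 2 J. F w * of_bool (w = ?w0)) = (\<Sum>w\<in>normal_on 2 J. if w = ?w0 then F ?w0 else 0)"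
        by (intro sum.cong refl) simp
      then show ?thesis using True I(3) w0 finite_normal_on[OF assms(1)] by simp
    qed simp
  qed
  also have "\<dots> = F ?w0" using I(1) by (simp add: I_def)
  finally show ?thesis by simp
qed

text \<open>A \<open>b\<close> in the second factor is excluded by the hypothesis on
  \<open>h\<close>, an \<open>a\<close> without a \<open>b\<close> by
  \<open>second_factor_A\<close>; what remains is the part \<open>f \<otimes> 1\<close>.\<close>

lemma sum_normal_on:
  assumes "finite J" "card J = N" "\<And>u v i. h [u, v @ [B i]] = 0"
  shows "(\<Sum>w\<in>normal_on 2 J. F w * h w) =
    (\<Sum>P\<in>permutations_of_set J. \<Sum>Q\<in>permutations_of_set J.
      F [map A P @ map B Q, []] * h [map A P @ map B Q, []])"
proof -
  let ?X = "permutations_of_set J \<times> permutations_of_set J"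
  let ?f = "\<lambda>(P, Q). [map A P @ map B Q, []]"
  have "(\<Sum>w\<in>normal_on 2 J. F w * h w) = (\<Sum>w\<in>?f ` ?X. F w * h w)"
  proof (rule sum.mono_neutral_right)
    show "finite (normal_on 2 J)" by (rule finite_normal_on[OF assms(1)])
    show "?f ` ?X \<subseteq> normal_on 2 J"
    proof (intro image_subsetI)
      fix x assume "x \<in> ?X"
      then obtain P Q where x: "x = (P, Q)" "P \<in> permutations_of_set J" "Q \<in> permutations_of_set J"
        by blast
      then show "?f x \<in> normal_on 2 J"
        unfolding normal_on_2_iff
        by (intro exI[of _ P] exI[of _ Q] exI[of _ "[]"]) simp
    qed
    show "\<forall>w\<in>normal_on 2 J - ?f ` ?X. F w * h w = 0"
    proof
      fix w assume w': "w \<in> normal_on 2 J - ?f ` ?X"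
      then have "w \<in> normal_on 2 J" by blast
      then obtain P Q S T where w: "w = [map A P @ map B Q, map A S @ map B T]"
        and PQ: "P @ S \<in> permutations_of_set J" "Q @ T \<in> permutations_of_set J"
        unfolding normal_on_2_iff by blast
      show "F w * h w = 0"
      proof (cases T rule: rev_cases)
        case (snoc T' t)
        then show ?thesis using assms(3)[of "map A P @ map B Q" "map A S @ map B T'" t] by (simp add: w)
      next
        case Nil
        have "S \<noteq> []"
        proof
          assume "S = []"
          then have "w = ?f (P, Q)" "(P, Q) \<in> ?X" using w PQ Nil by simp_all
          then show False using w' by blast
        qed
        then show ?thesis
          using second_factor_A[OF assms(1,2) PQ(1), of Q] PQ(2) Nil by (simp add: w)
      qed
    qed
  qed
  also have "\<dots> = (\<Sum>x\<in>?X. F (?f x) * h (?f x))"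
  proof (subst sum.reindex)
    show "inj_on ?f ?X" by (auto simp: inj_on_def normal_word_eq_iff)
  qed simp
  also have "\<dots> = (\<Sum>P\<in>permutations_of_set J. \<Sum>Q\<in>permutations_of_set J.
      F [map A P @ map B Q, []] * h [map A P @ map B Q, []])"
    unfolding sum.cartesian_product by (intro sum.cong refl) auto
  finally show ?thesis .
qed

sublocale vanishing "\<lambda>P Q. F [map A P @ map B Q, []]" N
proof
  fix \<sigma> :: "nat \<Rightarrow> nat" and P Q assume "bij \<sigma>"
  then show "F [map A (map \<sigma> P) @ map B (map \<sigma> Q), []] = F [map A P @ map B Q, []]"
    using F_renumber[of \<sigma> "[map A P @ map B Q, []]"] by (simp add: comp_def)
next
  fix I :: "nat set" and \<omega> S T
  assume I: "finite I" "card I = Suc N" and \<omega>: "set \<omega> \<subseteq> I" "distinct \<omega>" "2 \<le> length \<omega>"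
    "length \<omega> \<noteq> Suc N \<or> (\<forall>p\<in>S. hd \<omega> \<in> set p \<longrightarrow> p = [hd \<omega>])"
  define g :: "nat list \<Rightarrow> nat list \<Rightarrow> 'k" where "g P Q = of_bool (agrees S P \<and> agrees T Q)" for P Q
  define G :: "expr \<Rightarrow> 'k" where
    "G e = of_bool (\<exists>P Q. e = [map A P @ map B Q, map B \<omega>, []] \<and> agrees S P \<and> agrees T Q)" for e
  have G: "G [map A P @ map B Q, map B \<omega>', []] = (if \<omega>' = \<omega> then g P Q else 0)" for P Q \<omega>'
    unfolding G_def g_def list.inject normal_word_eq_iff map_letter_eq_iff by auto
  have G_eq_0: "G [u, v, w] = 0" if "v \<noteq> map B \<omega> \<or> w \<noteq> []" for u v w
    using that by (auto simp: G_def)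
  have G_start: "G e = 0" if "\<exists>u i. e ! 1 = A i # u" for e
    using that by (cases \<omega>) (auto simp: G_def)
  have kills: "kills_third_B G" by (auto simp: kills_third_B_def G_def)
  have val: "linear_val G j [map A P @ map B Q, []] =
      - (if j \<in> set \<omega> then insertion_value g (takeWhile (\<lambda>x. x \<noteq> j) \<omega>) (tl (dropWhile (\<lambda>x. x \<noteq> j) \<omega>)) j P Q
         else 0)"
    if j: "j \<in> I" and P: "P \<in> permutations_of_set (I - {j})" and Q: "Q \<in> permutations_of_set (I - {j})"
    for j P Q
  proof -
    have P': "set P = I - {j}" "distinct P" and Q': "set Q = I - {j}" "distinct Q"
      using P Q by (simp_all add: permutations_of_set_iff)
    have card: "card (I - {j}) = N" using I j by simp
    have len: "length P = N" "length Q = N" using P' Q' card distinct_card by metis+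
    then have ne: "P \<noteq> []" using N_ge_2 by auto
    have 1: "normal_val G [A j # map A P @ map B Q, [B j], []] = 0"
    proof (rule normal_val_split_None)
      show "split_expr [A j # map A P @ map B Q, [B j], []] = None"
        using split_word_normal[of "j # P" Q] by simp
      show "G [A j # map A P @ map B Q, [B j], []] = 0"
        using \<omega>(3) by (intro G_eq_0) (auto simp: map_eq_Cons_conv)
    qed
    \<comment> \<open>The only way to reach the target is \<open>\<omega> = j # Q\<close>, of length
      \<open>N + 1\<close>. Then j is the head of \<omega> and alone in its block, so the
      commutators with \<open>a_j\<close> cancel.\<close>
    have 3: "normal_val G [[A j], B j # map A P @ map B Q, []] = 0"
    proof -
      have "normal_val G [map A [j], B j # map A P @ map B Q, []] = 0"
      proof (rule normal_val_absorb[where L = "set P"])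
        fix V l assume l: "l \<in> set P"
        show "G [map A (sub j [j, l] V), map B (j # Q), []] = G [map A (sub j [l, j] V), map B (j # Q), []]"
        proof (cases "\<omega> = j # Q")
          case True
          then have "\<forall>p\<in>S. j \<in> set p \<longrightarrow> p = [j]" using \<omega>(4) len by simp
          moreover have "l \<noteq> j" using l P' by auto
          ultimately have "\<not> (j \<in> set p \<and> l \<in> set p)" if "p \<in> S" for p using that by auto
          from agrees_sub_swap[OF this] show ?thesis
            using G[of "sub j [j, l] V" "[]" "j # Q"] G[of "sub j [l, j] V" "[]" "j # Q"]
            by (simp add: g_def)
        next
          case False
          then show ?thesis by (auto simp: G_def)
        qed
      qed (use P' Q' j ne G_start in auto)
      then show ?thesis by simp
    qed
    \<comment> \<open>As P is not empty, the second factor starts with an \<open>a\<close>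
      throughout, unlike \<open>b_\<omega>\<close>.\<close>
    have 4: "normal_val G [[A j], (map A P @ map B Q) @ [B j], []] = 0"
      using stable_starts_A
      by (rule normal_val_stable[where k = 1]) (use ne G_start in \<open>auto simp: neq_Nil_conv\<close>)
    have 5: "normal_val G [u, v, [B j]] = 0" for u v
      using normal_val_ends_B[OF kills, of u v "[]"] by simp
    have 2: "normal_val G [(map A P @ map B Q) @ [A j], [B j], []] =
      (if j \<in> set \<omega> then insertion_value g (takeWhile (\<lambda>x. x \<noteq> j) \<omega>) (tl (dropWhile (\<lambda>x. x \<noteq> j) \<omega>)) j P Q
         else 0)"
    proof -
      note ins = normal_val_insertion[where G = G and g = g and \<omega> = \<omega> and P = P and Q = Q and R = "[]"
        and \<alpha> = "[]" and \<beta> = "[]" and j = j, OF G \<omega>(2)]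
      show ?thesis
      proof (cases "j \<in> set \<omega>")
        case True
        then obtain a b where ab: "\<omega> = a @ j # b" using split_list by metis
        have "j \<notin> set a" using \<omega>(2) ab by simp
        then show ?thesis
          using ins(1)[of a b] P' Q' ab by (simp add: takeWhile_neq_append dropWhile_neq_append)
      next
        case False
        then have "\<nexists>a b. \<omega> = [] @ a @ j # b @ []" by auto
        from ins(2)[OF _ _ _ _ this] show ?thesis using False P' Q' by simp
      qed
    qed
    show ?thesis unfolding linear_val_eq 1 2 3 4 5 by simp
  qed
  have "0 = (\<Sum>j\<in>I. \<Sum>w\<in>normal_on 2 (I - {j}). F w * linear_val G j w)"
    by (rule linear_equation[OF I kills, symmetric])
  also have "\<dots> = (\<Sum>j\<in>I. \<Sum>P\<in>permutations_of_set (I - {j}). \<Sum>Q\<in>permutations_of_set (I - {j}).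
      F [map A P @ map B Q, []] * linear_val G j [map A P @ map B Q, []])"
    using I by (intro sum.cong refl sum_normal_on linear_val_ends_B[OF kills]) auto
  also have "\<dots> = (\<Sum>j\<in>I. if j \<in> set \<omega> then
      - (\<Sum>P\<in>permutations_of_set (I - {j}). \<Sum>Q\<in>permutations_of_set (I - {j}).
      F [map A P @ map B Q, []] *
      insertion_value g (takeWhile (\<lambda>x. x \<noteq> j) \<omega>) (tl (dropWhile (\<lambda>x. x \<noteq> j) \<omega>)) j P Q) else 0)"
    by (intro sum.cong refl) (simp add: val sum_negf)
  also have "\<dots> = (\<Sum>j\<in>set \<omega>. if j \<in> set \<omega> then
      - (\<Sum>P\<in>permutations_of_set (I - {j}). \<Sum>Q\<in>permutations_of_set (I - {j}).
      F [map A P @ map B Q, []] *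
      insertion_value g (takeWhile (\<lambda>x. x \<noteq> j) \<omega>) (tl (dropWhile (\<lambda>x. x \<noteq> j) \<omega>)) j P Q) else 0)"
    using I(1) \<omega>(1) by (intro sum.mono_neutral_right) auto
  also have "\<dots> = - (\<Sum>j\<in>set \<omega>.
      \<Sum>P\<in>permutations_of_set (I - {j}). \<Sum>Q\<in>permutations_of_set (I - {j}).
      F [map A P @ map B Q, []] *
      insertion_value g (takeWhile (\<lambda>x. x \<noteq> j) \<omega>) (tl (dropWhile (\<lambda>x. x \<noteq> j) \<omega>)) j P Q)"
    unfolding sum_negf[symmetric] by (intro sum.cong refl) simp
  finally show "(\<Sum>j\<in>set \<omega>. \<Sum>P\<in>permutations_of_set (I - {j}). \<Sum>Q\<in>permutations_of_set (I - {j}).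
      F [map A P @ map B Q, []] * insertion_value (\<lambda>P Q. of_bool (agrees S P \<and> agrees T Q))
      (takeWhile (\<lambda>x. x \<noteq> j) \<omega>) (tl (dropWhile (\<lambda>x. x \<noteq> j) \<omega>)) j P Q) = 0"
    unfolding g_def[abs_def] by simp
qed (rule N_ge_2)

lemma no_B_in_second_factor:
  assumes "finite J" "card J = N" "w \<in> normal_on 2 J" "\<And>i. B i \<notin> set (w ! 1)"
  shows "F w = 0"
proof -
  obtain P Q S T where w: "w = [map A P @ map B Q, map A S @ map B T]"
    and PQ: "P @ S \<in> permutations_of_set J" "Q @ T \<in> permutations_of_set J"
    using assms(3) unfolding normal_on_2_iff by blast
  have T: "T = []" using assms(4) by (cases T) (auto simp: w)
  show ?thesis
  proof (cases "S = []")
    case True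
    then show ?thesis using weights_eq_0[of P J Q] PQ T assms(2) by (simp add: w)
  next
    case False
    then show ?thesis using second_factor_A[OF assms(1,2) PQ(1)] PQ(2) T by (simp add: w)
  qed
qed

end

lemma normal_val_renumber:
  assumes "bij \<sigma>"
  shows "normal_val G (renumber \<sigma> e) = normal_val (\<lambda>f. G (renumber \<sigma> f)) e"
proof (induction e rule: normal_order.induct)
  case (1 e)
  show ?case
  proof (cases "admissible e")
    case False
    then show ?thesis using assms by (simp add: normal_val_not_admissible admissible_renumber)
  next
    case adm: True
    then have adm': "admissible (renumber \<sigma> e)" using assms by (simp add: admissible_renumber)
    show ?thesis
    proof (cases "split_expr e")
      case None
      then have "split_expr (renumber \<sigma> e) = None" by (simp add: split_expr_renumber)
      then show ?thesis using None adm adm' by (simp add: normal_val_normal)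
    next
      case (Some a)
      obtain us p i j q vs where a: "a = (us, p, i, j, q, vs)" by (cases a)
      note s = Some[unfolded a]
      have s': "split_expr (renumber \<sigma> e) = Some (renumber \<sigma> us, map (renumber_letter \<sigma>) p, \<sigma> i, \<sigma> j,
          map (renumber_letter \<sigma>) q, renumber \<sigma> vs)"
        using s by (simp add: split_expr_renumber)
      note IH = 1[OF adm s refl refl refl refl refl]
      show ?thesis
        unfolding normal_val_step[OF adm s] normal_val_step[OF adm' s'] IH[symmetric]
        by (simp add: subst_renumber[OF bij_is_inj[OF assms], symmetric])
    qed
  qed
qed

section \<open>The mirror symmetry\<close>

primrec mirror_letter :: "letter \<Rightarrow> letter" where
  "mirror_letter (A i) = B i"
| "mirror_letter (B i) = A i"

definition mirror_word :: "letter list \<Rightarrow> letter list" where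
  "mirror_word w = rev (map mirror_letter w)"

text \<open>
  An anti-automorphism fixing \<open>r\<close>: it exchanges the two Lie algebras and reverses all orders, which
  turns the rewriting rule into itself.
\<close>

definition mirror :: "expr \<Rightarrow> expr" where
  "mirror e = rev (map mirror_word e)"

lemma mirror_letter_mirror [simp]: "mirror_letter (mirror_letter x) = x"
  by (cases x) auto

lemma mirror_word_simps [simp]: "mirror_word [] = []" "mirror_word (u @ v) = mirror_word v @ mirror_word u"
  "mirror_word (x # v) = mirror_word v @ [mirror_letter x]" "mirror_word (mirror_word w) = w"
  by (simp_all add: mirror_word_def rev_map comp_def)

lemma mirror_simps [simp]: "mirror [] = []" "mirror (u @ v) = mirror v @ mirror u"
  "mirror (w # v) = mirror v @ [mirror_word w]" "mirror (mirror e) = e" "length (mirror e) = length e"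
  by (simp_all add: mirror_def rev_map comp_def)

lemma mirror_map [simp]: "mirror_word (map A p) = map B (rev p)" "mirror_word (map B p) = map A (rev p)"
  by (simp_all add: mirror_word_def rev_map)

lemma concat_mirror: "concat (mirror e) = mirror_word (concat e)"
  by (induction e) auto

lemma set_mirror_word: "set (mirror_word w) = mirror_letter ` set w"
  by (simp add: mirror_word_def)

lemma inj_mirror_letter: "inj mirror_letter"
  by (metis injI mirror_letter_mirror)

lemma multilinear_mirror: "multilinear I e \<Longrightarrow> multilinear I (mirror e)"
proof -
  assume *: "multilinear I e"
  then have "distinct (concat (mirror e))"
    unfolding concat_mirror multilinear_def mirror_word_def
    by (auto simp: distinct_map intro: inj_on_subset[OF inj_mirror_letter])
  moreover have "set (concat (mirror e)) = A ` I \<union> B ` I"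
    unfolding concat_mirror set_mirror_word using *
    by (simp add: multilinear_def image_Un image_image Un_commute)
  ultimately show ?thesis by (simp add: multilinear_def)
qed

lemma ba_word_mirror: "ba_word (mirror_word w) = (ba_word w)\<inverse>"
proof (induction w rule: ba_word.induct)
  case (3 i w)
  have "B j \<in> set (mirror_word w) \<longleftrightarrow> A j \<in> set w" for j
    unfolding set_mirror_word by (metis (no_types) image_iff mirror_letter.simps mirror_letter_mirror)
  then show ?case using 3 by (auto simp: ba_word_append)
qed (auto simp: ba_word_append)

lemma ba_mirror: "ba (mirror e) = (ba e)\<inverse>"
  by (induction e) (auto simp: ba_append ba_Cons ba_word_mirror, auto simp: ba_def)

lemma admissible_mirror: "admissible (mirror e) \<longleftrightarrow> admissible e"
proof -
  have "admissible e \<Longrightarrow> admissible (mirror e)" for e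
    unfolding admissible_def ba_mirror using multilinear_mirror acyclic_converse by blast
  then show ?thesis by (metis mirror_simps(4))
qed

lemma mirror_sub: "mirror_word (sub x s w) = sub (mirror_letter x) (mirror_word s) (mirror_word w)"
  by (induction w) (auto dest: injD[OF inj_mirror_letter])

lemma mirror_subst: "mirror (subst x s e) = subst (mirror_letter x) (mirror_word s) (mirror e)"
  unfolding subst_eq_sub by (induction e) (auto simp: mirror_sub)

text \<open>
  Under this condition there is at most one adjacent pair \<open>b_i a_j\<close> at every stage, so that the
  leftmost-first strategy is compatible with the mirror.
\<close>

definition single_line :: "(nat \<times> nat) set \<Rightarrow> bool" where
  "single_line E \<longleftrightarrow> (\<exists>i. E \<subseteq> {i} \<times> UNIV) \<or> (\<exists>j. E \<subseteq> UNIV \<times> {j})"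

lemma single_line_cases:
  assumes "single_line E" "(i, j) \<in> E"
  shows "(\<forall>x\<in>E. fst x = i) \<or> (\<forall>x\<in>E. snd x = j)"
  using assms(1) unfolding single_line_def
proof
  assume "\<exists>i. E \<subseteq> {i} \<times> UNIV"
  then obtain i' where "E \<subseteq> {i'} \<times> UNIV" by blast
  then have "\<forall>x\<in>E. fst x = i'" "i = i'" using assms(2) by auto
  then show ?thesis by simp
next
  assume "\<exists>j. E \<subseteq> UNIV \<times> {j}"
  then obtain j' where "E \<subseteq> UNIV \<times> {j'}" by blast
  then have "\<forall>x\<in>E. snd x = j'" "j = j'" using assms(2) by auto
  then show ?thesis by simp
qed

lemma ba_normally_ordered: "normally_ordered e \<Longrightarrow> ba e = {}"
  by (auto simp: ba_def normally_ordered_def ba_word_append)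

lemma unique_factor:
  assumes "distinct (concat (us @ w # vs))" "us @ w # vs = us' @ w' # vs'" "x \<in> set w" "x \<in> set w'"
  shows "us = us' \<and> w = w' \<and> vs = vs'"
proof -
  from assms(2) consider ys where "us = us' @ ys" "ys @ w # vs = w' # vs'"
    | ys where "us @ ys = us'" "w # vs = ys @ w' # vs'"
    by (auto simp: append_eq_append_conv2)
  then show ?thesis
  proof cases
    case (1 ys)
    then show ?thesis using assms(1,3,4) by (cases ys) auto
  next
    case (2 ys)
    then show ?thesis using assms(1,3,4) by (cases ys) auto
  qed
qed

text \<open>Two adjacent pairs would have their indices in the same row or the same column of
  \<open>ba e\<close>, hence share a letter; each letter occurs only once, so the pairs
  coincide.\<close>

lemma split_expr_unique:
  assumes "distinct (concat e)" "single_line (ba e)" "e = us @ (p @ [B i, A j] @ q) # vs"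
  shows "split_expr e = Some (us, p, i, j, q, vs)"
proof -
  have ij: "(i, j) \<in> ba e" unfolding assms(3) by (auto simp: ba_append ba_Cons ba_word_append)
  then have "split_expr e \<noteq> None" using split_expr_NoneD[of e] ba_normally_ordered[of e] by (metis empty_iff)
  then obtain us' p' i' j' q' vs' where s: "split_expr e = Some (us', p', i', j', q', vs')" by auto
  note e' = split_expr_SomeD[OF s]
  have ij': "(i', j') \<in> ba e" unfolding e' by (auto simp: ba_append ba_Cons ba_word_append)
  from assms(2) ij ij' have "i = i' \<or> j = j'" unfolding single_line_def by blast
  then obtain x where "x \<in> set (p @ [B i, A j] @ q)" "x \<in> set (p' @ [B i', A j'] @ q')" by auto
  from unique_factor[OF _ _ this] assms(1,3) e'
  have w: "us = us'" "p @ [B i, A j] @ q = p' @ [B i', A j'] @ q'" "vs = vs'" by metis+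
  have d1: "distinct (p @ [B i, A j] @ q)" using assms(1) unfolding assms(3) by auto
  then have d: "B i \<notin> set p" "B i \<notin> set q" "A j \<notin> set p" "A j \<notin> set q" by auto
  from \<open>i = i' \<or> j = j'\<close> have "p = p' \<and> i = i' \<and> j = j' \<and> q = q'"
  proof
    assume "i = i'"
    then show ?thesis using w(2) d append_Cons_eq_iff[of "B i" p "A j # q" p' "A j' # q'"] by auto
  next
    assume "j = j'"
    then show ?thesis using w(2) d append_Cons_eq_iff[of "A j" "p @ [B i]" q "p' @ [B i']" q'] by auto
  qed
  then show ?thesis using s w by simp
qed

text \<open>If all pairs lie in row i, acyclicity forbids any \<open>(k, i)\<close>, so replacing
  \<open>a_i\<close> creates no pair, and replacing \<open>b_j\<close> creates pairs in row i only.
  The case of column j is dual.\<close>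

lemma single_line_reductions:
  assumes "admissible e" "split_expr e = Some (us, p, i, j, q, vs)" "single_line (ba e)"
    and "e' \<in> reductions us p i j q vs"
  shows "single_line (ba e')"
proof -
  obtain I where I: "multilinear I e" and ac: "acyclic (ba e)" using assms(1) by (auto simp: admissible_def)
  note st = ba_step[OF split_expr_SomeD[OF assms(2)] I ac]
  have mono: "single_line E'" if "single_line E" "E' \<subseteq> E" for E E'
    using that unfolding single_line_def by blast
  from assms(4) consider "e' = us @ (p @ [A j, B i] @ q) # vs"
    | s where "s = [A i, A j] \<or> s = [A j, A i]" "e' = subst (A i) s (us @ (p @ [B i] @ q) # vs)"
    | s where "s = [B i, B j] \<or> s = [B j, B i]" "e' = subst (B j) s (us @ (p @ [A j] @ q) # vs)"
    unfolding reductions_def by blast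
  then show ?thesis
  proof cases
    case 1
    then show ?thesis using mono[OF assms(3)] st(3) by simp
  next
    case (2 s)
    have "(\<forall>x\<in>ba e. fst x = i) \<or> (\<forall>x\<in>ba e. snd x = j)"
      by (rule single_line_cases[OF assms(3) st(2)])
    then show ?thesis
    proof
      assume "\<forall>x\<in>ba e. fst x = i"
      then have "(k, i) \<notin> ba e" for k using ac by (force simp: acyclic_def)
      then show ?thesis unfolding 2(2) ba_subst_A[OF 2(1)] using st(4) by (intro mono[OF assms(3)]) blast
    next
      assume "\<forall>x\<in>ba e. snd x = j"
      then have "ba e' \<subseteq> UNIV \<times> {j}" unfolding 2(2) ba_subst_A[OF 2(1)] using st(4) by fastforce
      then show ?thesis unfolding single_line_def by blast
    qed
  next
    case (3 s)
    have "(\<forall>x\<in>ba e. fst x = i) \<or> (\<forall>x\<in>ba e. snd x = j)"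
      by (rule single_line_cases[OF assms(3) st(2)])
    then show ?thesis
    proof
      assume "\<forall>x\<in>ba e. snd x = j"
      then have "(j, k) \<notin> ba e" for k using ac by (force simp: acyclic_def)
      then show ?thesis unfolding 3(2) ba_subst_B[OF 3(1)] using st(5) by (intro mono[OF assms(3)]) blast
    next
      assume "\<forall>x\<in>ba e. fst x = i"
      then have "ba e' \<subseteq> {i} \<times> UNIV" unfolding 3(2) ba_subst_B[OF 3(1)] using st(5) by fastforce
      then show ?thesis unfolding single_line_def by blast
    qed
  qed
qed

text \<open>The mirror exchanges rules (ii) and (iii) and the leftmost pair with the rightmost one.
  With at most one pair at every stage these are the same pair, and the two recursions run in
  parallel.\<close>

lemma normal_val_mirror:
  assumes "single_line (ba e)"
  shows "normal_val G (mirror e) = normal_val (\<lambda>f. G (mirror f)) e"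
  using assms
proof (induction e rule: normal_order.induct)
  case (1 e)
  show ?case
  proof (cases "admissible e")
    case False
    then show ?thesis by (simp add: normal_val_not_admissible admissible_mirror)
  next
    case adm: True
    then have adm': "admissible (mirror e)" by (simp add: admissible_mirror)
    then obtain I where I: "multilinear I (mirror e)" by (auto simp: admissible_def)
    have sl: "single_line (ba (mirror e))" using 1(6) unfolding ba_mirror single_line_def by blast
    show ?thesis
    proof (cases "split_expr e")
      case None
      then have "ba (mirror e) = {}"
        using ba_normally_ordered[OF split_expr_NoneD[OF None]] by (simp add: ba_mirror)
      moreover have "(i, j) \<in> ba (mirror e)" if "split_expr (mirror e) = Some (us, p, i, j, q, vs)"
        for us p i j q vs
        unfolding split_expr_SomeD[OF that] by (auto simp: ba_append ba_Cons ba_word_append)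
      ultimately have "split_expr (mirror e) = None" by (cases "split_expr (mirror e)") auto
      then show ?thesis using None adm adm' by (simp add: normal_val_normal)
    next
      case (Some a)
      obtain us p i j q vs where a: "a = (us, p, i, j, q, vs)" by (cases a)
      note s = Some[unfolded a]
      have "mirror e = mirror vs @ (mirror_word q @ [B j, A i] @ mirror_word p) # mirror us"
        unfolding split_expr_SomeD[OF s] by simp
      then have s': "split_expr (mirror e) =
          Some (mirror vs, mirror_word q, j, i, mirror_word p, mirror us)"
        using I sl by (intro split_expr_unique) (auto simp: multilinear_def)
      have red: "single_line (ba e')" if "e' \<in> reductions us p i j q vs" for e'
        by (rule single_line_reductions[OF adm s 1(6) that])
      note IH = 1(1-5)[OF adm s refl refl refl refl refl, OF red, unfolded reductions_def]
      show ?thesis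
        unfolding normal_val_step[OF adm s] normal_val_step[OF adm' s']
        by (simp add: IH[symmetric] mirror_subst del: append.simps, simp)
    qed
  qed
qed

lemma mirror_normal_on: "mirror ` normal_on n J = normal_on n J"
proof -
  have *: "mirror e \<in> normal_on n J" if "e \<in> normal_on n J" for e
  proof -
    have "normally_ordered (mirror e)"
      unfolding normally_ordered_def
    proof
      fix w assume "w \<in> set (mirror e)"
      then obtain v where "v \<in> set e" "w = mirror_word v" by (auto simp: mirror_def)
      moreover have "normally_ordered e" using that by (simp add: normal_on_def)
      ultimately obtain p q where "w = mirror_word v" "v = map A p @ map B q"
        unfolding normally_ordered_def by blast
      then have "w = map A (rev q) @ map B (rev p)" by simp
      then show "\<exists>p q. w = map A p @ map B q" by blast
    qed
    then show ?thesis using that multilinear_mirror by (simp add: normal_on_def)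
  qed
  show ?thesis
  proof
    show "normal_on n J \<subseteq> mirror ` normal_on n J"
      using * by (metis image_eqI mirror_simps(4) subsetI)
  qed (use * in auto)
qed

lemma mirror_renumber: "mirror (renumber \<sigma> e) = renumber \<sigma> (mirror e)"
proof -
  have l: "mirror_letter (renumber_letter \<sigma> x) = renumber_letter \<sigma> (mirror_letter x)" for x
    by (cases x) auto
  have "mirror_word (map (renumber_letter \<sigma>) w) = map (renumber_letter \<sigma>) (mirror_word w)" for w
    by (induction w) (auto simp: l)
  then show ?thesis by (induction e) auto
qed

definition mirror_linear_val :: "(expr \<Rightarrow> 'k::field_char_0) \<Rightarrow> nat \<Rightarrow> expr \<Rightarrow> 'k" where
  "mirror_linear_val G j w =
     normal_val G (juxtapose (insert_expr 1 2 w) (r_expr 2 3 j))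
   + normal_val G (juxtapose (insert_expr 1 3 w) (r_expr 2 3 j))
   - normal_val G (juxtapose (r_expr 2 3 j) (insert_expr 1 3 w))
   - normal_val G (juxtapose (r_expr 2 3 j) (insert_expr 1 2 w))
   + normal_val G (juxtapose (insert_expr 1 2 w) (r_expr 1 3 j))
   - normal_val G (juxtapose (insert_expr 1 3 w) (r_expr 1 2 j))"

text \<open>One factor of each of the six products is r, with its single label j, so every pair that
  has to be reordered lies in row j or in column j.\<close>

lemma mirror_linear_val_mirror:
  assumes "w \<in> normal_on 2 J"
  shows "mirror_linear_val G j (mirror w) = linear_val (\<lambda>f. G (mirror f)) j w"
proof -
  obtain P Q S T where w: "w = [map A P @ map B Q, map A S @ map B T]"
    using assms unfolding normal_on_2_iff by blast
  define u v where uv: "u = map A P @ map B Q" "v = map A S @ map B T"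
  have b: "ba_word (A j # u) = {}" "ba_word (A j # v) = {}" "ba_word u = {}" "ba_word v = {}"
    by (simp_all add: uv ba_word_append)
  have b1: "ba_word (x @ [A j]) \<subseteq> UNIV \<times> {j}" if "ba_word x = {}" for x
    using that by (auto simp: ba_word_append)
  have b2: "ba_word (B j # x) \<subseteq> {j} \<times> UNIV" if "ba_word x = {}" for x
    using that by auto
  have 1: "single_line (ba [A j # u, [B j], v])" "single_line (ba [[A j], u @ [B j], v])"
    by (simp_all add: ba_def b single_line_def ba_word_append)
  have 2: "single_line (ba [u @ [A j], [B j], v])"
    using b1[OF b(3)] by (auto simp: ba_def b single_line_def)
  have 3: "single_line (ba [[A j], B j # u, v])" "single_line (ba [[A j], u, B j # v])"
      "single_line (ba [u, [A j], B j # v])"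
    using b2[OF b(3)] b2[OF b(4)] by (auto simp: ba_def b single_line_def)
  have "linear_val (\<lambda>f. G (mirror f)) j w =
     normal_val G (mirror [A j # u, [B j], v]) - normal_val G (mirror [u @ [A j], [B j], v])
   + normal_val G (mirror [[A j], B j # u, v]) - normal_val G (mirror [[A j], u @ [B j], v])
   + normal_val G (mirror [[A j], u, B j # v]) - normal_val G (mirror [u, [A j], B j # v])"
    unfolding w uv[symmetric] linear_val_eq by (simp only: normal_val_mirror 1 2 3)
  also have "\<dots> = mirror_linear_val G j (mirror w)"
    unfolding w uv[symmetric] by (simp add: mirror_linear_val_def r_expr_def juxtapose_def)
  finally show ?thesis by simp
qed

section \<open>From the universal algebra to labelled expressions\<close>

lemma Abs_univ_linear:
  fixes x y :: "'k::field_char_0 comb"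
  shows "Abs_univ 0 = (0 :: 'k univ)" "Abs_univ (x + y) = Abs_univ x + Abs_univ y"
    "Abs_univ (x - y) = Abs_univ x - Abs_univ y" "Abs_univ (cscale c x) = uscale c (Abs_univ x)"
  by (simp_all add: zero_univ_def plus_univ.abs_eq minus_univ.abs_eq uscale.abs_eq)

lemma Abs_univ_sum: "Abs_univ (sum f I) = (\<Sum>i\<in>I. Abs_univ (f i))"
  by (induction I rule: infinite_finite_induct) (auto simp: Abs_univ_linear)

lemma Abs_univ_eq_iff: "Abs_univ x = Abs_univ y \<longleftrightarrow> x - y \<in> renumber_diffs"
  by (rule univ.abs_eq_iff)

lemma comb_eq_sum:
  "x = (\<Sum>e\<in>Poly_Mapping.keys x. cscale (Poly_Mapping.lookup x e) (single_expr e))"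
proof (rule poly_mapping_eqI)
  fix f
  show "Poly_Mapping.lookup x f =
      Poly_Mapping.lookup (\<Sum>e\<in>Poly_Mapping.keys x. cscale (Poly_Mapping.lookup x e) (single_expr e)) f"
    by (simp add: lookup_sum lookup_single when_def in_keys_iff
        if_distrib[of "\<lambda>c. _ * c"] cong: if_cong)
qed

lemma Abs_univ_in_span:
  assumes "\<And>e. e \<in> Poly_Mapping.keys x \<Longrightarrow> e \<in> X"
  shows "Abs_univ x \<in> univ.span (expr_class ` X)"
proof -
  have "Abs_univ x = (\<Sum>e\<in>Poly_Mapping.keys x. uscale (Poly_Mapping.lookup x e) (expr_class e))"
    by (subst comb_eq_sum) (simp add: Abs_univ_sum Abs_univ_linear expr_class.abs_eq)
  also have "\<dots> \<in> univ.span (expr_class ` X)"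
    using assms by (intro univ.span_sum univ.span_scale univ.span_base imageI)
  finally show ?thesis .
qed

lemma lin_val_renumber_diffs:
  assumes "\<And>\<sigma> e. bij \<sigma> \<Longrightarrow> G (renumber \<sigma> e) = G e" "z \<in> renumber_diffs"
  shows "lin_val G z = 0"
  using assms(2)[unfolded renumber_diffs_def]
proof (induction rule: comb.span_induct)
  case base
  show ?case by (auto simp: comb.subspace_def lin_val_add lin_val_cscale)
next
  case (step z)
  then show ?case by (auto simp: lin_val_diff assms(1))
qed

definition renumbering :: "expr \<Rightarrow> expr \<Rightarrow> bool" where
  "renumbering e f \<longleftrightarrow> (\<exists>\<sigma>. bij \<sigma> \<and> f = renumber \<sigma> e)"

lemma renumbering_renumber:
  assumes "bij \<sigma>"
  shows "renumbering e (renumber \<sigma> f) \<longleftrightarrow> renumbering e f"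
proof
  assume "renumbering e f"
  then obtain \<tau> where \<tau>: "bij \<tau>" "f = renumber \<tau> e" unfolding renumbering_def by blast
  then have "renumber \<sigma> f = renumber (\<sigma> \<circ> \<tau>) e" by (simp add: renumber_renumber)
  then show "renumbering e (renumber \<sigma> f)"
    using bij_comp[OF \<tau>(1) assms] unfolding renumbering_def by blast
next
  assume "renumbering e (renumber \<sigma> f)"
  then obtain \<tau> where \<tau>: "bij \<tau>" "renumber \<sigma> f = renumber \<tau> e" unfolding renumbering_def by blast
  have "f = renumber (inv \<sigma>) (renumber \<sigma> f)"
    using assms by (simp add: renumber_renumber bij_is_inj)
  also have "\<dots> = renumber (inv \<sigma> \<circ> \<tau>) e" by (simp add: \<tau>(2) renumber_renumber)
  finally show "renumbering e f"
    using bij_comp[OF \<tau>(1) bij_imp_bij_inv[OF assms]] unfolding renumbering_def by blast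
qed

text \<open>The coefficient of one expression makes no sense on coinvariants, but the sum of the
  coefficients over its orbit does.\<close>

lift_definition orbit_coeff :: "expr \<Rightarrow> 'k::field_char_0 univ \<Rightarrow> 'k" is
  "\<lambda>e x. lin_val (\<lambda>f. of_bool (renumbering e f)) x"
proof -
  fix e and x y :: "'k comb"
  assume "x - y \<in> renumber_diffs"
  then have "lin_val (\<lambda>f. of_bool (renumbering e f)) (x - y) = 0"
    by (rule lin_val_renumber_diffs[rotated]) (simp add: renumbering_renumber)
  then show "lin_val (\<lambda>f. of_bool (renumbering e f)) x = lin_val (\<lambda>f. of_bool (renumbering e f)) y"
    by (simp add: lin_val_diff)
qed

lemma orbit_coeff_linear:
  "orbit_coeff e (x + y) = orbit_coeff e x + orbit_coeff e y"
  "orbit_coeff e (uscale c x) = c * orbit_coeff e x" "orbit_coeff e 0 = 0"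
  by (transfer; simp add: lin_val_add lin_val_cscale)+

lemma orbit_coeff_span:
  assumes "x \<in> univ.span (expr_class ` X)" "\<And>f. f \<in> X \<Longrightarrow> \<not> renumbering e f"
  shows "orbit_coeff e x = 0"
  using assms(1)
proof (induction rule: univ.span_induct)
  case base
  show ?case by (auto simp: univ.subspace_def orbit_coeff_linear)
next
  case (step x)
  then obtain f where "f \<in> X" "x = expr_class f" by blast
  then show ?case using assms(2) by (simp add: expr_class.abs_eq orbit_coeff.abs_eq)
qed

text \<open>The coefficient of a class is shared equally among its normally ordered representatives,
  which uses characteristic 0. As F depends on the class only, its invariance is immediate and it
  has a value on expressions with any labels; on classes without a representative in
  \<open>normal_exprs n N\<close> the division by 0 gives 0.\<close>

lemma U_coefficients:
  assumes "x \<in> U n N"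
  obtains F where "\<And>\<sigma> e. bij \<sigma> \<Longrightarrow> F (renumber \<sigma> e) = F e"
    and "x = (\<Sum>v\<in>normal_exprs n N. uscale (F v) (expr_class v))"
proof -
  let ?V = "normal_exprs n N"
  have fin: "finite ?V" unfolding normal_exprs_eq by (rule finite_normal_on) simp
  then have "univ.span (expr_class ` ?V :: 'a univ set) =
      range (\<lambda>u. \<Sum>c\<in>expr_class ` ?V. uscale (u c) c)"
    by (intro univ.span_finite) simp
  then obtain u where u: "x = (\<Sum>c\<in>expr_class ` ?V. uscale (u c) c)"
    using assms unfolding U_def by blast
  define m where "m c = card {v \<in> ?V. expr_class v = c}" for c :: "'a univ"
  define F where "F e = u (expr_class e) / of_nat (m (expr_class e))" for e
  have *: "uscale (u c) c = (\<Sum>v\<in>{v \<in> ?V. expr_class v = c}. uscale (F v) (expr_class v))"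
    if "c \<in> expr_class ` ?V" for c
  proof -
    have "m c \<noteq> 0" using that fin by (auto simp: m_def)
    then have "of_nat (m c) * (u c / of_nat (m c)) = u c" by simp
    moreover have "(\<Sum>v\<in>{v \<in> ?V. expr_class v = c}. uscale (F v) (expr_class v)) =
        (\<Sum>v\<in>{v \<in> ?V. expr_class v = c}. uscale (u c / of_nat (m c)) c)"
      by (intro sum.cong) (auto simp: F_def)
    moreover have "\<dots> = uscale (\<Sum>v\<in>{v \<in> ?V. expr_class v = c}. u c / of_nat (m c)) c"
      by (simp only: univ.scale_sum_left)
    ultimately show ?thesis by (simp add: m_def)
  qed
  have "x = (\<Sum>c\<in>(expr_class ` ?V :: 'a univ set). \<Sum>v\<in>{v \<in> ?V. expr_class v = c}. uscale (F v) (expr_class v))"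
    unfolding u
  proof (rule sum.cong[OF refl])
    fix c :: "'a univ" assume "c \<in> expr_class ` ?V"
    then show "uscale (u c) c = (\<Sum>v\<in>{v \<in> ?V. expr_class v = c}. uscale (F v) (expr_class v))"
      by (rule *)
  qed
  also have "\<dots> = (\<Sum>v\<in>?V. uscale (F v) (expr_class v))"
    by (rule sum.image_gen[OF fin, symmetric])
  finally have "x = (\<Sum>v\<in>?V. uscale (F v) (expr_class v))" .
  moreover have "F (renumber \<sigma> e) = F e" if "bij \<sigma>" for \<sigma> e
    using that by (simp add: F_def expr_class_renumber)
  ultimately show ?thesis using that by blast
qed

lemma keys_span:
  assumes "(x :: 'k::field_char_0 comb) \<in> comb.span (single_expr ` S)" "f \<in> Poly_Mapping.keys x"
  shows "f \<in> S"
proof -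
  have "\<forall>f. f \<notin> S \<longrightarrow> Poly_Mapping.lookup x f = 0"
    using assms(1)
  proof (induction rule: comb.span_induct)
    case base
    show ?case by (auto simp: comb.subspace_def lookup_add)
  next
    case (step x)
    then show ?case by (auto simp: lookup_single when_def)
  qed
  then show ?thesis using assms(2) by (auto simp: in_keys_iff)
qed

lemma keys_normal_order:
  assumes "f \<in> Poly_Mapping.keys (normal_order e :: 'k::field_char_0 comb)"
  shows "length f = length e" "set (concat f) = set (concat e)"
proof -
  have "admissible e"
  proof (rule ccontr)
    assume "\<not> admissible e"
    then have "normal_order e = (0 :: 'k comb)" by (simp add: normal_order.simps)
    then show False using assms by simp
  qed
  then obtain I where I: "multilinear I e" "acyclic (ba e)" by (auto simp: admissible_def)
  from keys_span[OF normal_order_in_span[OF this] assms]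
  show "length f = length e" "set (concat f) = set (concat e)"
    using I(1) by (auto simp: multilinear_def)
qed

text \<open>A coefficient of the normal form is the value of an indicator functional, so an
  invariant of the rewriting restricts the expressions that occur in it.\<close>

lemma keys_stable:
  assumes "f \<in> Poly_Mapping.keys (normal_order e :: 'k::field_char_0 comb)"
    and "stable_word W" "k < length e" "W (e ! k)"
  shows "W (f ! k)"
proof (rule ccontr)
  assume "\<not> W (f ! k)"
  then have "normal_val (\<lambda>g. of_bool (g = f)) e = (0 :: 'k)"
    using normal_val_stable[OF assms(2-4), of "\<lambda>g. of_bool (g = f)"] by auto
  then show False using assms(1) by (simp add: normal_val_def flip: lookup_eq_lin_val add: in_keys_iff)
qed

lemma renumber_normal_on:
  assumes "bij \<sigma>"
  shows "renumber \<sigma> ` normal_on n J = normal_on n (\<sigma> ` J)"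
proof -
  have *: "renumber \<tau> e \<in> normal_on n (\<tau> ` K)" if "bij \<tau>" "e \<in> normal_on n K" for \<tau> e K
    using that multilinear_renumber[OF bij_is_inj] normally_ordered_renumber
    by (auto simp: normal_on_def)
  show ?thesis
  proof
    show "normal_on n (\<sigma> ` J) \<subseteq> renumber \<sigma> ` normal_on n J"
    proof
      fix e assume e: "e \<in> normal_on n (\<sigma> ` J)"
      have "inv \<sigma> ` \<sigma> ` J = J" using assms by (simp add: image_comp bij_is_inj)
      then have "renumber (inv \<sigma>) e \<in> normal_on n J" using *[OF bij_imp_bij_inv[OF assms] e] by simp
      moreover have "e = renumber \<sigma> (renumber (inv \<sigma>) e)"
        using bij_is_surj[OF assms] by (simp add: renumber_renumber surj_iff)
      ultimately show "e \<in> renumber \<sigma> ` normal_on n J" by blast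
    qed
  qed (use *[OF assms] in auto)
qed

lemma inj_renumber: "bij \<sigma> \<Longrightarrow> inj_on (renumber \<sigma>) X"
proof (rule inj_onI)
  fix x y assume "bij \<sigma>" "renumber \<sigma> x = renumber \<sigma> y"
  then have "renumber (inv \<sigma>) (renumber \<sigma> x) = renumber (inv \<sigma>) (renumber \<sigma> y)" by simp
  then show "x = y" using \<open>bij \<sigma>\<close> by (simp add: renumber_renumber bij_is_inj)
qed

lemma set_concat_renumber:
  "set (concat e) = A ` I \<union> B ` I \<Longrightarrow> set (concat (renumber \<sigma> e)) = A ` \<sigma> ` I \<union> B ` \<sigma> ` I"
  by (simp add: concat_renumber image_Un image_image)

lemma letters_eq_iff: "A ` I \<union> B ` I = A ` J \<union> B ` J \<longleftrightarrow> I = J"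
proof
  assume eq: "A ` I \<union> B ` I = A ` J \<union> B ` J"
  have "I = {x. A x \<in> A ` I \<union> B ` I}" by auto
  also have "\<dots> = {x. A x \<in> A ` J \<union> B ` J}" by (simp only: eq)
  also have "\<dots> = J" by auto
  finally show "I = J" .
qed simp

text \<open>
  Summing over all choices \<open>j\<close> of the label of \<open>r\<close> makes the combination invariant under permutations
  of the labels, so that its coefficients can be read off from its class.
\<close>

lemma labelled_equation_of_span:
  fixes F :: "expr \<Rightarrow> 'k::field_char_0" and t :: "nat \<Rightarrow> expr \<Rightarrow> 'k comb"
  assumes F: "\<And>\<sigma> e. bij \<sigma> \<Longrightarrow> F (renumber \<sigma> e) = F e"
    and b: "\<And>v \<tau> j. v \<in> normal_on 2 {1..N} \<Longrightarrow> bij \<tau> \<Longrightarrow> j \<notin> \<tau> ` {1..N} \<Longrightarrow>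
      b v = Abs_univ (t j (renumber \<tau> v))"
    and span: "(\<Sum>v\<in>normal_exprs 2 N. uscale (F v) (b v)) \<in> univ.span (expr_class ` X)"
    and X: "\<And>\<sigma> e. bij \<sigma> \<Longrightarrow> e \<in> X \<Longrightarrow> renumber \<sigma> e \<in> X"
    and t: "\<And>\<sigma> G j w. bij \<sigma> \<Longrightarrow>
      lin_val G (t (\<sigma> j) (renumber \<sigma> w)) = lin_val (\<lambda>f. G (renumber \<sigma> f)) (t j w)"
    and t_set: "\<And>j w f K. w \<in> normal_on 2 K \<Longrightarrow> f \<in> Poly_Mapping.keys (t j w) \<Longrightarrow>
      set (concat f) = A ` insert j K \<union> B ` insert j K"
    and I: "finite I" "card I = Suc N" and G: "\<And>e. e \<in> X \<Longrightarrow> G e = 0"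
  shows "(\<Sum>j\<in>I. \<Sum>w\<in>normal_on 2 (I - {j}). F w * lin_val G (t j w)) = 0"
proof -
  define Z where "Z = (\<Sum>v\<in>normal_exprs 2 N. uscale (F v) (b v))"
  define x where "x = (\<Sum>j\<in>I. \<Sum>w\<in>normal_on 2 (I - {j}). cscale (F w) (t j w))"
  have val: "lin_val H x = (\<Sum>j\<in>I. \<Sum>w\<in>normal_on 2 (I - {j}). F w * lin_val H (t j w))" for H
    by (simp add: x_def lin_val_sum lin_val_cscale)
  have "(\<Sum>w\<in>normal_on 2 (I - {j}). uscale (F w) (Abs_univ (t j w))) = Z" if "j \<in> I" for j
  proof -
    have "card {1..N} = card (I - {j})" using I that by simp
    then obtain f where f: "bij_betw f {1..N} (I - {j})"
      using finite_same_card_bij[of "{1..N}" "I - {j}"] I(1) by auto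
    then obtain \<tau> where \<tau>: "bij \<tau>" "\<And>k. k \<in> {1..N} \<Longrightarrow> \<tau> k = f k"
      using bij_extension[of "{1..N}" f] bij_betw_imp_inj_on by blast
    have img: "\<tau> ` {1..N} = I - {j}" using f \<tau>(2) by (simp add: bij_betw_def)
    have "(\<Sum>w\<in>normal_on 2 (I - {j}). uscale (F w) (Abs_univ (t j w))) =
        (\<Sum>v\<in>normal_on 2 {1..N}. uscale (F (renumber \<tau> v)) (Abs_univ (t j (renumber \<tau> v))))"
      unfolding img[symmetric] renumber_normal_on[OF \<tau>(1), symmetric]
      by (subst sum.reindex[OF inj_renumber[OF \<tau>(1)]]) simp
    also have "\<dots> = Z"
      unfolding Z_def normal_exprs_eq using img
      by (intro sum.cong refl) (simp add: F[OF \<tau>(1)] b[OF _ \<tau>(1), of _ j])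
    finally show ?thesis .
  qed
  then have "Abs_univ x = (\<Sum>j\<in>I. Z)"
    by (simp add: x_def Abs_univ_sum Abs_univ_linear)
  also have "\<dots> \<in> univ.span (expr_class ` X)"
    using span by (intro univ.span_sum) (simp add: Z_def)
  finally have Abs_x: "Abs_univ x \<in> univ.span (expr_class ` X)" .
  have key_set: "set (concat f) = A ` I \<union> B ` I" if "f \<in> Poly_Mapping.keys x" for f
  proof -
    have "\<exists>j\<in>I. \<exists>w\<in>normal_on 2 (I - {j}). f \<in> Poly_Mapping.keys (t j w)"
    proof (rule ccontr)
      assume "\<not> ?thesis"
      then have "Poly_Mapping.lookup x f = 0" by (simp add: x_def lookup_sum in_keys_iff)
      then show False using that by (simp add: in_keys_iff)
    qed
    then obtain j w where "j \<in> I" "w \<in> normal_on 2 (I - {j})" "f \<in> Poly_Mapping.keys (t j w)" by blast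
    then show ?thesis using t_set[of w "I - {j}" f j] by (simp add: insert_absorb)
  qed
  have invariant: "Poly_Mapping.lookup x (renumber \<sigma> e) = Poly_Mapping.lookup x e"
    if \<sigma>: "bij \<sigma>" "\<sigma> ` I = I" for \<sigma> e
  proof -
    let ?h = "\<lambda>j w. F w * lin_val (\<lambda>f. of_bool (f = renumber \<sigma> e)) (t j w)"
    have eq: "renumber \<sigma> f = renumber \<sigma> e \<longleftrightarrow> f = e" for f
      using inj_renumber[OF \<sigma>(1), of UNIV] by (simp add: inj_eq)
    have "Poly_Mapping.lookup x (renumber \<sigma> e) = (\<Sum>j\<in>I. \<Sum>w\<in>normal_on 2 (I - {j}). ?h j w)"
      unfolding lookup_eq_lin_val val ..
    also have "\<dots> = (\<Sum>j\<in>\<sigma> ` I. \<Sum>w\<in>normal_on 2 (I - {j}). ?h j w)" by (simp add: \<sigma>(2))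
    also have "\<dots> = (\<Sum>j\<in>I. \<Sum>w\<in>normal_on 2 (I - {\<sigma> j}). ?h (\<sigma> j) w)"
      using \<sigma>(1) by (subst sum.reindex) (auto intro: inj_on_subset[OF bij_is_inj])
    also have "\<dots> = (\<Sum>j\<in>I. \<Sum>w\<in>normal_on 2 (I - {j}). ?h (\<sigma> j) (renumber \<sigma> w))"
    proof (rule sum.cong[OF refl])
      fix j assume "j \<in> I"
      have "\<sigma> ` (I - {j}) = I - {\<sigma> j}"
        using \<sigma>(2) image_set_diff[OF bij_is_inj[OF \<sigma>(1)], of I "{j}"] by simp
      then show "(\<Sum>w\<in>normal_on 2 (I - {\<sigma> j}). ?h (\<sigma> j) w) =
          (\<Sum>w\<in>normal_on 2 (I - {j}). ?h (\<sigma> j) (renumber \<sigma> w))"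
        using renumber_normal_on[OF \<sigma>(1), of 2 "I - {j}"]
        by (metis (no_types, lifting) inj_renumber[OF \<sigma>(1)] sum.cong sum.reindex_cong)
    qed
    also have "\<dots> = (\<Sum>j\<in>I. \<Sum>w\<in>normal_on 2 (I - {j}). F w * lin_val (\<lambda>f. of_bool (f = e)) (t j w))"
      by (simp add: F[OF \<sigma>(1)] t[OF \<sigma>(1)] eq)
    also have "\<dots> = Poly_Mapping.lookup x e" unfolding lookup_eq_lin_val val ..
    finally show ?thesis .
  qed
  have keys_X: "e \<in> X" if e: "e \<in> Poly_Mapping.keys x" for e
  proof (rule ccontr)
    assume "e \<notin> X"
    have "\<not> renumbering e f" if "f \<in> X" for f
    proof
      assume "renumbering e f"
      then obtain \<sigma> where \<sigma>: "bij \<sigma>" "f = renumber \<sigma> e" unfolding renumbering_def by blast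
      then have "e = renumber (inv \<sigma>) f" by (simp add: renumber_renumber bij_is_inj)
      then show False using X[OF bij_imp_bij_inv[OF \<sigma>(1)] \<open>f \<in> X\<close>] \<open>e \<notin> X\<close> by simp
    qed
    then have "orbit_coeff e (Abs_univ x) = 0" by (rule orbit_coeff_span[OF Abs_x])
    \<comment> \<open>All renumberings of e among the keys of x have the label set I and, by
      \<open>invariant\<close>, the same coefficient as e. The orbit sum is thus a positive integer
      multiple of this coefficient and can vanish only together with it.\<close>
    then have "0 = lin_val (\<lambda>f. of_bool (renumbering e f)) x" by (simp add: orbit_coeff.abs_eq)
    also have "\<dots> = (\<Sum>f\<in>{f \<in> Poly_Mapping.keys x. renumbering e f}. Poly_Mapping.lookup x f)"
      by (simp add: lin_val_def Int_def)
    also have "\<dots> = (\<Sum>f\<in>{f \<in> Poly_Mapping.keys x. renumbering e f}. Poly_Mapping.lookup x e)"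
    proof (rule sum.cong[OF refl])
      fix f assume f: "f \<in> {f \<in> Poly_Mapping.keys x. renumbering e f}"
      then obtain \<sigma> where \<sigma>: "bij \<sigma>" "f = renumber \<sigma> e" unfolding renumbering_def by blast
      have "A ` \<sigma> ` I \<union> B ` \<sigma> ` I = A ` I \<union> B ` I"
        using key_set[of f] set_concat_renumber[OF key_set[OF e], of \<sigma>] f \<sigma>(2) by simp
      then have "\<sigma> ` I = I" unfolding letters_eq_iff .
      then show "Poly_Mapping.lookup x f = Poly_Mapping.lookup x e" unfolding \<sigma>(2) by (rule invariant[OF \<sigma>(1)])
    qed
    also have "\<dots> = of_nat (card {f \<in> Poly_Mapping.keys x. renumbering e f}) * Poly_Mapping.lookup x e"
      by simp
    finally have "card {f \<in> Poly_Mapping.keys x. renumbering e f} = 0"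
      using e by (simp add: in_keys_iff)
    moreover have "renumbering e e" unfolding renumbering_def by (intro exI[of _ id]) simp
    ultimately show False using e by simp
  qed
  have "lin_val G x = 0" unfolding lin_val_def using keys_X G by (intro sum.neutral) simp
  then show ?thesis by (simp add: val)
qed

text \<open>The even and odd labels in the product are one choice among many: any other disjoint
  labelling is obtained from it by a bijection \<rho>, and normal ordering respects renumbering up
  to the relations of the quotient.\<close>

lemma umult_labelled:
  assumes e: "multilinear K e" "multilinear L f" "finite K" "finite L"
    and inj: "inj_on \<sigma> K" "inj_on \<tau> L" "\<sigma> ` K \<inter> \<tau> ` L = {}"
  shows "umult (expr_class e) (expr_class f) =
    Abs_univ (normal_order (juxtapose (renumber \<sigma> e) (renumber \<tau> f)) :: 'k::field_char_0 comb)"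
proof -
  define g where "g k = (if even k then \<sigma> (k div 2) else \<tau> (k div 2))" for k
  let ?M = "(\<lambda>k. 2 * k) ` K \<union> (\<lambda>k. 2 * k + 1) ` L"
  have "inj_on g ?M"
  proof (rule inj_onI)
    fix x y assume x: "x \<in> ?M" and y: "y \<in> ?M" and eq: "g x = g y"
    have *: "even z \<and> z div 2 \<in> K \<and> g z = \<sigma> (z div 2) \<or> odd z \<and> z div 2 \<in> L \<and> g z = \<tau> (z div 2)"
      if "z \<in> ?M" for z using that by (auto simp: g_def)
    from *[OF x] *[OF y] have "(even x \<longleftrightarrow> even y) \<and> x div 2 = y div 2"
    proof (elim disjE conjE)
      assume "x div 2 \<in> K" "y div 2 \<in> L" "g x = \<sigma> (x div 2)" "g y = \<tau> (y div 2)"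
      then show ?thesis using eq inj(3) by (metis IntI empty_iff image_eqI)
    next
      assume "x div 2 \<in> L" "y div 2 \<in> K" "g x = \<tau> (x div 2)" "g y = \<sigma> (y div 2)"
      then show ?thesis using eq inj(3) by (metis IntI empty_iff image_eqI)
    qed (use eq inj(1,2) in \<open>auto dest: inj_onD\<close>)
    then show "x = y" by (metis div_mult_mod_eq parity_cases)
  qed
  then obtain \<rho> where \<rho>: "bij \<rho>" "\<And>k. k \<in> ?M \<Longrightarrow> \<rho> k = g k"
    using bij_extension[of ?M g] e(3,4) by auto
  have "renumber \<rho> (renumber (\<lambda>k. 2 * k) e) = renumber \<sigma> e"
    unfolding renumber_renumber using \<rho>(2) by (intro renumber_cong[OF e(1)]) (auto simp: g_def)
  moreover have "renumber \<rho> (renumber (\<lambda>k. 2 * k + 1) f) = renumber \<tau> f"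
    unfolding renumber_renumber using \<rho>(2) by (intro renumber_cong[OF e(2)]) (auto simp: g_def)
  ultimately have "juxtapose (renumber \<sigma> e) (renumber \<tau> f) =
      renumber \<rho> (juxtapose (renumber (\<lambda>k. 2 * k) e) (renumber (\<lambda>k. 2 * k + 1) f))"
    by (simp only: renumber_juxtapose)
  then show ?thesis
    using normal_order_renumber[OF \<rho>(1)] unfolding umult_expr_class mult_expr_def
    by (metis Abs_univ_eq_iff)
qed

section \<open>Products, the unit and insertions in the quotient\<close>

lemma uinsert_linear:
  "uinsert i k (x + y) = uinsert i k x + uinsert i k y"
  "uinsert i k (uscale c x) = uscale c (uinsert i k x)" "uinsert i k 0 = 0"
  by (transfer; simp add: lin_ext_add lin_ext_cscale renumber_diffs_intros)+

lemma uinsert_expr_class: "uinsert i k (expr_class e) = expr_class (insert_expr i k e)"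
  by (simp add: expr_class.abs_eq uinsert.abs_eq)

lemma umult_diff: "umult (x - x') y = umult x y - umult x' y"
proof -
  have "umult ((x - x') + x') y = umult (x - x') y + umult x' y" by (rule umult_linear)
  then show ?thesis by simp
qed

lemma span_expr_class_linear:
  assumes "x \<in> univ.span (expr_class ` S)" "univ.subspace V" "\<And>e. e \<in> S \<Longrightarrow> h (expr_class e) \<in> V"
    and "\<And>x y. h (x + y) = h x + h y" "\<And>c x. h (uscale c x) = uscale c (h x)" "h 0 = 0"
  shows "h x \<in> V"
  using assms(1)
proof (induction rule: univ.span_induct)
  case base
  show ?case
    using assms(4-) univ.subspace_0[OF assms(2)] univ.subspace_add[OF assms(2)]
      univ.subspace_scale[OF assms(2)]
    by (auto simp: univ.subspace_def)
qed (use assms(3) in auto)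

lemma umult_span:
  assumes "x \<in> univ.span (expr_class ` S)" "y \<in> univ.span (expr_class ` T)" "univ.subspace V"
    and "\<And>u v. u \<in> S \<Longrightarrow> v \<in> T \<Longrightarrow> umult (expr_class u) (expr_class v) \<in> V"
  shows "umult x y \<in> V"
proof (rule span_expr_class_linear[OF assms(1,3), of "\<lambda>x. umult x y"])
  fix u assume "u \<in> S"
  then show "umult (expr_class u) y \<in> V"
    using assms(4) by (intro span_expr_class_linear[OF assms(2,3), of "umult (expr_class u)"])
      (auto simp: umult_linear)
qed (auto simp: umult_linear)

definition ternary :: "nat \<Rightarrow> (letter list \<Rightarrow> bool) \<Rightarrow> expr set" where
  "ternary k W = {e. length e = 3 \<and> W (e ! k)}"

lemma umult_ternary:
  assumes "stable_word W" "k < 3" "x \<in> univ.span (expr_class ` ternary k W1)"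
    "y \<in> univ.span (expr_class ` ternary k W2)"
    and W: "\<And>u v. W1 u \<Longrightarrow> W2 v \<Longrightarrow>
      W (map (renumber_letter (\<lambda>k. 2 * k)) u @ map (renumber_letter (\<lambda>k. 2 * k + 1)) v)"
  shows "umult x y \<in> univ.span (expr_class ` ternary k W)"
proof (rule umult_span[OF assms(3,4)])
  fix u v assume u: "u \<in> ternary k W1" and v: "v \<in> ternary k W2"
  let ?e = "juxtapose (renumber (\<lambda>k. 2 * k) u) (renumber (\<lambda>k. 2 * k + 1) v)"
  have len: "length ?e = 3" using u v by (simp add: ternary_def juxtapose_def)
  have "?e ! k = map (renumber_letter (\<lambda>k. 2 * k)) (u ! k) @ map (renumber_letter (\<lambda>k. 2 * k + 1)) (v ! k)"
    using u v assms(2) by (simp add: ternary_def juxtapose_def renumber_def)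
  then have We: "W (?e ! k)" using u v W by (simp add: ternary_def)
  show "umult (expr_class u) (expr_class v) \<in> univ.span (expr_class ` ternary k W)"
    unfolding umult_expr_class mult_expr_def
  proof (rule Abs_univ_in_span)
    fix f assume f: "f \<in> Poly_Mapping.keys (normal_order ?e)"
    have "W (f ! k)" by (rule keys_stable[OF f assms(1)]) (use len We assms(2) in auto)
    moreover have "length f = 3" using keys_normal_order(1)[OF f] len by simp
    ultimately show "f \<in> ternary k W" by (simp add: ternary_def)
  qed
qed simp

lemma split_expr_normal: "normally_ordered e \<Longrightarrow> split_expr e = None"
proof (rule ccontr)
  assume "normally_ordered e" "split_expr e \<noteq> None"
  then obtain us p i j q vs where "split_expr e = Some (us, p, i, j, q, vs)" by auto
  then have "(i, j) \<in> ba e"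
    by (auto dest!: split_expr_SomeD simp: ba_append ba_Cons ba_word_append)
  then show False using ba_normally_ordered[OF \<open>normally_ordered e\<close>] by simp
qed

lemma normal_order_normal:
  "normally_ordered e \<Longrightarrow> multilinear I e \<Longrightarrow> normal_order e = single_expr e"
  using admissibleI[of I e "{}" "{}"]
  by (subst normal_order.simps) (simp add: split_expr_normal ba_normally_ordered)

abbreviation unit3 :: "'k::field_char_0 univ" where
  "unit3 \<equiv> expr_class [[], [], []]"

lemma umult_unit:
  assumes "x \<in> U 3 N"
  shows "umult unit3 x = x" "umult x unit3 = x"
proof -
  have u: "multilinear {} [[], [], []]" by (simp add: multilinear_def)
  have j: "juxtapose [[], [], []] e = e" "juxtapose e [[], [], []] = e" if "length e = 3" for e
    using that by (auto simp: juxtapose_def numeral_3_eq_3 length_Suc_conv)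
  have r: "renumber \<sigma> [[], [], []] = [[], [], []]" for \<sigma> by simp
  have base: "umult unit3 (expr_class e) = (expr_class e :: 'a univ)"
      "umult (expr_class e) unit3 = (expr_class e :: 'a univ)" if "e \<in> normal_exprs 3 N" for e
  proof -
    have e: "multilinear {1..N} e" "length e = 3" "normally_ordered e"
      using that by (simp_all add: normal_exprs_def)
    show "umult unit3 (expr_class e) = (expr_class e :: 'a univ)"
      using umult_labelled[OF u e(1), of id id] e
      by (simp add: j r normal_order_normal expr_class.abs_eq del: renumber_Cons)
    show "umult (expr_class e) unit3 = (expr_class e :: 'a univ)"
      using umult_labelled[OF e(1) u, of id id] e
      by (simp add: j r normal_order_normal expr_class.abs_eq del: renumber_Cons)
  qed
  have sub: "univ.subspace {0}" by (simp add: univ.subspace_def)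
  have "umult unit3 x - x \<in> {0}"
    using assms unfolding U_def
    by (rule span_expr_class_linear[OF _ sub, of _ _ "\<lambda>x. umult unit3 x - x"])
       (auto simp: base umult_linear univ.scale_right_diff_distrib)
  moreover have "umult x unit3 - x \<in> {0}"
    using assms unfolding U_def
    by (rule span_expr_class_linear[OF _ sub, of _ _ "\<lambda>x. umult x unit3 - x"])
       (auto simp: base umult_linear univ.scale_right_diff_distrib)
  ultimately show "umult unit3 x = x" "umult x unit3 = x" by simp_all
qed

definition positions :: "nat \<Rightarrow> nat \<Rightarrow> bool" where
  "positions i k \<longleftrightarrow> (i, k) \<in> {(1, 2), (1, 3), (2, 3)}"

lemma positions_simps [simp]: "positions 1 2" "positions 1 3" "positions 2 3"
    "positions (Suc 0) 2" "positions (Suc 0) 3"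
  by (simp_all add: positions_def)

lemma insert_expr_props:
  assumes "positions i k" "length e = 2"
  shows "length (insert_expr i k e) = 3" "multilinear I e \<Longrightarrow> multilinear I (insert_expr i k e)"
    "normally_ordered e \<Longrightarrow> normally_ordered (insert_expr i k e)"
    "set (concat (insert_expr i k e)) = set (concat e)"
proof -
  obtain u v where e: "e = [u, v]" using assms(2) by (auto simp: numeral_2_eq_2 length_Suc_conv)
  have "\<exists>p q. [] = map A p @ map B q" by simp
  then show "length (insert_expr i k e) = 3" "multilinear I e \<Longrightarrow> multilinear I (insert_expr i k e)"
    "normally_ordered e \<Longrightarrow> normally_ordered (insert_expr i k e)"
    "set (concat (insert_expr i k e)) = set (concat e)"
    using assms(1) by (auto simp: positions_def e multilinear_def normally_ordered_def)
qed

lemma uinsert_in_U: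
  assumes "positions i k" "x \<in> U 2 N"
  shows "uinsert i k x \<in> U 3 N"
proof (rule span_expr_class_linear[OF assms(2)[unfolded U_def], of _ "uinsert i k"])
  show "univ.subspace (U 3 N)" by (simp add: U_def)
  fix e assume "e \<in> normal_exprs 2 N"
  then show "uinsert i k (expr_class e) \<in> U 3 N"
    unfolding uinsert_expr_class U_def
    using insert_expr_props[OF assms(1)]
    by (intro univ.span_base imageI) (auto simp: normal_exprs_def)
qed (auto simp: uinsert_linear)

lemma U_ternary: "x \<in> U 3 N \<Longrightarrow> x \<in> univ.span (expr_class ` ternary k (\<lambda>_. True))"
  unfolding U_def by (erule rev_subsetD) (intro univ.span_mono, auto simp: ternary_def normal_exprs_def)

lemma uinsert_ternary_empty:
  assumes "x \<in> U 2 N"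
  shows "uinsert 1 2 x \<in> univ.span (expr_class ` ternary 2 (\<lambda>w. w = []))"
    and "uinsert 2 3 x \<in> univ.span (expr_class ` ternary 0 (\<lambda>w. w = []))"
proof -
  have *: "\<exists>u v. e = [u, v]" if "e \<in> normal_exprs 2 N" for e
    using that by (auto simp: normal_exprs_def numeral_2_eq_2 length_Suc_conv)
  show "uinsert 1 2 x \<in> univ.span (expr_class ` ternary 2 (\<lambda>w. w = []))"
  proof (rule span_expr_class_linear[OF assms[unfolded U_def], of _ "uinsert 1 2"])
    fix e assume "e \<in> normal_exprs 2 N"
    then show "uinsert 1 2 (expr_class e) \<in> univ.span (expr_class ` ternary 2 (\<lambda>w. w = []))"
      unfolding uinsert_expr_class by (intro univ.span_base imageI) (auto dest!: * simp: ternary_def)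
  qed (auto simp: uinsert_linear)
  show "uinsert 2 3 x \<in> univ.span (expr_class ` ternary 0 (\<lambda>w. w = []))"
  proof (rule span_expr_class_linear[OF assms[unfolded U_def], of _ "uinsert 2 3"])
    fix e assume "e \<in> normal_exprs 2 N"
    then show "uinsert 2 3 (expr_class e) \<in> univ.span (expr_class ` ternary 0 (\<lambda>w. w = []))"
      unfolding uinsert_expr_class by (intro univ.span_base imageI) (auto dest!: * simp: ternary_def)
  qed (auto simp: uinsert_linear)
qed

section \<open>The one-sided ideals\<close>

abbreviation ends_B :: "letter list \<Rightarrow> bool" where
  "ends_B w \<equiv> \<exists>u i. w = u @ [B i]"

abbreviation starts_A :: "letter list \<Rightarrow> bool" where
  "starts_A w \<equiv> \<exists>u i. w = A i # u"

definition J3 :: "'k::field_char_0 univ set" where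
  "J3 = univ.span (expr_class ` ternary 2 ends_B)"

definition J1 :: "'k::field_char_0 univ set" where
  "J1 = univ.span (expr_class ` ternary 0 starts_A)"

lemma subspace_J3: "univ.subspace J3" and subspace_J1: "univ.subspace J1"
  by (simp_all add: J3_def J1_def)

text \<open>Multiplication from the left only prepends letters to the third factor, so its final
  \<open>b\<close> stays in place. From the right this holds for operands whose third factor is
  empty.\<close>

lemma J3_left: "x \<in> U 3 M \<Longrightarrow> y \<in> J3 \<Longrightarrow> umult x y \<in> J3"
  unfolding J3_def by (rule umult_ternary[OF stable_ends_B, of 2 _ "\<lambda>_. True" _ ends_B])
    (auto intro: U_ternary)

lemma J3_right: "x \<in> J3 \<Longrightarrow> y \<in> U 2 M \<Longrightarrow> umult x (uinsert 1 2 y) \<in> J3"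
  unfolding J3_def by (rule umult_ternary[OF stable_ends_B, of 2 _ ends_B _ "\<lambda>w. w = []"])
    (auto intro: uinsert_ternary_empty(1)[simplified])

lemma J1_right: "x \<in> J1 \<Longrightarrow> y \<in> U 3 M \<Longrightarrow> umult x y \<in> J1"
  unfolding J1_def by (rule umult_ternary[OF stable_starts_A, of 0 _ starts_A _ "\<lambda>_. True"])
    (auto intro: U_ternary)

lemma J1_left: "x \<in> J1 \<Longrightarrow> y \<in> U 2 M \<Longrightarrow> umult (uinsert 2 3 y) x \<in> J1"
  unfolding J1_def by (rule umult_ternary[OF stable_starts_A, of 0 _ "\<lambda>w. w = []" _ starts_A])
    (auto intro: uinsert_ternary_empty(2)[simplified])

lemma uinsert_in_J3:
  assumes "x \<in> univ.span (expr_class ` {e \<in> normal_exprs 2 N. \<exists>i. B i \<in> set (e ! 1)})" "i \<in> {1, 2}"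
  shows "uinsert i 3 x \<in> J3"
proof (rule span_expr_class_linear[OF assms(1) subspace_J3, of "uinsert i 3"])
  fix e assume "e \<in> {e \<in> normal_exprs 2 N. \<exists>i. B i \<in> set (e ! 1)}"
  then obtain k where e: "e \<in> normal_on 2 {1..N}" and k: "B k \<in> set (e ! 1)"
    unfolding normal_exprs_eq by blast
  then obtain P Q S T where w: "e = [map A P @ map B Q, map A S @ map B T]"
    unfolding normal_on_2_iff by blast
  with k have "T \<noteq> []" by auto
  then obtain T' t where "T = T' @ [t]" by (metis rev_exhaust)
  then have "insert_expr i 3 e \<in> ternary 2 ends_B"
    using assms(2) by (auto simp: w ternary_def)
  then show "uinsert i 3 (expr_class e) \<in> J3"
    unfolding uinsert_expr_class J3_def by (intro univ.span_base imageI)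
qed (auto simp: uinsert_linear)

lemma uinsert_in_J1:
  assumes "x \<in> univ.span (expr_class ` {e \<in> normal_exprs 2 N. \<exists>i. A i \<in> set (e ! 0)})" "k \<in> {2, 3}"
  shows "uinsert 1 k x \<in> J1"
proof (rule span_expr_class_linear[OF assms(1) subspace_J1, of "uinsert 1 k"])
  fix e assume "e \<in> {e \<in> normal_exprs 2 N. \<exists>i. A i \<in> set (e ! 0)}"
  then obtain l where e: "e \<in> normal_on 2 {1..N}" and l: "A l \<in> set (e ! 0)"
    unfolding normal_exprs_eq by blast
  then obtain P Q S T where w: "e = [map A P @ map B Q, map A S @ map B T]"
    unfolding normal_on_2_iff by blast
  with l have "P \<noteq> []" by auto
  then obtain p P' where "P = p # P'" by (cases P) auto
  then have "insert_expr 1 k e \<in> ternary 0 starts_A"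
    using assms(2) by (auto simp: w ternary_def)
  then show "uinsert 1 k (expr_class e) \<in> J1"
    unfolding uinsert_expr_class J1_def by (intro univ.span_base imageI)
qed (auto simp: uinsert_linear)

lemma hat_mult_mod:
  assumes "univ.subspace V" "P \<subseteq> {..m}" "\<And>p. p \<le> m \<Longrightarrow> p \<notin> P \<Longrightarrow> umult (X p) (Y (m - p)) \<in> V"
  shows "(X \<star> Y) m - (\<Sum>p\<in>P. umult (X p) (Y (m - p))) \<in> V"
proof -
  have "(X \<star> Y) m = (\<Sum>p\<in>P. umult (X p) (Y (m - p))) + (\<Sum>p\<in>{..m} - P. umult (X p) (Y (m - p)))"
    unfolding hat_mult_def using assms(2) by (simp add: sum.subset_diff add.commute)
  moreover have "(\<Sum>p\<in>{..m} - P. umult (X p) (Y (m - p))) \<in> V"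
    using assms(3) by (intro univ.subspace_sum[OF assms(1)]) auto
  ultimately show ?thesis by simp
qed

lemma hat_mult_in_U: "(\<And>p. X p \<in> U n p) \<Longrightarrow> (\<And>p. Y p \<in> U n p) \<Longrightarrow> (X \<star> Y) m \<in> U n m"
  unfolding hat_mult_def
proof (rule univ.subspace_sum)
  show "univ.subspace (U n m)" by (simp add: U_def)
  fix p assume "\<And>p. X p \<in> U n p" "\<And>p. Y p \<in> U n p" "p \<in> {..m}"
  then show "umult (X p) (Y (m - p)) \<in> U n m" using umult_in_U[of "X p" n p "Y (m - p)" "m - p"] by simp
qed

section \<open>Solutions of the quantum Yang--Baxter equation\<close>

locale qybe_solution =
  fixes R :: "'k::field_char_0 univ_hat"
  assumes R_in_U: "R \<in> U_hat 2"
    and qybe: "hat_insert 1 2 R \<star> hat_insert 1 3 R \<star> hat_insert 2 3 R =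
         hat_insert 2 3 R \<star> hat_insert 1 3 R \<star> hat_insert 1 2 R"
    and R_0: "component R 0 = hat_one 2"
    and R_1: "component R 1 = classical_r"
begin

definition R12 :: "nat \<Rightarrow> 'k univ" where "R12 p = uinsert 1 2 (R p)"
definition R13 :: "nat \<Rightarrow> 'k univ" where "R13 p = uinsert 1 3 (R p)"
definition R23 :: "nat \<Rightarrow> 'k univ" where "R23 p = uinsert 2 3 (R p)"

lemma in_U: "R p \<in> U 2 p" "R12 p \<in> U 3 p" "R13 p \<in> U 3 p" "R23 p \<in> U 3 p"
proof -
  show R: "R p \<in> U 2 p" using R_in_U by (simp add: U_hat_def)
  show "R12 p \<in> U 3 p" "R13 p \<in> U 3 p" "R23 p \<in> U 3 p"
    unfolding R12_def R13_def R23_def by (intro uinsert_in_U R positions_simps)+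
qed

lemma zeroth: "R12 0 = unit3" "R13 0 = unit3" "R23 0 = unit3"
proof -
  have "R 0 = expr_class [[], []]"
    using fun_cong[OF R_0, of 0] by (simp add: component_def hat_one_def numeral_2_eq_2)
  then show "R12 0 = unit3" "R13 0 = unit3" "R23 0 = unit3"
    by (simp_all add: R12_def R13_def R23_def uinsert_expr_class)
qed

lemma first: "R 1 = expr_class [[A 1], [B 1]]"
  using fun_cong[OF R_1, of 1] by (simp add: component_def classical_r_def)

lemma product_unit [simp]:
  "umult unit3 (R12 p) = R12 p" "umult unit3 (R13 p) = R13 p" "umult unit3 (R23 p) = R23 p"
  "umult (R12 p) unit3 = R12 p" "umult (R13 p) unit3 = R13 p" "umult (R23 p) unit3 = R23 p"
  using umult_unit[OF in_U(2)] umult_unit[OF in_U(3)] umult_unit[OF in_U(4)] by blast+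

lemma unit_unit [simp]: "umult unit3 unit3 = (unit3 :: 'k univ)"
  using product_unit(1)[of 0] by (simp only: zeroth)

lemma qybe_components: "((R12 \<star> R13) \<star> R23) n = ((R23 \<star> R13) \<star> R12) n"
  using fun_cong[OF qybe, of n] unfolding hat_insert_def R12_def R13_def R23_def .

lemma products_in_U: "(R12 \<star> R13) m \<in> U 3 m" "(R23 \<star> R13) m \<in> U 3 m"
  by (intro hat_mult_in_U in_U)+

lemma linearised_third:
  assumes N: "2 \<le> N" and J: "\<And>k. 1 \<le> k \<Longrightarrow> k < N \<Longrightarrow> R13 k \<in> J3 \<and> R23 k \<in> J3"
  shows "umult (R12 1) (R13 N) - umult (R13 N) (R12 1) + umult (R12 1) (R23 N) - umult (R23 N) (R12 1)
    + umult (R13 1) (R23 N) - umult (R23 1) (R13 N) \<in> J3"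
proof -
  note sub = subspace_J3
  note diff = univ.subspace_diff[OF sub] and add = univ.subspace_add[OF sub]
  define n where "n = N + 1"
  define D where "D = R12 \<star> R13"
  define E where "E = R23 \<star> R13"
  have DU: "D m \<in> U 3 m" and EU: "E m \<in> U 3 m" for m
    using products_in_U by (simp_all add: D_def E_def)
  have D01: "D 0 = unit3" "D 1 = R13 1 + R12 1"
    by (simp_all add: D_def hat_mult_def zeroth)
  have E0: "E 0 = unit3"
    by (simp add: E_def hat_mult_def zeroth)
  \<comment> \<open>A summand lies in the left ideal as soon as its right-hand operand has a degree
    from 1 to \<open>N - 1\<close>; the degrees n, N and 0 remain.\<close>
  have Dn: "D n - (R13 n + umult (R12 1) (R13 N) + R12 n) \<in> J3"
  proof -
    have "D n - (\<Sum>p\<in>{0, 1, n}. umult (R12 p) (R13 (n - p))) \<in> J3"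
      unfolding D_def
      by (rule hat_mult_mod[OF sub]) (use N in \<open>auto simp: n_def intro!: J3_left[OF in_U(2)] conjunct1[OF J]\<close>)
    then show ?thesis using N by (simp add: n_def zeroth add.assoc)
  qed
  have En: "E n - (R13 n + umult (R23 1) (R13 N) + R23 n) \<in> J3"
  proof -
    have "E n - (\<Sum>p\<in>{0, 1, n}. umult (R23 p) (R13 (n - p))) \<in> J3"
      unfolding E_def
      by (rule hat_mult_mod[OF sub]) (use N in \<open>auto simp: n_def intro!: J3_left[OF in_U(4)] conjunct1[OF J]\<close>)
    then show ?thesis using N by (simp add: n_def zeroth add.assoc)
  qed
  have EN: "E N - (R13 N + R23 N) \<in> J3"
  proof -
    have "E N - (\<Sum>p\<in>{0, N}. umult (R23 p) (R13 (N - p))) \<in> J3"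
      unfolding E_def
      by (rule hat_mult_mod[OF sub]) (use N in \<open>auto intro!: J3_left[OF in_U(4)] conjunct1[OF J]\<close>)
    then show ?thesis using N by (simp add: zeroth)
  qed
  have Em: "E m \<in> J3" if "1 \<le> m" "m < N" for m
  proof -
    have "E m - (\<Sum>p\<in>{m}. umult (R23 p) (R13 (m - p))) \<in> J3"
      unfolding E_def
      by (rule hat_mult_mod[OF sub]) (use that in \<open>auto intro!: J3_left[OF in_U(4)] conjunct1[OF J]\<close>)
    then show ?thesis using add[of _ "R23 m"] J[OF that] by (simp add: zeroth) (metis diff_add_cancel add)
  qed
  have L: "(D \<star> R23) n - (R23 n + umult (R13 1 + R12 1) (R23 N) + D n) \<in> J3"
  proof -
    have "(D \<star> R23) n - (\<Sum>p\<in>{0, 1, n}. umult (D p) (R23 (n - p))) \<in> J3"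
      by (rule hat_mult_mod[OF sub]) (use N in \<open>auto simp: n_def intro!: J3_left[OF DU] conjunct2[OF J]\<close>)
    then show ?thesis using N D01 umult_unit(2)[OF DU[of n]] by (simp add: n_def zeroth add.assoc)
  qed
  \<comment> \<open>Here the right-hand operand lives in the first two factors and preserves the
    ideal, so the condition falls on the degree of E, of which 0, N and n survive.\<close>
  have Rr: "(E \<star> R12) n - (R12 n + umult (E N) (R12 1) + E n) \<in> J3"
  proof -
    have "(E \<star> R12) n - (\<Sum>p\<in>{0, N, n}. umult (E p) (R12 (n - p))) \<in> J3"
    proof (rule hat_mult_mod[OF sub])
      fix p assume "p \<le> n" "p \<notin> {0, N, n}"
      then have "E p \<in> J3" by (intro Em) (auto simp: n_def)
      then show "umult (E p) (R12 (n - p)) \<in> J3" unfolding R12_def by (rule J3_right[OF _ in_U(1)])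
    qed (auto simp: n_def)
    then show ?thesis using N E0 umult_unit(2)[OF EU[of n]] by (simp add: n_def zeroth add.assoc)
  qed
  have EN': "umult (E N) (R12 1) - umult (R13 N + R23 N) (R12 1) \<in> J3"
    unfolding umult_diff[symmetric] R12_def by (rule J3_right[OF EN in_U(1)])
  have "(D \<star> R23) n = (E \<star> R12) n" unfolding D_def E_def by (rule qybe_components)
  then have eq: "umult (R12 1) (R13 N) - umult (R13 N) (R12 1) + umult (R12 1) (R23 N) - umult (R23 N) (R12 1)
    + umult (R13 1) (R23 N) - umult (R23 1) (R13 N) =
    ((E \<star> R12) n - (R12 n + umult (E N) (R12 1) + E n))
    + (umult (E N) (R12 1) - umult (R13 N + R23 N) (R12 1))
    + (E n - (R13 n + umult (R23 1) (R13 N) + R23 n))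
    - ((D \<star> R23) n - (R23 n + umult (R13 1 + R12 1) (R23 N) + D n))
    - (D n - (R13 n + umult (R12 1) (R13 N) + R12 n))"
    by (simp add: umult_linear algebra_simps)
  show ?thesis unfolding eq by (rule diff[OF diff[OF add[OF add[OF Rr EN'] En] L] Dn])
qed

text \<open>Both triple products are bracketed to the left, so this is not the literal mirror image
  of the preceding computation. The ideal now is a right ideal stable under left multiplication by
  elements of the last two factors, and more intermediate terms have to be kept before they turn out
  to lie in it.\<close>

lemma linearised_first:
  assumes N: "2 \<le> N" and J: "\<And>k. 1 \<le> k \<Longrightarrow> k < N \<Longrightarrow> R12 k \<in> J1 \<and> R13 k \<in> J1"
  shows "umult (R12 N) (R23 1) + umult (R13 N) (R23 1) - umult (R23 1) (R13 N) - umult (R23 1) (R12 N)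
    + umult (R12 N) (R13 1) - umult (R13 N) (R12 1) \<in> J1"
proof -
  note sub = subspace_J1
  note diff = univ.subspace_diff[OF sub] and add = univ.subspace_add[OF sub]
  define n where "n = N + 1"
  define D where "D = R12 \<star> R13"
  define E where "E = R23 \<star> R13"
  have DU: "D m \<in> U 3 m" and EU: "E m \<in> U 3 m" for m
    using products_in_U by (simp_all add: D_def E_def)
  have E01: "E 0 = unit3" "E 1 = R13 1 + R23 1"
    by (simp_all add: E_def hat_mult_def zeroth)
  have D0: "D 0 = unit3"
    by (simp add: D_def hat_mult_def zeroth)
  have left: "umult (R23 p) x \<in> J1" if "x \<in> J1" for p x
    unfolding R23_def by (rule J1_left[OF that in_U(1)])
  have Dn: "D n - (R13 n + umult (R12 N) (R13 1) + R12 n) \<in> J1"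
  proof -
    have "D n - (\<Sum>p\<in>{0, N, n}. umult (R12 p) (R13 (n - p))) \<in> J1"
      unfolding D_def
      by (rule hat_mult_mod[OF sub]) (use N in \<open>auto simp: n_def intro!: J1_right[OF _ in_U(3)] conjunct1[OF J]\<close>)
    then show ?thesis using N by (simp add: n_def zeroth add.assoc)
  qed
  have DN: "D N - (R13 N + R12 N) \<in> J1"
  proof -
    have "D N - (\<Sum>p\<in>{0, N}. umult (R12 p) (R13 (N - p))) \<in> J1"
      unfolding D_def
      by (rule hat_mult_mod[OF sub]) (use N in \<open>auto intro!: J1_right[OF _ in_U(3)] conjunct1[OF J]\<close>)
    then show ?thesis using N by (simp add: zeroth)
  qed
  have Dm: "D m \<in> J1" if "1 \<le> m" "m < N" for m
  proof -
    have "D m - (\<Sum>p\<in>{0}. umult (R12 p) (R13 (m - p))) \<in> J1"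
      unfolding D_def
      by (rule hat_mult_mod[OF sub]) (use that in \<open>auto intro!: J1_right[OF _ in_U(3)] conjunct1[OF J]\<close>)
    then show ?thesis using J[OF that] by (simp add: zeroth) (metis diff_add_cancel add)
  qed
  have En: "E n - (R13 n + umult (R23 1) (R13 N) + R23 n) \<in> J1"
  proof -
    have "E n - (\<Sum>p\<in>{0, 1, n}. umult (R23 p) (R13 (n - p))) \<in> J1"
      unfolding E_def
      by (rule hat_mult_mod[OF sub]) (use N in \<open>auto simp: n_def intro!: left conjunct2[OF J]\<close>)
    then show ?thesis using N by (simp add: n_def zeroth add.assoc)
  qed
  have EN: "E N - (R13 N + R23 N) \<in> J1"
  proof -
    have "E N - (\<Sum>p\<in>{0, N}. umult (R23 p) (R13 (N - p))) \<in> J1"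
      unfolding E_def
      by (rule hat_mult_mod[OF sub]) (use N in \<open>auto intro!: left conjunct2[OF J]\<close>)
    then show ?thesis using N by (simp add: zeroth)
  qed
  have Em: "E m - R23 m \<in> J1" if "1 \<le> m" "m < N" for m
  proof -
    have "E m - (\<Sum>p\<in>{m}. umult (R23 p) (R13 (m - p))) \<in> J1"
      unfolding E_def
      by (rule hat_mult_mod[OF sub]) (use that in \<open>auto intro!: left conjunct2[OF J]\<close>)
    then show ?thesis by (simp add: zeroth)
  qed
  have L: "(D \<star> R23) n - (R23 n + umult (D N) (R23 1) + D n) \<in> J1"
  proof -
    have "(D \<star> R23) n - (\<Sum>p\<in>{0, N, n}. umult (D p) (R23 (n - p))) \<in> J1"
      by (rule hat_mult_mod[OF sub]) (use N in \<open>auto simp: n_def intro!: J1_right[OF _ in_U(4)] Dm\<close>)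
    then show ?thesis using N D0 umult_unit(2)[OF DU[of n]] by (simp add: n_def zeroth add.assoc)
  qed
  \<comment> \<open>In the intermediate degrees \<open>E p\<close> is congruent to
    \<open>R23 p\<close>, which preserves the ideal from the left. The degree 1 is kept because
    \<open>R12 N\<close> is not known to lie in the ideal, the degree N because \<open>E N\<close>
    also involves \<open>R13 N\<close>.\<close>
  have Rr: "(E \<star> R12) n - (R12 n + umult (E 1) (R12 N) + umult (E N) (R12 1) + E n) \<in> J1"
  proof -
    have "(E \<star> R12) n - (\<Sum>p\<in>{0, 1, N, n}. umult (E p) (R12 (n - p))) \<in> J1"
    proof (rule hat_mult_mod[OF sub])
      fix p assume p: "p \<le> n" "p \<notin> {0, 1, N, n}"
      then have "E p - R23 p \<in> J1" by (intro Em) (auto simp: n_def)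
      then have "umult (E p - R23 p) (R12 (n - p)) \<in> J1" by (rule J1_right[OF _ in_U(2)])
      moreover have "umult (R23 p) (R12 (n - p)) \<in> J1"
        using p by (intro left conjunct1[OF J]) (auto simp: n_def)
      ultimately show "umult (E p) (R12 (n - p)) \<in> J1"
        using add[of "umult (E p - R23 p) (R12 (n - p))" "umult (R23 p) (R12 (n - p))"]
        by (simp add: umult_diff)
    qed (auto simp: n_def)
    then show ?thesis using N E01(1) umult_unit(2)[OF EU[of n]] by (simp add: n_def zeroth add.assoc)
  qed
  have DN': "umult (D N) (R23 1) - umult (R13 N + R12 N) (R23 1) \<in> J1"
    unfolding umult_diff[symmetric] by (rule J1_right[OF DN in_U(4)])
  have EN': "umult (E N) (R12 1) - umult (R13 N + R23 N) (R12 1) \<in> J1"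
    unfolding umult_diff[symmetric] by (rule J1_right[OF EN in_U(2)])
  have r1: "umult (R23 N) (R12 1) \<in> J1" using N by (intro left conjunct1[OF J]) auto
  have r2: "umult (R13 1) (R12 N) \<in> J1" using N by (intro J1_right[OF _ in_U(2)] conjunct2[OF J]) auto
  have "(D \<star> R23) n = (E \<star> R12) n" unfolding D_def E_def by (rule qybe_components)
  then have eq: "umult (R12 N) (R23 1) + umult (R13 N) (R23 1) - umult (R23 1) (R13 N) - umult (R23 1) (R12 N)
    + umult (R12 N) (R13 1) - umult (R13 N) (R12 1) =
    ((E \<star> R12) n - (R12 n + umult (E 1) (R12 N) + umult (E N) (R12 1) + E n))
    + (umult (E N) (R12 1) - umult (R13 N + R23 N) (R12 1))
    + (E n - (R13 n + umult (R23 1) (R13 N) + R23 n))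
    + umult (R23 N) (R12 1) + umult (R13 1) (R12 N)
    - ((D \<star> R23) n - (R23 n + umult (D N) (R23 1) + D n))
    - (umult (D N) (R23 1) - umult (R13 N + R12 N) (R23 1))
    - (D n - (R13 n + umult (R12 N) (R13 1) + R12 n))"
    unfolding E01(2) by (simp add: umult_linear algebra_simps)
  show ?thesis
    unfolding eq by (rule diff[OF diff[OF diff[OF add[OF add[OF add[OF add[OF Rr EN'] En] r1] r2] L] DN'] Dn])
qed

end

section \<open>The linearised equations for labelled expressions\<close>

definition linear_comb :: "nat \<Rightarrow> expr \<Rightarrow> 'k::field_char_0 comb" where
  "linear_comb j w =
     normal_order (juxtapose (r_expr 1 2 j) (insert_expr 1 3 w))
   - normal_order (juxtapose (insert_expr 1 3 w) (r_expr 1 2 j))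
   + normal_order (juxtapose (r_expr 1 2 j) (insert_expr 2 3 w))
   - normal_order (juxtapose (insert_expr 2 3 w) (r_expr 1 2 j))
   + normal_order (juxtapose (r_expr 1 3 j) (insert_expr 2 3 w))
   - normal_order (juxtapose (r_expr 2 3 j) (insert_expr 1 3 w))"

definition mirror_linear_comb :: "nat \<Rightarrow> expr \<Rightarrow> 'k::field_char_0 comb" where
  "mirror_linear_comb j w =
     normal_order (juxtapose (insert_expr 1 2 w) (r_expr 2 3 j))
   + normal_order (juxtapose (insert_expr 1 3 w) (r_expr 2 3 j))
   - normal_order (juxtapose (r_expr 2 3 j) (insert_expr 1 3 w))
   - normal_order (juxtapose (r_expr 2 3 j) (insert_expr 1 2 w))
   + normal_order (juxtapose (insert_expr 1 2 w) (r_expr 1 3 j))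
   - normal_order (juxtapose (insert_expr 1 3 w) (r_expr 1 2 j))"

lemma lin_val_linear_comb:
  "lin_val G (linear_comb j w) = linear_val G j w"
  "lin_val G (mirror_linear_comb j w) = mirror_linear_val G j w"
  by (simp_all add: linear_comb_def linear_val_def mirror_linear_comb_def mirror_linear_val_def
      normal_val_def lin_val_add lin_val_diff)

lemma renumber_r_expr: "renumber \<sigma> (r_expr i k j) = r_expr i k (\<sigma> j)"
  by (simp add: r_expr_def flip: insert_expr_renumber)

lemma linear_val_renumber:
  assumes "bij \<sigma>"
  shows "linear_val G (\<sigma> j) (renumber \<sigma> w) = linear_val (\<lambda>f. G (renumber \<sigma> f)) j w"
    and "mirror_linear_val G (\<sigma> j) (renumber \<sigma> w) = mirror_linear_val (\<lambda>f. G (renumber \<sigma> f)) j w"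
  unfolding linear_val_def mirror_linear_val_def
  by (simp_all only: insert_expr_renumber renumber_r_expr[symmetric] renumber_juxtapose[symmetric]
      normal_val_renumber[OF assms])

lemma set_concat_juxtapose:
  "length u = length v \<Longrightarrow> set (concat (juxtapose u v)) = set (concat u) \<union> set (concat v)"
  unfolding juxtapose_def by (induction u v rule: list_induct2) auto

lemma r_expr_props:
  assumes "positions i k"
  shows "length (r_expr i k j) = 3" "multilinear {j} (r_expr i k j)"
    "set (concat (r_expr i k j)) = {A j, B j}"
  using assms by (auto simp: positions_def multilinear_def r_expr_def)

lemma set_concat_terms:
  assumes "positions i k" "positions a b" "w \<in> normal_on 2 K"
  shows "set (concat (juxtapose (r_expr i k j) (insert_expr a b w))) = A ` insert j K \<union> B ` insert j K"
    and "set (concat (juxtapose (insert_expr a b w) (r_expr i k j))) = A ` insert j K \<union> B ` insert j K"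
proof -
  have "length w = 2" "set (concat w) = A ` K \<union> B ` K"
    using assms(3) by (simp_all add: normal_on_def multilinear_def)
  then have ins: "length (insert_expr a b w) = 3" "set (concat (insert_expr a b w)) = A ` K \<union> B ` K"
    using insert_expr_props[OF assms(2)] by simp_all
  note r = r_expr_props[OF assms(1), of j]
  have len: "length (r_expr i k j) = length (insert_expr a b w)" using ins(1) r(1) by simp
  show "set (concat (juxtapose (r_expr i k j) (insert_expr a b w))) = A ` insert j K \<union> B ` insert j K"
    unfolding set_concat_juxtapose[OF len] r(3) ins(2) by auto
  show "set (concat (juxtapose (insert_expr a b w) (r_expr i k j))) = A ` insert j K \<union> B ` insert j K"
    unfolding set_concat_juxtapose[OF len[symmetric]] r(3) ins(2) by auto
qed

lemma keys_diffD: "f \<in> Poly_Mapping.keys (x - y) \<Longrightarrow> f \<in> Poly_Mapping.keys x \<or> f \<in> Poly_Mapping.keys y"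
  and keys_addD: "f \<in> Poly_Mapping.keys (x + y) \<Longrightarrow> f \<in> Poly_Mapping.keys x \<or> f \<in> Poly_Mapping.keys y"
  for x y :: "'a \<Rightarrow>\<^sub>0 'b::ab_group_add"
  using Poly_Mapping.keys_diff[of x y] Poly_Mapping.keys_add[of x y] by blast+

lemma set_concat_linear_comb:
  assumes "w \<in> normal_on 2 K"
  shows "f \<in> Poly_Mapping.keys (linear_comb j w :: 'k::field_char_0 comb) \<Longrightarrow>
      set (concat f) = A ` insert j K \<union> B ` insert j K"
    and "f \<in> Poly_Mapping.keys (mirror_linear_comb j w :: 'k comb) \<Longrightarrow>
      set (concat f) = A ` insert j K \<union> B ` insert j K"
  unfolding linear_comb_def mirror_linear_comb_def
  by (elim keys_diffD[elim_format] keys_addD[elim_format] disjE;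
      drule keys_normal_order(2); simp only: set_concat_terms[OF _ _ assms] positions_simps)+

lemma umult_r_expr:
  assumes "positions i k" "positions a b" "v \<in> normal_on 2 {1..N}" "bij \<tau>" "j \<notin> \<tau> ` {1..N}"
  shows "umult (expr_class (r_expr i k 1)) (uinsert a b (expr_class v)) =
      Abs_univ (normal_order (juxtapose (r_expr i k j) (insert_expr a b (renumber \<tau> v))) :: 'k::field_char_0 comb)"
    and "umult (uinsert a b (expr_class v)) (expr_class (r_expr i k 1)) =
      Abs_univ (normal_order (juxtapose (insert_expr a b (renumber \<tau> v)) (r_expr i k j)) :: 'k comb)"
proof -
  have v: "multilinear {1..N} (insert_expr a b v)"
    using assms(3) insert_expr_props[OF assms(2)] by (simp add: normal_on_def)
  have inj: "inj_on \<tau> {1..N}" using assms(4) by (meson bij_is_inj inj_on_subset subset_UNIV)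
  note r = r_expr_props(2)[OF assms(1), of 1]
  show "umult (expr_class (r_expr i k 1)) (uinsert a b (expr_class v)) =
      Abs_univ (normal_order (juxtapose (r_expr i k j) (insert_expr a b (renumber \<tau> v))) :: 'k comb)"
    using umult_labelled[OF r v _ _ _ inj, of "\<lambda>_. j"] assms(5)
    by (simp add: uinsert_expr_class renumber_r_expr insert_expr_renumber)
  show "umult (uinsert a b (expr_class v)) (expr_class (r_expr i k 1)) =
      Abs_univ (normal_order (juxtapose (insert_expr a b (renumber \<tau> v)) (r_expr i k j)) :: 'k comb)"
    using umult_labelled[OF v r _ _ inj, of "\<lambda>_. j"] assms(5)
    by (simp add: uinsert_expr_class renumber_r_expr insert_expr_renumber)
qed

lemma linear_image_sum:
  assumes "\<And>x y. h (x + y) = h x + h y" "\<And>c x. h (uscale c x) = uscale c (h x)" "h 0 = 0"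
  shows "h (\<Sum>v\<in>V. uscale (F v) (f v)) = (\<Sum>v\<in>V. uscale (F v) (h (f v)))"
  by (induction V rule: infinite_finite_induct) (auto simp: assms)

context qybe_solution
begin

lemma r_classes: "R12 1 = expr_class (r_expr 1 2 1)" "R13 1 = expr_class (r_expr 1 3 1)"
    "R23 1 = expr_class (r_expr 2 3 1)"
  unfolding R12_def R13_def R23_def first uinsert_expr_class r_expr_def by simp_all

lemma labelled_equation_third:
  assumes "2 \<le> N" "\<And>k. 1 \<le> k \<Longrightarrow> k < N \<Longrightarrow> R13 k \<in> J3 \<and> R23 k \<in> J3"
    and F: "\<And>\<sigma> e. bij \<sigma> \<Longrightarrow> F (renumber \<sigma> e) = F e"
    and R: "R N = (\<Sum>v\<in>normal_exprs 2 N. uscale (F v) (expr_class v))"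
  shows "labelled_equation F N"
proof
  fix I :: "nat set" and G :: "expr \<Rightarrow> 'k"
  assume I: "finite I" "card I = Suc N" and G: "kills_third_B G"
  define h where "h x = umult (R12 1) (uinsert 1 3 x) - umult (uinsert 1 3 x) (R12 1)
    + umult (R12 1) (uinsert 2 3 x) - umult (uinsert 2 3 x) (R12 1)
    + umult (R13 1) (uinsert 2 3 x) - umult (R23 1) (uinsert 1 3 x)" for x
  have "(\<Sum>j\<in>I. \<Sum>w\<in>normal_on 2 (I - {j}). F w * lin_val G (linear_comb j w)) = 0"
  proof (rule labelled_equation_of_span[OF F, where X = "ternary 2 ends_B" and b = "\<lambda>v. h (expr_class v)"])
    show "h (expr_class v) = Abs_univ (linear_comb j (renumber \<tau> v))"
      if "v \<in> normal_on 2 {1..N}" "bij \<tau>" "j \<notin> \<tau> ` {1..N}" for v \<tau> j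
      unfolding h_def linear_comb_def r_classes Abs_univ_linear
      by (simp only: umult_r_expr[OF _ _ that] positions_simps)
    have "h (R N) \<in> J3"
      using linearised_third[OF assms(1,2)] by (simp add: h_def R12_def R13_def R23_def)
    also have "h (R N) = (\<Sum>v\<in>normal_exprs 2 N. uscale (F v) (h (expr_class v)))"
      unfolding R by (rule linear_image_sum)
        (simp_all add: h_def uinsert_linear umult_linear univ.scale_right_distrib
          univ.scale_right_diff_distrib)
    finally show "(\<Sum>v\<in>normal_exprs 2 N. uscale (F v) (h (expr_class v))) \<in> univ.span (expr_class ` ternary 2 ends_B)"
      unfolding J3_def .
    show "renumber \<sigma> e \<in> ternary 2 ends_B" if "e \<in> ternary 2 ends_B" for \<sigma> e
      using that by (auto simp: ternary_def renumber_def)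
    show "G e = 0" if e: "e \<in> ternary 2 ends_B" for e
    proof -
      obtain u i where "length e = 3" "e ! 2 = u @ [B i]" using e by (auto simp: ternary_def)
      then show ?thesis using G unfolding kills_third_B_def by (metis in_set_conv_decomp lessI numeral_3_eq_3 numeral_2_eq_2)
    qed
  qed (use I set_concat_linear_comb(1) in \<open>simp_all only: lin_val_linear_comb linear_val_renumber\<close>)
  then show "(\<Sum>j\<in>I. \<Sum>w\<in>normal_on 2 (I - {j}). F w * linear_val G j w) = 0"
    by (simp only: lin_val_linear_comb)
qed (use assms in auto)

text \<open>The mirror image of a functional that kills \<open>b\<close> in the third factor kills
  expressions whose first factor starts with \<open>a\<close>. Hence the equation modulo
  \<open>J1\<close> can be tested by mirrored functionals, and reindexing by the mirror gives the
  equation already studied, with mirrored coefficients.\<close>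

lemma labelled_equation_first:
  assumes "2 \<le> N" "\<And>k. 1 \<le> k \<Longrightarrow> k < N \<Longrightarrow> R12 k \<in> J1 \<and> R13 k \<in> J1"
    and F: "\<And>\<sigma> e. bij \<sigma> \<Longrightarrow> F (renumber \<sigma> e) = F e"
    and R: "R N = (\<Sum>v\<in>normal_exprs 2 N. uscale (F v) (expr_class v))"
  shows "labelled_equation (\<lambda>w. F (mirror w)) N"
proof
  fix I :: "nat set" and G :: "expr \<Rightarrow> 'k"
  assume I: "finite I" "card I = Suc N" and G: "kills_third_B G"
  define G' where "G' f = G (mirror f)" for f
  define h where "h x = umult (uinsert 1 2 x) (R23 1) + umult (uinsert 1 3 x) (R23 1)
    - umult (R23 1) (uinsert 1 3 x) - umult (R23 1) (uinsert 1 2 x)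
    + umult (uinsert 1 2 x) (R13 1) - umult (uinsert 1 3 x) (R12 1)" for x
  have "(\<Sum>j\<in>I. \<Sum>w\<in>normal_on 2 (I - {j}). F w * lin_val G' (mirror_linear_comb j w)) = 0"
  proof (rule labelled_equation_of_span[OF F, where X = "ternary 0 starts_A" and b = "\<lambda>v. h (expr_class v)"])
    show "h (expr_class v) = Abs_univ (mirror_linear_comb j (renumber \<tau> v))"
      if "v \<in> normal_on 2 {1..N}" "bij \<tau>" "j \<notin> \<tau> ` {1..N}" for v \<tau> j
      unfolding h_def mirror_linear_comb_def r_classes Abs_univ_linear
      by (simp only: umult_r_expr[OF _ _ that] positions_simps)
    have "h (R N) \<in> J1"
      using linearised_first[OF assms(1,2)] by (simp add: h_def R12_def R13_def R23_def)
    also have "h (R N) = (\<Sum>v\<in>normal_exprs 2 N. uscale (F v) (h (expr_class v)))"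
      unfolding R by (rule linear_image_sum)
        (simp_all add: h_def uinsert_linear umult_linear univ.scale_right_distrib
          univ.scale_right_diff_distrib)
    finally show "(\<Sum>v\<in>normal_exprs 2 N. uscale (F v) (h (expr_class v))) \<in> univ.span (expr_class ` ternary 0 starts_A)"
      unfolding J1_def .
    show "renumber \<sigma> e \<in> ternary 0 starts_A" if "e \<in> ternary 0 starts_A" for \<sigma> e
      using that by (auto simp: ternary_def renumber_def)
    show "G' e = 0" if e: "e \<in> ternary 0 starts_A" for e
    proof -
      obtain u i x y where "e = [A i # u, x, y]"
        using e by (auto simp: ternary_def numeral_3_eq_3 length_Suc_conv)
      then have "2 < length (mirror e)" "B i \<in> set (mirror e ! 2)" by simp_all
      then show ?thesis using G unfolding kills_third_B_def G'_def by blast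
    qed
  qed (use I set_concat_linear_comb(2) in \<open>simp_all only: lin_val_linear_comb linear_val_renumber\<close>)
  also have "(\<Sum>j\<in>I. \<Sum>w\<in>normal_on 2 (I - {j}). F w * lin_val G' (mirror_linear_comb j w)) =
      (\<Sum>j\<in>I. \<Sum>w\<in>normal_on 2 (I - {j}). F (mirror w) * linear_val G j w)"
  proof (rule sum.cong[OF refl])
    fix j
    have inj: "inj_on mirror X" for X by (metis inj_on_inverseI mirror_simps(4))
    have "(\<Sum>w\<in>normal_on 2 (I - {j}). F w * mirror_linear_val G' j w) =
        (\<Sum>w\<in>mirror ` normal_on 2 (I - {j}). F w * mirror_linear_val G' j w)"
      by (simp only: mirror_normal_on)
    also have "\<dots> = (\<Sum>w\<in>normal_on 2 (I - {j}). F (mirror w) * mirror_linear_val G' j (mirror w))"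
      by (simp only: sum.reindex[OF inj] comp_def)
    also have "\<dots> = (\<Sum>w\<in>normal_on 2 (I - {j}). F (mirror w) * linear_val G j w)"
      by (intro sum.cong refl) (simp add: mirror_linear_val_mirror G'_def)
    finally show "(\<Sum>w\<in>normal_on 2 (I - {j}). F w * lin_val G' (mirror_linear_comb j w)) =
        (\<Sum>w\<in>normal_on 2 (I - {j}). F (mirror w) * linear_val G j w)"
      by (simp only: lin_val_linear_comb)
  qed
  finally show "(\<Sum>j\<in>I. \<Sum>w\<in>normal_on 2 (I - {j}). F (mirror w) * linear_val G j w) = 0" .
qed (use assms in \<open>auto simp: mirror_renumber\<close>)

section \<open>The inductions on the degree\<close>

lemma in_span_of_coefficients:
  assumes "x = (\<Sum>v\<in>normal_exprs n N. uscale (F v) (expr_class v))"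
    and "\<And>v. v \<in> normal_exprs n N \<Longrightarrow> \<not> P v \<Longrightarrow> F v = 0"
  shows "x \<in> univ.span (expr_class ` {v \<in> normal_exprs n N. P v})"
  unfolding assms(1)
proof (rule univ.span_sum)
  fix v assume v: "v \<in> normal_exprs n N"
  show "uscale (F v) (expr_class v) \<in> univ.span (expr_class ` {v \<in> normal_exprs n N. P v})"
  proof (cases "P v")
    case True
    then show ?thesis using v by (intro univ.span_scale univ.span_base) blast
  next
    case False
    then show ?thesis using assms(2)[OF v] by (simp add: univ.span_zero)
  qed
qed

lemma r_normal: "[[A 1], [B 1]] \<in> normal_exprs 2 1"
proof -
  have "[A 1] = map A [1] @ map B []" "[B 1] = map A [] @ map B [1]" by simp_all
  then show ?thesis unfolding normal_exprs_eq normal_on_2_iff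
    by (intro exI[of _ "[1]"] exI[of _ "[]"]) (auto simp: permutations_of_set_iff)
qed

lemma B_in_second:
  "1 \<le> N \<Longrightarrow> R N \<in> univ.span (expr_class ` {e \<in> normal_exprs 2 N. \<exists>i. B i \<in> set (e ! 1)})"
proof (induction N rule: less_induct)
  case (less N)
  show ?case
  \<comment> \<open>Degree 1 is r itself, which lies in the span; the linear equation is used from
    degree 2 on.\<close>
  proof (cases "N = 1")
    case True
    then show ?thesis unfolding True first using r_normal by (intro univ.span_base imageI) simp
  next
    case False
    then have N: "2 \<le> N" using less.prems by simp
    have J: "R13 k \<in> J3 \<and> R23 k \<in> J3" if "1 \<le> k" "k < N" for k
      unfolding R13_def R23_def using uinsert_in_J3[OF less.IH[OF that(2,1)]] by simp
    obtain F where F: "\<And>\<sigma> e. bij \<sigma> \<Longrightarrow> F (renumber \<sigma> e) = F e"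
      and R: "R N = (\<Sum>v\<in>normal_exprs 2 N. uscale (F v) (expr_class v))"
      using U_coefficients[OF in_U(1)] by blast
    interpret labelled_equation F N by (rule labelled_equation_third[OF N J F R])
    show ?thesis
    proof (rule in_span_of_coefficients[OF R])
      fix v assume "v \<in> normal_exprs 2 N" "\<nexists>i. B i \<in> set (v ! 1)"
      then show "F v = 0"
        using no_B_in_second_factor[of "{1..N}" v] by (simp add: normal_exprs_eq)
    qed
  qed
qed

lemma A_in_first:
  "1 \<le> N \<Longrightarrow> R N \<in> univ.span (expr_class ` {e \<in> normal_exprs 2 N. \<exists>i. A i \<in> set (e ! 0)})"
proof (induction N rule: less_induct)
  case (less N)
  show ?case
  proof (cases "N = 1")
    case True
    then show ?thesis unfolding True first using r_normal by (intro univ.span_base imageI) simp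
  next
    case False
    then have N: "2 \<le> N" using less.prems by simp
    have J: "R12 k \<in> J1 \<and> R13 k \<in> J1" if "1 \<le> k" "k < N" for k
      unfolding R12_def R13_def using uinsert_in_J1[OF less.IH[OF that(2,1)]] by simp
    obtain F where F: "\<And>\<sigma> e. bij \<sigma> \<Longrightarrow> F (renumber \<sigma> e) = F e"
      and R: "R N = (\<Sum>v\<in>normal_exprs 2 N. uscale (F v) (expr_class v))"
      using U_coefficients[OF in_U(1)] by blast
    interpret labelled_equation "\<lambda>w. F (mirror w)" N by (rule labelled_equation_first[OF N J F R])
    show ?thesis
    proof (rule in_span_of_coefficients[OF R])
      fix v assume v: "v \<in> normal_exprs 2 N" "\<nexists>i. A i \<in> set (v ! 0)"
      then obtain x y where xy: "v = [x, y]"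
        by (auto simp: normal_exprs_def numeral_2_eq_2 length_Suc_conv)
      have "mirror v \<in> normal_on 2 {1..N}"
        using v(1) mirror_normal_on unfolding normal_exprs_eq by blast
      moreover have "B i \<notin> set (mirror v ! 1)" for i
      proof
        assume "B i \<in> set (mirror v ! 1)"
        then obtain z where "z \<in> set x" "B i = mirror_letter z" by (auto simp: xy set_mirror_word)
        moreover from this(2) have "z = A i" by (cases z) simp_all
        ultimately have "A i \<in> set (v ! 0)" by (simp add: xy)
        then show False using v(2) by blast
      qed
      ultimately show "F v = 0"
        using no_B_in_second_factor[of "{1..N}" "mirror v"] by simp
    qed
  qed
qed

end

theorem theorem3p1:
  fixes R :: "'k::field_char_0 univ_hat"
  assumes "R \<in> U_hat 2"
    and "hat_insert 1 2 R \<star> hat_insert 1 3 R \<star> hat_insert 2 3 R =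
         hat_insert 2 3 R \<star> hat_insert 1 3 R \<star> hat_insert 1 2 R"
    and "component R 0 = hat_one 2"
    and "component R 1 = classical_r"
  shows "\<forall>N\<ge>1. component R N \<in> Ug_UaUb0 \<and> component R N \<in> Ua0Ub_Ug"
proof -
  interpret qybe_solution R by standard (rule assms)+
  show ?thesis
    using B_in_second A_in_first
    by (simp add: Ug_UaUb0_def Ua0Ub_Ug_def completed_span_def component_def univ.span_zero)
qed

end
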